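(* For every $\epsilon>0$ the regularized Beckmann problem $$\inf\Big\{\int_\Omega w\,|q|\,dx+\frac{\epsilon}{\alpha}\|q\|_{L^\alpha(\Omega;\mathbb R^d)}^\alpha \;:\; q\in L^\alpha(\Omega;\mathbb R^d),\ \operatorname{div} q=\mu \text{ in } W^{-1,\alpha}_\perp(\Omega)\Big\}$$ has a unique solution (minimizer).
   Context: Setting: $d\in\mathbb N$; $\Omega\subset\mathbb R^d$ is a compact set whose interior is a bounded Lipschitz domain; $w:\Omega\to[0,\infty)$ is continuous; $1<\alpha<\frac{d}{d-1}$ and $\alpha'=\frac{\alpha}{\alpha-1}$; $\mu^+,\mu^-$ are Borel probability measures on $\Omega$ and $\mu:=\mu^+-\mu^-$. $|\cdot|$ is the Euclidean norm and $dx$ is Lebesgue measure; $\|q\|_{L^\alpha(\Omega;\mathbb R^d)}^\alpha=\int_\Omega|q|^\alpha dx$. Sobolev spaces $W^{1,p}(\Omega)$ are understood on the interior of $\Omega$. Definitions: $W^{1,p}_\emptyset(\Omega):=\{v\in W^{1,p}(\Omega):\int_\Omega v\,dx=0\}$. For $p\in(1,\infty)$ with conjugate exponent $p'$, $W^{-1,p}_\perp(\Omega):=\{v\in (W^{1,p'}(\Omega))^*:\langle v,1\rangle=0\}$. The divergence $\operatorname{div}:L^p(\Omega;\mathbb R^d)\to W^{-1,p}_\perp(\Omega)$ is defined by $\langle \operatorname{div}q,\phi\rangle:=-\int_\Omega q\cdot\nabla\phi\,dx$ for all $\phi\in W^{1,p'}_\emptyset(\Omega)$. Since $\alpha<\frac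 d{d-1}$, $W^{1,\alpha'}(\Omega)$ embeds into $C(\Omega)$, so $\mu$ is regarded as an element of $W^{-1,\alpha}_\perp(\Omega)$ via $\phi\mapsto\int_\Omega\phi\,d\mu$. Hence $\operatorname{div}q=\mu$ means $-\int_\Omega q\cdot\nabla\phi\,dx=\int_\Omega\phi\,d\mu$ for all $\phi\in W^{1,\alpha'}_\emptyset(\Omega)$. Standing assumption on $\Omega$: for every $\nu\in W^{-1,\alpha'}_\perp(\Omega)$ the equation $\operatorname{div}\nabla y=\nu$ in $W^{-1,\alpha'}_\perp(\Omega)$, i.e. $-\int_\Omega\nabla y\cdot\nabla\phi\,dx=\langle\nu,\phi\rangle$ for all $\phi\in W^{1,\alpha}_\emptyset(\Omega)$, has a unique solution $y\in W^{1,\alpha'}_\emptyset(\Omega)$. *)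

theory Defs
  imports "HOL-Analysis.Analysis" "HOL-Probability.Probability_Measure"
begin

section \<open>Bounded Lipschitz domains\<close>

text \<open>Near every boundary point, after a rotation sending \<open>e\<close> to the last coordinate direction,
  the domain is the region strictly above the graph of a Lipschitz function \<open>\<gamma>\<close> of the
  remaining coordinates, i.e. of a function on the hyperplane orthogonal to \<open>e\<close>.\<close>

definition bounded_lipschitz_domain :: "'a::euclidean_space set \<Rightarrow> bool" where
  "bounded_lipschitz_domain U \<longleftrightarrow>
     open U \<and> connected U \<and> U \<noteq> {} \<and> bounded U \<and>
     (\<forall>x\<in>frontier U. \<exists>r>0. \<exists>e L \<gamma>. norm e = 1 \<and> L-lipschitz_on {z. z \<bullet> e = 0} \<gamma> \<and>
        U \<inter> ball x r = {y \<in> ball x r. (\<gamma> (y - (y \<bullet> e) *\<^sub>R e) :: real) < y \<bullet> e})"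

section \<open>Lebesgue and Sobolev spaces\<close>

text \<open>Elements of Lebesgue and Sobolev spaces are represented by functions; two functions
  denote the same element iff they agree almost everywhere.\<close>

definition Lp_space :: "'a::euclidean_space set \<Rightarrow> real \<Rightarrow> ('a \<Rightarrow> 'b::euclidean_space) set" where
  "Lp_space S p = {f \<in> borel_measurable (lebesgue_on S).
                     integrable (lebesgue_on S) (\<lambda>x. norm (f x) powr p)}"

primrec k_times_cont_diff :: "nat \<Rightarrow> ('a::euclidean_space \<Rightarrow> real) \<Rightarrow> bool" where
  "k_times_cont_diff 0 f \<longleftrightarrow> continuous_on UNIV f"
| "k_times_cont_diff (Suc k) f \<longleftrightarrow> f differentiable_on UNIV \<and>
     (\<forall>b\<in>Basis. k_times_cont_diff k (\<lambda>x. frechet_derivative f (at x) b))"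

definition test_function :: "'a::euclidean_space set \<Rightarrow> ('a \<Rightarrow> real) \<Rightarrow> bool" where
  "test_function U \<psi> \<longleftrightarrow> (\<forall>k. k_times_cont_diff k \<psi>) \<and>
     compact (closure {x. \<psi> x \<noteq> 0}) \<and> closure {x. \<psi> x \<noteq> 0} \<subseteq> U"

definition locally_integrable ::
    "'a::euclidean_space set \<Rightarrow> ('a \<Rightarrow> 'b::euclidean_space) \<Rightarrow> bool" where
  "locally_integrable U f \<longleftrightarrow> (\<forall>K. compact K \<and> K \<subseteq> U \<longrightarrow> integrable (lebesgue_on K) f)"

definition has_weak_gradient ::
    "'a::euclidean_space set \<Rightarrow> ('a \<Rightarrow> real) \<Rightarrow> ('a \<Rightarrow> 'a) \<Rightarrow> bool" where
  "has_weak_gradient U v G \<longleftrightarrow> locally_integrable U v \<and> locally_integrable U G \<and>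
     (\<forall>\<psi>. test_function U \<psi> \<longrightarrow> (\<forall>b\<in>Basis.
        (LINT x|lebesgue_on U. v x * frechet_derivative \<psi> (at x) b) =
        - (LINT x|lebesgue_on U. (G x \<bullet> b) * \<psi> x)))"

text \<open>Weak gradients are unique up to null sets, so the choice below is immaterial.\<close>

definition weak_grad :: "'a::euclidean_space set \<Rightarrow> ('a \<Rightarrow> real) \<Rightarrow> 'a \<Rightarrow> 'a" where
  "weak_grad U v = (SOME G. has_weak_gradient U v G)"

definition W1 :: "'a::euclidean_space set \<Rightarrow> real \<Rightarrow> ('a \<Rightarrow> real) set" where
  "W1 U p = {v \<in> Lp_space U p. \<exists>G \<in> Lp_space U p. has_weak_gradient U v G}"

definition W1_norm :: "'a::euclidean_space set \<Rightarrow> real \<Rightarrow> ('a \<Rightarrow> real) \<Rightarrow> real" where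
  "W1_norm U p v = ((LINT x|lebesgue_on U. \<bar>v x\<bar> powr p) +
                    (LINT x|lebesgue_on U. norm (weak_grad U v x) powr p)) powr (1 / p)"

definition W1_mean0 :: "'a::euclidean_space set \<Rightarrow> real \<Rightarrow> ('a \<Rightarrow> real) set" where
  "W1_mean0 U p = {v \<in> W1 U p. (LINT x|lebesgue_on U. v x) = 0}"

definition conj_exp :: "real \<Rightarrow> real" where
  "conj_exp p = p / (p - 1)"

text \<open>The bounded linear functionals on \<open>W1 U (conj_exp p)\<close> that annihilate constants. Boundedness
  and linearity make such a functional respect equality almost everywhere.\<close>

definition Wneg1_perp :: "'a::euclidean_space set \<Rightarrow> real \<Rightarrow> (('a \<Rightarrow> real) \<Rightarrow> real) set" where
  "Wneg1_perp U p = {\<nu>.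
     (\<forall>\<phi>\<in>W1 U (conj_exp p). \<forall>\<psi>\<in>W1 U (conj_exp p). \<nu> (\<lambda>x. \<phi> x + \<psi> x) = \<nu> \<phi> + \<nu> \<psi>) \<and>
     (\<forall>c. \<forall>\<phi>\<in>W1 U (conj_exp p). \<nu> (\<lambda>x. c * \<phi> x) = c * \<nu> \<phi>) \<and>
     (\<exists>C. \<forall>\<phi>\<in>W1 U (conj_exp p). \<bar>\<nu> \<phi>\<bar> \<le> C * W1_norm U (conj_exp p) \<phi>) \<and>
     \<nu> (\<lambda>x. 1) = 0}"

section \<open>The divergence equation\<close>

definition weak_div :: "'a::euclidean_space set \<Rightarrow> ('a \<Rightarrow> 'a) \<Rightarrow> ('a \<Rightarrow> real) \<Rightarrow> real" where
  "weak_div U q \<phi> = - (LINT x|lebesgue_on U. q x \<bullet> weak_grad U \<phi> x)"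

text \<open>Unique solvability of the Neumann problem \<open>div (grad y) = \<nu>\<close> in \<open>Wneg1_perp U p\<close>.\<close>

definition neumann_uniquely_solvable :: "'a::euclidean_space set \<Rightarrow> real \<Rightarrow> bool" where
  "neumann_uniquely_solvable U p \<longleftrightarrow>
     (\<forall>\<nu>\<in>Wneg1_perp U p. \<exists>y\<in>W1_mean0 U p.
        (\<forall>\<phi>\<in>W1_mean0 U (conj_exp p). weak_div U (weak_grad U y) \<phi> = \<nu> \<phi>) \<and>
        (\<forall>z\<in>W1_mean0 U p.
           (\<forall>\<phi>\<in>W1_mean0 U (conj_exp p). weak_div U (weak_grad U z) \<phi> = \<nu> \<phi>) \<longrightarrow>
           (AE x in lebesgue_on U. z x = y x)))"

text \<open>Integrals of a Sobolev function against \<open>\<mu>p - \<mu>m\<close> are those of its continuous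
  representative \<open>g\<close>. If \<open>\<Omega> = closure (interior \<Omega>)\<close> then \<open>g\<close> is unique on \<open>\<Omega>\<close>. For exponents
  \<open>conj_exp p > d\<close> on a bounded Lipschitz domain it exists for every \<open>\<phi>\<close> by the Sobolev
  embedding, so that quantifying over \<open>g\<close> excludes no \<open>\<phi>\<close>.\<close>

definition continuous_representative ::
    "'a::euclidean_space set \<Rightarrow> ('a \<Rightarrow> real) \<Rightarrow> ('a \<Rightarrow> real) \<Rightarrow> bool" where
  "continuous_representative \<Omega> \<phi> g \<longleftrightarrow>
     continuous_on \<Omega> g \<and> (AE x in lebesgue_on (interior \<Omega>). g x = \<phi> x)"

definition div_eq_measure ::
    "'a::euclidean_space set \<Rightarrow> real \<Rightarrow> 'a measure \<Rightarrow> 'a measure \<Rightarrow> ('a \<Rightarrow> 'a) \<Rightarrow> bool" where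
  "div_eq_measure \<Omega> p \<mu>p \<mu>m q \<longleftrightarrow>
     (\<forall>\<phi>\<in>W1_mean0 (interior \<Omega>) (conj_exp p). \<forall>g. continuous_representative \<Omega> \<phi> g \<longrightarrow>
        weak_div (interior \<Omega>) q \<phi> = (LINT x|\<mu>p. g x) - (LINT x|\<mu>m. g x))"

section \<open>The regularized Beckmann problem\<close>

definition beckmann_admissible ::
    "'a::euclidean_space set \<Rightarrow> real \<Rightarrow> 'a measure \<Rightarrow> 'a measure \<Rightarrow> ('a \<Rightarrow> 'a) set" where
  "beckmann_admissible \<Omega> \<alpha> \<mu>p \<mu>m = {q \<in> Lp_space \<Omega> \<alpha>. div_eq_measure \<Omega> \<alpha> \<mu>p \<mu>m q}"

definition beckmann_objective ::
    "'a::euclidean_space set \<Rightarrow> ('a \<Rightarrow> real) \<Rightarrow> real \<Rightarrow> real \<Rightarrow> ('a \<Rightarrow> 'a) \<Rightarrow> real" where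
  "beckmann_objective \<Omega> w \<alpha> \<epsilon> q =
     (LINT x|lebesgue_on \<Omega>. w x * norm (q x)) +
     \<epsilon> / \<alpha> * (LINT x|lebesgue_on \<Omega>. norm (q x) powr \<alpha>)"

end

theory Submission
  imports Defs "HOL-Real_Asymp.Real_Asymp" "HOL-Computational_Algebra.Polynomial"
begin

text \<open>Existence and uniqueness are convex analysis once some admissible field exists. Uniform convexity
  of \<open>t \<mapsto> norm t powr p\<close>, in the form of a pointwise bound on its midpoint defect, makes minimising
  sequences Cauchy in \<open>L\<^sup>p\<close>, so a subsequence converges dominatedly and both the constraint and the
  objective pass to the limit. An admissible field is \<open>|G| ^ (p - 2) G\<close>, up to sign, where \<open>p\<close> is
  the exponent conjugate to \<open>\<alpha>\<close> and \<open>G\<close> is the limit of the gradients along a sequence minimising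
  \<open>norm (grad \<phi>) ^ p / p\<close> minus the integral of \<open>\<phi>\<close> against \<open>\<mu>\<close>. This functional is bounded
  below because \<open>p\<close> exceeds the dimension: the cone condition of a Lipschitz domain yields Morrey's
  estimate up to the boundary.\<close>

section \<open>Convergence in \<open>L\<^sup>p\<close> and uniform convexity\<close>

text \<open>Compactness always takes one form: almost everywhere convergence under an
  \<open>L^p\<close> majorant, so that constraint, objective and duality map all pass to the limit
  by dominated convergence. In the construction of the admissible field, the limit \<open>G\<close>
  of gradients is not known to belong to the set that is minimised over. The Euler-Lagrange equation
  is therefore derived for almost minimisers and only then sent to the limit. The lower bound rests
  on two facts. Both measures have mass one, so the integral of a function against their difference
  is unchanged by adding constants and is controlled by the oscillation. The oscillation is at most
  a constant times the \<open>L^p\<close> norm of the gradient, and that norm is exactly what the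
  minimised functional controls. Let \<open>d\<close> be the dimension. Averages over bumps
  contracted towards a point \<open>y\<close> change at a rate of at most a multiple of
  \<open>t powr (- d / p)\<close>, integrable at \<open>t = 0\<close> exactly when
  \<open>p > d\<close>. The bumps approach \<open>y\<close> from inside the domain, so the estimate
  includes boundary points \<open>y\<close>.\<close>

definition Lp_fun :: "'a measure \<Rightarrow> real \<Rightarrow> ('a \<Rightarrow> 'b::euclidean_space) \<Rightarrow> bool" where
  "Lp_fun M p f \<longleftrightarrow> f \<in> borel_measurable M \<and> integrable M (\<lambda>x. norm (f x) powr p)"

lemma Lp_fun_measurable: "Lp_fun M p f \<Longrightarrow> f \<in> borel_measurable M"
  and Lp_fun_integrable: "Lp_fun M p f \<Longrightarrow> integrable M (\<lambda>x. norm (f x) powr p)"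
  by (auto simp: Lp_fun_def)

lemma Lp_space_iff: "f \<in> Lp_space S p \<longleftrightarrow> Lp_fun (lebesgue_on S) p f"
  by (auto simp: Lp_space_def Lp_fun_def)

lemma powr_add_le:
  fixes a b p :: real
  assumes "0 \<le> a" "0 \<le> b" "0 < p"
  shows "(a + b) powr p \<le> 2 powr p * (a powr p + b powr p)"
proof -
  have "(a + b) powr p \<le> (2 * max a b) powr p"
    using assms by (intro powr_mono2) auto
  also have "\<dots> = 2 powr p * max a b powr p"
    using assms by (simp add: powr_mult)
  also have "\<dots> \<le> 2 powr p * (a powr p + b powr p)"
    by (intro mult_left_mono) (auto simp: max_def)
  finally show ?thesis .
qed

lemma Lp_fun_dominated:
  assumes "Lp_fun M p h" "f \<in> borel_measurable M" "AE x in M. norm (f x) \<le> norm (h x)" "0 < p"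
  shows "Lp_fun M p f"
  unfolding Lp_fun_def
proof
  show "integrable M (\<lambda>x. norm (f x) powr p)"
  proof (rule Bochner_Integration.integrable_bound[OF Lp_fun_integrable[OF assms(1)]])
    show "(\<lambda>x. norm (f x) powr p) \<in> borel_measurable M"
      using assms(2) by measurable
    show "AE x in M. norm (norm (f x) powr p) \<le> norm (norm (h x) powr p)"
      using assms(3) by eventually_elim (use assms(4) in \<open>auto intro: powr_mono2\<close>)
  qed
qed fact

lemma Lp_fun_norm: "Lp_fun M p f \<Longrightarrow> Lp_fun M p (\<lambda>x. norm (f x))"
  unfolding Lp_fun_def by auto

lemma Lp_fun_scaleR:
  assumes "Lp_fun M p f"
  shows "Lp_fun M p (\<lambda>x. c *\<^sub>R f x)"
  using assms by (auto simp: Lp_fun_def powr_mult)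

lemma Lp_fun_add:
  assumes "Lp_fun M p f" "Lp_fun M p g" "0 < p"
  shows "Lp_fun M p (\<lambda>x. f x + g x)"
  unfolding Lp_fun_def
proof
  note [measurable] = assms(1,2)[THEN Lp_fun_measurable]
  show "(\<lambda>x. f x + g x) \<in> borel_measurable M" by measurable
  show "integrable M (\<lambda>x. norm (f x + g x) powr p)"
  proof (rule Bochner_Integration.integrable_bound)
    show "integrable M (\<lambda>x. 2 powr p * (norm (f x) powr p + norm (g x) powr p))"
      using assms by (auto simp: Lp_fun_def)
    show "AE x in M. norm (norm (f x + g x) powr p)
        \<le> norm (2 powr p * (norm (f x) powr p + norm (g x) powr p))"
    proof (intro always_eventually allI)
      fix x
      have "norm (f x + g x) powr p \<le> (norm (f x) + norm (g x)) powr p"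
        using assms by (intro powr_mono2 norm_triangle_ineq) auto
      also have "\<dots> \<le> 2 powr p * (norm (f x) powr p + norm (g x) powr p)"
        by (intro powr_add_le) (use assms in auto)
      finally show "norm (norm (f x + g x) powr p)
        \<le> norm (2 powr p * (norm (f x) powr p + norm (g x) powr p))" by simp
    qed
  qed measurable
qed

lemma Lp_fun_lincomb:
  "Lp_fun M p f \<Longrightarrow> Lp_fun M p g \<Longrightarrow> 0 < p \<Longrightarrow> Lp_fun M p (\<lambda>x. s *\<^sub>R f x + t *\<^sub>R g x)"
  by (intro Lp_fun_add Lp_fun_scaleR)

lemma Lp_fun_diff:
  assumes "Lp_fun M p f" "Lp_fun M p g" "0 < p"
  shows "Lp_fun M p (\<lambda>x. f x - g x)"
  using Lp_fun_lincomb[OF assms, of 1 "-1"] by simp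

section \<open>Conjugate exponents and Hoelder's inequality\<close>

lemma conj_exp_props:
  assumes "1 < p"
  shows "1 < conj_exp p" "1 / p + 1 / conj_exp p = 1" "conj_exp (conj_exp p) = p"
    "(p - 1) * conj_exp p = p"
  using assms by (auto simp: conj_exp_def divide_simps)

lemma Youngs_conj_exp:
  fixes a b :: real
  assumes "1 < p" "0 \<le> a" "0 \<le> b"
  shows "a * b \<le> a powr p / p + b powr conj_exp p / conj_exp p"
  using assms conj_exp_props[OF assms(1)] by (intro Youngs_inequality) auto

lemma integrable_inner_Lp:
  fixes f g :: "'a \<Rightarrow> 'b::euclidean_space"
  assumes "1 < p" "Lp_fun M p f" "Lp_fun M (conj_exp p) g"
  shows "integrable M (\<lambda>x. norm (f x) * norm (g x))" "integrable M (\<lambda>x. f x \<bullet> g x)"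
proof -
  note [measurable] = assms(2,3)[THEN Lp_fun_measurable]
  note q = conj_exp_props[OF assms(1)]
  show *: "integrable M (\<lambda>x. norm (f x) * norm (g x))"
  proof (rule Bochner_Integration.integrable_bound)
    show "integrable M (\<lambda>x. norm (f x) powr p / p + norm (g x) powr conj_exp p / conj_exp p)"
      using assms by (auto simp: Lp_fun_def)
    show "AE x in M. norm (norm (f x) * norm (g x))
        \<le> norm (norm (f x) powr p / p + norm (g x) powr conj_exp p / conj_exp p)"
      using Youngs_conj_exp[OF assms(1)] q assms(1) by (intro always_eventually) auto
  qed measurable
  show "integrable M (\<lambda>x. f x \<bullet> g x)"
    by (rule Bochner_Integration.integrable_bound[OF *]) (auto simp: Cauchy_Schwarz_ineq2)
qed

text \<open>Young's inequality for the two functions divided by their norms \<open>a\<close> and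
  \<open>b\<close>; the right side then integrates to \<open>1 / p + 1 / conj_exp p = 1\<close>. A
  vanishing norm cannot be divided by, but makes the product vanish almost everywhere.\<close>

lemma Holder_inequality_inner:
  fixes f g :: "'a \<Rightarrow> 'b::euclidean_space"
  assumes "1 < p" "Lp_fun M p f" "Lp_fun M (conj_exp p) g"
  shows "\<bar>LINT x|M. f x \<bullet> g x\<bar> \<le> (LINT x|M. norm (f x) powr p) powr (1 / p)
     * (LINT x|M. norm (g x) powr conj_exp p) powr (1 / conj_exp p)"
proof -
  define q where "q = conj_exp p"
  define A where "A = (LINT x|M. norm (f x) powr p)"
  define B where "B = (LINT x|M. norm (g x) powr q)"
  note q = conj_exp_props[OF assms(1), folded q_def]
  note [measurable] = assms(2,3)[THEN Lp_fun_measurable]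
  have AB: "0 \<le> A" "0 \<le> B" by (auto simp: A_def B_def)
  note int = integrable_inner_Lp[OF assms]
  have le: "\<bar>LINT x|M. f x \<bullet> g x\<bar> \<le> (LINT x|M. norm (f x) * norm (g x))"
    by (rule order_trans[OF integral_abs_bound integral_mono])
       (use int in \<open>auto simp: Cauchy_Schwarz_ineq2\<close>)
  show ?thesis
  proof (cases "A = 0 \<or> B = 0")
    case True
    have "AE x in M. norm (f x) * norm (g x) = 0"
    proof (cases "A = 0")
      case True
      then have "AE x in M. norm (f x) powr p = 0"
        unfolding A_def by (subst (asm) integral_nonneg_eq_0_iff_AE) (use assms in \<open>auto simp: Lp_fun_def\<close>)
      then show ?thesis by eventually_elim auto
    next
      case False
      then have "B = 0" using True by simp
      then have "AE x in M. norm (g x) powr q = 0"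
        unfolding B_def by (subst (asm) integral_nonneg_eq_0_iff_AE) (use assms in \<open>auto simp: Lp_fun_def q_def\<close>)
      then show ?thesis by eventually_elim auto
    qed
    then have "(LINT x|M. norm (f x) * norm (g x)) = 0"
      by (rule integral_eq_zero_AE)
    then show ?thesis using le by (simp add: order_trans[OF _ mult_nonneg_nonneg])
  next
    case False
    define a where "a = A powr (1 / p)"
    define b where "b = B powr (1 / q)"
    have ab: "a > 0" "b > 0" "a powr p = A" "b powr q = B"
      using False AB q assms(1) by (auto simp: a_def b_def powr_powr)
    have "(LINT x|M. norm (f x) * norm (g x))
        \<le> (LINT x|M. a * b * (norm (f x) powr p / (A * p) + norm (g x) powr q / (B * q)))"
    proof (rule integral_mono[OF int(1)])
      show "integrable M (\<lambda>x. a * b * (norm (f x) powr p / (A * p) + norm (g x) powr q / (B * q)))"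
        using assms by (auto simp: Lp_fun_def q_def)
      fix x
      have "norm (f x) / a * (norm (g x) / b)
          \<le> (norm (f x) / a) powr p / p + (norm (g x) / b) powr q / q"
        unfolding q_def by (intro Youngs_conj_exp) (use ab assms in auto)
      then have "norm (f x) * norm (g x)
          \<le> a * b * ((norm (f x) / a) powr p / p + (norm (g x) / b) powr q / q)"
        using ab by (simp add: field_simps)
      then show "norm (f x) * norm (g x)
          \<le> a * b * (norm (f x) powr p / (A * p) + norm (g x) powr q / (B * q))"
        using ab by (simp add: powr_divide)
    qed
    also have "\<dots> = a * b * (A / (A * p) + B / (B * q))"
      using assms by (subst integral_mult_right_zero, subst Bochner_Integration.integral_add)
        (auto simp: Lp_fun_def q_def A_def B_def)
    also have "\<dots> = a * b"
      using False q by simp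
    finally show ?thesis
      using le by (simp add: a_def b_def A_def B_def q_def)
  qed
qed

section \<open>Strict and uniform convexity of powers of the norm\<close>

text \<open>The mean value theorem on both halves of \<open>[x, y]\<close>: they have equal length,
  and the derivative \<open>p * t powr (p - 1)\<close> is strictly larger on the right half. At the
  endpoint \<open>x\<close>, which may be 0, just continuity is used.\<close>

lemma powr_midpoint_strict:
  fixes x y p :: real
  assumes "1 < p" "0 \<le> x" "x < y"
  shows "((x + y) / 2) powr p < (x powr p + y powr p) / 2"
proof -
  define m where "m = (x + y) / 2"
  have m: "x < m" "m < y" "m - x = (y - x) / 2" "y - m = (y - x) / 2"
    using assms by (auto simp: m_def field_simps)
  have der: "((\<lambda>t. t powr p) has_real_derivative p * t powr (p - 1)) (at t)" if "0 < t" for t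
    using that by (auto intro!: derivative_eq_intros simp: powr_diff)
  have cont: "continuous_on {a..b} (\<lambda>t. t powr p)" if "0 \<le> a" for a b :: real
    using assms(1) that by (intro continuous_on_powr' continuous_intros) auto
  obtain s where s: "x < s" "s < m" "m powr p - x powr p = (m - x) * (p * s powr (p - 1))"
  proof -
    have "\<exists>l z. x < z \<and> z < m \<and> ((\<lambda>t. t powr p) has_real_derivative l) (at z) \<and> m powr p - x powr p = (m - x) * l"
      by (rule MVT[OF m(1) cont[OF assms(2)]])
         (use der assms(2) in \<open>auto simp: real_differentiable_def intro: le_less_trans\<close>)
    then obtain l z where z: "x < z" "z < m" "((\<lambda>t. t powr p) has_real_derivative l) (at z)"
      "m powr p - x powr p = (m - x) * l" by blast
    moreover have "l = p * z powr (p - 1)"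
      using z assms by (intro DERIV_unique[OF z(3) der]) auto
    ultimately show ?thesis using that by blast
  qed
  obtain t where t: "m < t" "t < y" "y powr p - m powr p = (y - m) * (p * t powr (p - 1))"
  proof -
    have "\<exists>l z. m < z \<and> z < y \<and> ((\<lambda>t. t powr p) has_real_derivative l) (at z) \<and> y powr p - m powr p = (y - m) * l"
      by (rule MVT[OF m(2) cont])
         (use der assms(2) m(1) in \<open>auto simp: real_differentiable_def intro!: exI der\<close>)
    then obtain l z where z: "m < z" "z < y" "((\<lambda>t. t powr p) has_real_derivative l) (at z)"
      "y powr p - m powr p = (y - m) * l" by blast
    moreover have "l = p * z powr (p - 1)"
      using z assms m by (intro DERIV_unique[OF z(3) der]) auto
    ultimately show ?thesis using that by blast
  qed
  have "s powr (p - 1) < t powr (p - 1)"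
    using s t assms by (intro powr_less_mono2) auto
  then have "m powr p - x powr p < y powr p - m powr p"
    unfolding s(3) t(3) m(3,4) using assms by (simp add: mult_strict_left_mono)
  then show ?thesis by (simp add: m_def)
qed

text \<open>With equal norms the triangle inequality is strict, because equality would force
  \<open>norm a *\<^sub>R b = norm b *\<^sub>R a\<close> and hence \<open>a = b\<close>. With
  different norms strictness comes from the scalar inequality.\<close>

lemma norm_powr_midpoint_strict:
  fixes a b :: "'b::euclidean_space"
  assumes "1 < p" "a \<noteq> b"
  shows "norm ((1/2) *\<^sub>R (a + b)) powr p < (norm a powr p + norm b powr p) / 2"
proof (cases "norm a = norm b")
  case True
  have "norm (a + b) \<noteq> norm a + norm b"
  proof
    assume "norm (a + b) = norm a + norm b"
    then have "norm a *\<^sub>R b = norm b *\<^sub>R a" by (simp only: norm_triangle_eq)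
    then show False using assms(2) True by (cases "norm b = 0") auto
  qed
  then have "norm ((1/2) *\<^sub>R (a + b)) < norm b"
    using norm_triangle_ineq[of a b] True by (auto simp: less_le)
  then have "norm ((1/2) *\<^sub>R (a + b)) powr p < norm b powr p"
    using assms(1) by (intro powr_less_mono2) auto
  then show ?thesis using True by simp
next
  case False
  have "norm ((1/2) *\<^sub>R (a + b)) powr p \<le> ((norm a + norm b) / 2) powr p"
    using assms(1) norm_triangle_ineq[of a b] by (intro powr_mono2) auto
  also have "\<dots> < (norm a powr p + norm b powr p) / 2"
    using powr_midpoint_strict[of p "norm a" "norm b"] powr_midpoint_strict[of p "norm b" "norm a"]
      False assms(1) by (cases "norm a < norm b") (auto simp: add.commute)
  finally show ?thesis .
qed

lemma norm_powr_midpoint: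
  fixes a b :: "'b::euclidean_space"
  assumes "1 < p"
  shows "norm ((1/2) *\<^sub>R (a + b)) powr p \<le> (norm a powr p + norm b powr p) / 2"
proof (cases "a = b")
  case True
  have "(1/2) *\<^sub>R (b + b) = b"
    by (simp flip: scaleR_2)
  then show ?thesis using True by simp
qed (use norm_powr_midpoint_strict[OF assms] in \<open>auto intro: less_imp_le\<close>)

text \<open>By homogeneity it suffices to bound the strictly positive midpoint defect from below on a
  compact set; this replaces Clarkson's inequalities for every exponent.\<close>

lemma uniform_convexity_pointwise:
  fixes p e :: real
  assumes "1 < p" "0 < e"
  obtains K where "0 \<le> K" "\<And>a b :: 'b::euclidean_space. norm (a - b) powr p
     \<le> e * (norm a powr p + norm b powr p)
       + K * ((norm a powr p + norm b powr p) / 2 - norm ((1/2) *\<^sub>R (a + b)) powr p)"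
proof -
  define D where "D = (\<lambda>(a, b :: 'b). (norm a powr p + norm b powr p) / 2 - norm ((1/2) *\<^sub>R (a + b)) powr p)"
  \<comment> \<open>Normalised pairs that are separated at scale \<open>e\<close>: a compact set
    that misses the diagonal, and the defect \<open>D\<close> vanishes on the diagonal
    alone.\<close>
  define S where "S = {(a, b :: 'b). norm a powr p + norm b powr p = 1 \<and> e \<le> norm (a - b) powr p}"
  have c: "continuous_on A (\<lambda>z. norm (f z :: 'b) powr p)" if "continuous_on A f" for A :: "('b \<times> 'b) set" and f
    using assms(1) by (intro continuous_on_powr' continuous_intros that) auto
  have D0: "0 \<le> D z" for z
    using norm_powr_midpoint[OF assms(1), of "fst z" "snd z"] by (simp add: D_def split_beta)
  have "closed {z :: 'b \<times> 'b. norm (fst z) powr p + norm (snd z) powr p = 1}"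
    by (intro closed_Collect_eq continuous_intros c)
  moreover have "closed {z :: 'b \<times> 'b. e \<le> norm (fst z - snd z) powr p}"
    by (intro closed_Collect_le continuous_intros c)
  ultimately have "closed S"
    unfolding S_def split_beta by (auto simp: Collect_conj_eq)
  moreover have "bounded S"
  proof -
    have le1: "norm a \<le> 1" if "norm a powr p \<le> 1" for a :: 'b
    proof (rule ccontr)
      assume "\<not> norm a \<le> 1"
      then have "1 powr p < norm a powr p" using assms(1) by (intro powr_less_mono2) auto
      then show False using that by simp
    qed
    have "S \<subseteq> cball 0 1 \<times> cball 0 1"
      by (auto simp: S_def intro!: le1) (metis add_increasing2 le_add_same_cancel1 powr_ge_zero le_add_same_cancel2)+
    then show ?thesis
      by (rule bounded_subset[rotated]) (auto intro: bounded_Times)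
  qed
  ultimately have "compact S" by (simp add: compact_eq_bounded_closed)
  have "\<exists>d>0. \<forall>z\<in>S. d \<le> D z"
  proof (cases "S = {}")
    case False
    have "continuous_on S D"
      unfolding D_def split_beta by (intro continuous_intros c) auto
    then obtain z where z: "z \<in> S" "\<forall>y\<in>S. D z \<le> D y"
      using continuous_attains_inf[OF \<open>compact S\<close> False] by blast
    have "fst z \<noteq> snd z"
      using z(1) assms by (auto simp: S_def)
    then have "0 < D z"
      using norm_powr_midpoint_strict[OF assms(1), of "fst z" "snd z"] by (simp add: D_def split_beta)
    then show ?thesis using z by blast
  qed (auto intro: exI[of _ 1])
  then obtain d where d: "0 < d" "\<And>z. z \<in> S \<Longrightarrow> d \<le> D z" by blast
  \<comment> \<open>For a normalised pair in \<open>S\<close> the left side is at most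
    \<open>2 powr p\<close> and the defect at least \<open>d\<close>.\<close>
  define K where "K = 2 powr p / d"
  have main: "norm (a - b) powr p \<le> e * (norm a powr p + norm b powr p) + K * D (a, b)" for a b :: 'b
  proof (cases "norm (a - b) powr p \<le> e * (norm a powr p + norm b powr p)")
    case True
    moreover have "0 \<le> K * D (a, b)"
      using d(1) D0 by (auto simp: K_def)
    ultimately show ?thesis by linarith
  next
    case False
    define T where "T = norm a powr p + norm b powr p"
    define s where "s = T powr (1 / p)"
    have "T \<noteq> 0"
    proof
      assume "T = 0"
      then have "norm a powr p = 0" "norm b powr p = 0"
        unfolding T_def by (smt (verit) powr_ge_zero)+
      then show False using False by auto
    qed
    then have T: "T > 0" unfolding T_def by (smt (verit) powr_ge_zero)
    then have s: "s > 0" "s powr p = T"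
      using assms(1) by (auto simp: s_def powr_powr)
    have sc: "norm ((1/s) *\<^sub>R v) powr p = norm v powr p / T" for v :: 'b
      using s by (simp add: powr_divide)
    have "D ((1/s) *\<^sub>R a, (1/s) *\<^sub>R b) = D (a, b) / T"
    proof -
      have "(1/2) *\<^sub>R ((1/s) *\<^sub>R a + (1/s) *\<^sub>R b) = (1/s) *\<^sub>R ((1/2) *\<^sub>R (a + b))"
        by (simp add: algebra_simps)
      then show ?thesis
        unfolding D_def split by (simp only: sc) (simp only: add_divide_distrib diff_divide_distrib, simp)
    qed
    moreover have "((1/s) *\<^sub>R a, (1/s) *\<^sub>R b) \<in> S"
    proof -
      have "norm a powr p / T + norm b powr p / T = 1"
        using T by (simp add: T_def flip: add_divide_distrib)
      moreover have "e \<le> norm (a - b) powr p / T"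
        using False T by (simp add: T_def field_simps)
      ultimately show ?thesis
        by (simp only: S_def mem_Collect_eq split sc scaleR_diff_right[symmetric] conj_absorb simp_thms)
    qed
    ultimately have "d \<le> D (a, b) / T" using d(2) by metis
    then have "T * d \<le> D (a, b)"
      using T by (simp add: field_simps)
    have "norm (a - b) powr p \<le> (norm a + norm b) powr p"
      using assms(1) by (intro powr_mono2 norm_triangle_ineq4) auto
    also have "\<dots> \<le> 2 powr p * T"
      unfolding T_def by (rule powr_add_le) (use assms in auto)
    also have "\<dots> \<le> K * D (a, b)"
      using \<open>T * d \<le> D (a, b)\<close> d(1) by (simp add: K_def field_simps)
    also have "\<dots> \<le> e * T + K * D (a, b)" using assms T by simp
    finally show ?thesis by (simp add: T_def)
  qed
  show ?thesis
    by (rule that[of K]) (use main d in \<open>auto simp: K_def D_def\<close>)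
qed

section \<open>Convergence of minimising sequences\<close>

text \<open>The completeness argument for \<open>L^p\<close>, keeping its majorant. Increments are
  weighted by \<open>2 powr (k * p)\<close>, so that one integrable sum \<open>F\<close> bounds each
  of them by \<open>(1/2) ^ k * F powr (1/p)\<close>. Pointwise summation then gives convergence and
  domination together, for every \<open>p > 0\<close>.\<close>

lemma Lp_Cauchy_dominated_subsequence:
  fixes f :: "nat \<Rightarrow> 'a \<Rightarrow> 'b::euclidean_space"
  assumes p: "0 < p" and f: "\<And>n. Lp_fun M p (f n)"
    and Cauchy: "\<And>e. 0 < e \<Longrightarrow> \<exists>N. \<forall>m\<ge>N. \<forall>n\<ge>N. (LINT x|M. norm (f m x - f n x) powr p) < e"
  obtains r g and h :: "'a \<Rightarrow> real" where "strict_mono r" "Lp_fun M p g" "Lp_fun M p h"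
    "AE x in M. \<forall>n. norm (f (r n) x) \<le> h x" "AE x in M. (\<lambda>n. f (r n) x) \<longlonglongrightarrow> g x"
proof -
  note [measurable] = f[THEN Lp_fun_measurable]
  \<comment> \<open>The divisor cancels the weight put into \<open>u k\<close>; the factor
    \<open>(1/2) ^ k\<close> makes the weighted integrals summable.\<close>
  define c where "c k = (1/2) ^ k / 2 powr (real k * p)" for k :: nat
  have "\<forall>k. \<exists>N. \<forall>m\<ge>N. \<forall>n\<ge>N. (LINT x|M. norm (f m x - f n x) powr p) < c k"
    by (intro allI Cauchy) (simp add: c_def)
  then obtain N where N: "\<And>k m n. m \<ge> N k \<Longrightarrow> n \<ge> N k \<Longrightarrow> (LINT x|M. norm (f m x - f n x) powr p) < c k"
    by metis
  define r where "r k = (\<Sum>i\<le>k. Suc (N i))" for k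
  have r: "strict_mono r" by (simp add: strict_mono_Suc_iff r_def)
  have rN: "N k \<le> r k" for k
    using member_le_sum[of k "{..k}" "\<lambda>i. Suc (N i)"] by (simp add: r_def)
  define u where "u k x = 2 powr (real k * p) * norm (f (r (Suc k)) x - f (r k) x) powr p" for k x
  have u0: "0 \<le> u k x" for k x by (simp add: u_def)
  have [measurable]: "u k \<in> borel_measurable M" for k unfolding u_def by measurable
  have u_int: "integrable M (u k)" for k
    unfolding u_def using Lp_fun_diff[OF f f p] by (auto simp: Lp_fun_def)
  have u_le: "(LINT x|M. u k x) \<le> (1/2) ^ k" for k
  proof -
    have "N k \<le> r (Suc k)" using rN[of k] strict_monoD[OF r, of k "Suc k"] by simp
    from N[OF this rN[of k]] show ?thesis
      unfolding u_def c_def by (simp add: field_simps)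
  qed
  define F where "F x = (\<Sum>k. ennreal (u k x))" for x
  have [measurable]: "F \<in> borel_measurable M" unfolding F_def by measurable
  have "(\<integral>\<^sup>+x. F x \<partial>M) = (\<Sum>k. \<integral>\<^sup>+x. ennreal (u k x) \<partial>M)"
    unfolding F_def by (rule nn_integral_suminf) measurable
  also have "\<dots> = (\<Sum>k. ennreal (LINT x|M. u k x))"
    by (intro suminf_cong nn_integral_eq_integral u_int) (simp add: u0)
  also have "\<dots> \<le> (\<Sum>k. ennreal ((1/2) ^ k))"
    by (intro suminf_le ennreal_leI u_le) auto
  also have "\<dots> = ennreal (\<Sum>k. (1/2) ^ k)"
    by (intro suminf_ennreal2) (auto simp: summable_geometric)
  also have "\<dots> < \<infinity>" by simp
  finally have F_fin: "(\<integral>\<^sup>+x. F x \<partial>M) < \<infinity>" .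
  then have F_AE: "AE x in M. F x \<noteq> \<infinity>"
    by (intro nn_integral_noteq_infinite) auto
  define F' where "F' x = enn2real (F x)" for x
  have [measurable]: "F' \<in> borel_measurable M" unfolding F'_def by measurable
  have F'0: "0 \<le> F' x" for x by (simp add: F'_def)
  have F'_int: "integrable M F'"
  proof (rule integrableI_bounded)
    have "(\<integral>\<^sup>+x. ennreal (norm (F' x)) \<partial>M) \<le> (\<integral>\<^sup>+x. F x \<partial>M)"
      unfolding F'_def
      by (intro nn_integral_mono) (metis abs_of_nonneg enn2real_nonneg ennreal_enn2real_if real_norm_def zero_le order_refl top_greatest)
    then show "(\<integral>\<^sup>+x. ennreal (norm (F' x)) \<partial>M) < \<infinity>" using F_fin by simp
  qed measurable
  define h0 where "h0 x = F' x powr (1/p)" for x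
  define h where "h x = norm (f (r 0) x) + 2 * h0 x" for x
  have step: "AE x in M. \<forall>k. norm (f (r (Suc k)) x - f (r k) x) \<le> (1/2) ^ k * h0 x"
    using F_AE
  proof eventually_elim
    fix x assume fin: "F x \<noteq> \<infinity>"
    show "\<forall>k. norm (f (r (Suc k)) x - f (r k) x) \<le> (1/2) ^ k * h0 x"
    proof
      fix k
      have "ennreal (u k x) \<le> F x"
        unfolding F_def using sum_le_suminf[of "\<lambda>k. ennreal (u k x)" "{k}"] by simp
      then have "u k x \<le> F' x"
        using fin u0 unfolding F'_def by (metis enn2real_ennreal enn2real_mono infinity_ennreal_def less_top)
      then have "u k x powr (1/p) \<le> h0 x"
        unfolding h0_def using p u0 by (intro powr_mono2) auto
      moreover have "u k x powr (1/p) = 2 ^ k * norm (f (r (Suc k)) x - f (r k) x)"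
        using p by (simp add: u_def powr_mult powr_powr powr_realpow)
      ultimately show "norm (f (r (Suc k)) x - f (r k) x) \<le> (1/2) ^ k * h0 x"
        by (simp add: field_simps)
    qed
  qed
  have h0_nonneg: "0 \<le> h0 x" for x by (simp add: h0_def)
  have dom: "AE x in M. \<forall>n. norm (f (r n) x) \<le> h x"
    using step
  proof eventually_elim
    fix x assume st: "\<forall>k. norm (f (r (Suc k)) x - f (r k) x) \<le> (1/2) ^ k * h0 x"
    show "\<forall>n. norm (f (r n) x) \<le> h x"
    proof
      fix n
      have "f (r n) x - f (r 0) x = (\<Sum>k<n. f (r (Suc k)) x - f (r k) x)"
        by (rule sum_lessThan_telescope[symmetric])
      then have "norm (f (r n) x - f (r 0) x) \<le> (\<Sum>k<n. (1/2) ^ k * h0 x)"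
        using st by (auto intro!: sum_norm_le)
      also have "\<dots> = (\<Sum>k<n. (1/2) ^ k) * h0 x" by (simp add: sum_distrib_right)
      also have "\<dots> \<le> 2 * h0 x"
        by (intro mult_right_mono h0_nonneg) (simp add: geometric_sum)
      finally show "norm (f (r n) x) \<le> h x"
        unfolding h_def using norm_triangle_sub[of "f (r n) x" "f (r 0) x"] by linarith
    qed
  qed
  define g where "g x = lim (\<lambda>n. f (r n) x)" for x
  have [measurable]: "g \<in> borel_measurable M"
    unfolding g_def by (rule borel_measurable_lim_metric) measurable
  have conv: "AE x in M. (\<lambda>n. f (r n) x) \<longlonglongrightarrow> g x"
    using step
  proof eventually_elim
    fix x assume st: "\<forall>k. norm (f (r (Suc k)) x - f (r k) x) \<le> (1/2) ^ k * h0 x"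
    have "summable (\<lambda>k. f (r (Suc k)) x - f (r k) x)"
      by (rule summable_comparison_test[of _ "\<lambda>k. (1/2) ^ k * h0 x"])
         (use st in \<open>auto intro!: summable_mult2 summable_geometric\<close>)
    then have "convergent (\<lambda>n. \<Sum>k<n. f (r (Suc k)) x - f (r k) x)"
      by (simp add: summable_iff_convergent)
    then have "convergent (\<lambda>n. f (r n) x - f (r 0) x)"
      by (simp only: sum_lessThan_telescope[of "\<lambda>n. f (r n) x"])
    then have "convergent (\<lambda>n. f (r n) x - f (r 0) x + f (r 0) x)"
      by (intro convergent_add convergent_const)
    then show "(\<lambda>n. f (r n) x) \<longlonglongrightarrow> g x"
      by (simp add: g_def convergent_LIMSEQ_iff)
  qed
  have h0_Lp: "Lp_fun M p h0"
    unfolding Lp_fun_def h0_def using F'_int p F'0 by (auto simp: powr_powr abs_of_nonneg)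
  have h_Lp: "Lp_fun M p h"
    unfolding h_def using Lp_fun_add[OF Lp_fun_norm[OF f] Lp_fun_scaleR[OF h0_Lp] p, of "r 0" 2] by simp
  have "AE x in M. norm (g x) \<le> norm (h x)"
    using dom conv
  proof eventually_elim
    fix x assume "\<forall>n. norm (f (r n) x) \<le> h x" "(\<lambda>n. f (r n) x) \<longlonglongrightarrow> g x"
    then have "norm (g x) \<le> h x"
      by (intro LIMSEQ_le_const2[OF tendsto_norm]) auto
    then show "norm (g x) \<le> norm (h x)" by simp
  qed
  then have "Lp_fun M p g" by (intro Lp_fun_dominated[OF h_Lp _ _ p]) auto
  then show ?thesis using that r h_Lp dom conv by blast
qed

text \<open>The integrated form of the pointwise uniform convexity bound: boundedness handles the
  \<open>e\<close> term, a small defect the \<open>K\<close> term.\<close>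

lemma Lp_midpoint_defect_Cauchy:
  fixes f :: "nat \<Rightarrow> 'a \<Rightarrow> 'b::euclidean_space"
  assumes p: "1 < p" and f: "\<And>n. Lp_fun M p (f n)"
    and bdd: "\<And>n. (LINT x|M. norm (f n x) powr p) \<le> B"
    and defect: "\<And>e. 0 < e \<Longrightarrow> \<exists>N. \<forall>m\<ge>N. \<forall>n\<ge>N.
       ((LINT x|M. norm (f m x) powr p) + (LINT x|M. norm (f n x) powr p)) / 2
        - (LINT x|M. norm ((1/2) *\<^sub>R (f m x + f n x)) powr p) < e"
    and e: "0 < e"
  shows "\<exists>N. \<forall>m\<ge>N. \<forall>n\<ge>N. (LINT x|M. norm (f m x - f n x) powr p) < e"
proof -
  have "0 \<le> (LINT x|M. norm (f 0 x) powr p)" by simp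
  then have B: "0 \<le> B" using bdd[of 0] by linarith
  \<comment> \<open>\<open>e1\<close> is fixed first because \<open>K\<close> depends on it. The two
    integrals sum to at most \<open>2 * B\<close>, so the \<open>e1\<close> term costs at most
    \<open>e / 2\<close>. The defect tolerance \<open>e / (4 * (K + 1))\<close>, chosen afterwards,
    costs at most \<open>e / 4\<close>.\<close>
  define e1 where "e1 = e / (4 * (B + 1))"
  have e1: "0 < e1" using B e by (simp add: e1_def)
  obtain K where K: "0 \<le> K" "\<And>a b :: 'b. norm (a - b) powr p
     \<le> e1 * (norm a powr p + norm b powr p)
       + K * ((norm a powr p + norm b powr p) / 2 - norm ((1/2) *\<^sub>R (a + b)) powr p)"
    using uniform_convexity_pointwise[OF p e1] by blast
  have "0 < e / (4 * (K + 1))" using K e by simp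
  from defect[OF this] obtain N where N: "\<forall>m\<ge>N. \<forall>n\<ge>N.
       ((LINT x|M. norm (f m x) powr p) + (LINT x|M. norm (f n x) powr p)) / 2
        - (LINT x|M. norm ((1/2) *\<^sub>R (f m x + f n x)) powr p) < e / (4 * (K + 1))" by blast
  show ?thesis
  proof (intro exI[of _ N] allI impI)
    fix m n assume mn: "N \<le> m" "N \<le> n"
    define A where "A = (LINT x|M. norm (f m x) powr p) + (LINT x|M. norm (f n x) powr p)"
    define D where "D = (LINT x|M. norm ((1/2) *\<^sub>R (f m x + f n x)) powr p)"
    have i: "integrable M (\<lambda>x. norm (f k x) powr p)" for k using f by (auto simp: Lp_fun_def)
    have id: "integrable M (\<lambda>x. norm ((1/2) *\<^sub>R (f m x + f n x)) powr p)"
      by (intro Lp_fun_integrable Lp_fun_scaleR Lp_fun_add f) (use p in simp)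
    have "(LINT x|M. norm (f m x - f n x) powr p)
       \<le> (LINT x|M. e1 * (norm (f m x) powr p + norm (f n x) powr p)
       + K * ((norm (f m x) powr p + norm (f n x) powr p) / 2 - norm ((1/2) *\<^sub>R (f m x + f n x)) powr p))"
      using p by (intro integral_mono K Lp_fun_integrable Lp_fun_diff f Bochner_Integration.integrable_add
        Bochner_Integration.integrable_diff integrable_mult_right integrable_divide i id) auto
    also have "\<dots> = e1 * A + K * (A / 2 - D)"
      using i id by (simp add: A_def D_def)
    also have "\<dots> < e"
    proof -
      have "e1 * A \<le> e1 * (2 * (B + 1))"
        using bdd[of m] bdd[of n] e1 by (intro mult_left_mono) (auto simp: A_def)
      also have "\<dots> = e / 2" using B by (simp add: e1_def field_simps)
      finally have 1: "e1 * A \<le> e / 2" .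
      have "K * (A / 2 - D) \<le> K * (e / (4 * (K + 1)))"
        using N mn K(1) by (intro mult_left_mono) (auto simp: A_def D_def less_imp_le)
      also have "\<dots> \<le> e / 4"
        using K(1) e by (simp add: field_simps)
      finally show ?thesis using 1 e by linarith
    qed
    finally show "(LINT x|M. norm (f m x - f n x) powr p) < e" .
  qed
qed

text \<open>The derivative of \<open>v \<mapsto> norm v powr p / p\<close>.\<close>

definition duality_map :: "real \<Rightarrow> 'b::euclidean_space \<Rightarrow> 'b" where
  "duality_map p v = norm v powr (p - 1) *\<^sub>R sgn v"

lemma norm_duality_map: "1 < p \<Longrightarrow> norm (duality_map p v) = norm v powr (p - 1)"
  by (simp add: duality_map_def norm_sgn)

lemma isCont_duality_map:
  fixes v :: "'b::euclidean_space"
  assumes "1 < p"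
  shows "isCont (duality_map p) v"
proof (cases "v = 0")
  case True
  \<comment> \<open>\<open>sgn\<close> jumps at 0, but the factor \<open>norm x powr (p - 1)\<close>
    in front of it tends to 0 since \<open>p > 1\<close>.\<close>
  have "((\<lambda>x :: 'b. norm x powr (p - 1)) \<longlongrightarrow> norm (0::'b) powr (p - 1)) (at 0)"
    using assms by (intro tendsto_powr' tendsto_norm tendsto_ident_at tendsto_const) auto
  then have "((\<lambda>x :: 'b. norm (duality_map p x)) \<longlongrightarrow> 0) (at 0)"
    using assms by (simp add: norm_duality_map)
  then show ?thesis
    unfolding True isCont_def by (simp only: tendsto_norm_zero_iff duality_map_def[of p 0] sgn_zero scaleR_zero_right)
next
  case False
  then show ?thesis
    unfolding duality_map_def sgn_div_norm by (intro continuous_intros) auto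
qed

text \<open>Convexity of \<open>norm v powr p\<close> without differentiation: Young's inequality
  for \<open>norm u\<close> and \<open>norm v powr (p - 1)\<close>, where
  \<open>(p - 1) * conj_exp p = p\<close> turns the second power into
  \<open>norm v powr p\<close>.\<close>

lemma duality_map_subgradient:
  fixes u v :: "'b::euclidean_space"
  assumes "1 < p"
  shows "norm v powr p + p * (duality_map p v \<bullet> (u - v)) \<le> norm u powr p"
proof -
  note q = conj_exp_props[OF assms]
  have "norm u * norm v powr (p - 1) \<le> norm u powr p / p + (norm v powr (p - 1)) powr conj_exp p / conj_exp p"
    by (rule Youngs_conj_exp[OF assms]) auto
  also have "(norm v powr (p - 1)) powr conj_exp p = norm v powr p"
    using q by (simp add: powr_powr)
  finally have Y: "norm u * norm v powr (p - 1) \<le> norm u powr p / p + norm v powr p / conj_exp p" .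
  have "duality_map p v \<bullet> u \<le> norm v powr (p - 1) * norm u"
    using norm_cauchy_schwarz[of "duality_map p v" u] norm_duality_map[OF assms, of v] by simp
  moreover have "duality_map p v \<bullet> v = norm v powr p"
  proof (cases "v = 0")
    case False
    then show ?thesis
      by (simp add: duality_map_def sgn_div_norm powr_diff flip: power2_norm_eq_inner) (simp add: power2_eq_square)
  qed (simp add: duality_map_def)
  moreover have "norm v powr p / conj_exp p = norm v powr p - norm v powr p / p"
    using q(2) assms by (simp add: conj_exp_def field_simps)
  ultimately have "norm v powr p / p + (duality_map p v \<bullet> (u - v)) \<le> norm u powr p / p"
    using Y by (simp add: inner_diff_right algebra_simps)
  then have "p * (norm v powr p / p + (duality_map p v \<bullet> (u - v))) \<le> p * (norm u powr p / p)"
    using assms by (intro mult_left_mono) auto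
  then show ?thesis using assms by (simp add: distrib_left)
qed

lemma Lp_fun_duality_map:
  fixes f :: "'a \<Rightarrow> 'b::euclidean_space"
  assumes "1 < p" "Lp_fun M p f"
  shows "Lp_fun M (conj_exp p) (\<lambda>x. duality_map p (f x))"
  unfolding Lp_fun_def
proof
  have "continuous_on UNIV (duality_map p :: 'b \<Rightarrow> 'b)"
    by (intro continuous_at_imp_continuous_on ballI isCont_duality_map[OF assms(1)])
  then show "(\<lambda>x. duality_map p (f x)) \<in> borel_measurable M"
    using Lp_fun_measurable[OF assms(2)] by (rule borel_measurable_continuous_on)
  show "integrable M (\<lambda>x. norm (duality_map p (f x)) powr conj_exp p)"
    using Lp_fun_integrable[OF assms(2)] conj_exp_props[OF assms(1)] assms(1)
    by (simp add: norm_duality_map powr_powr)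
qed

text \<open>Serves both minimisations, hence the separation of the points \<open>z\<close> from the
  functions \<open>T z\<close>: in one use the points are pairs of a function and a number. If two
  points are within \<open>d\<close> of the infimum, the midpoint candidate \<open>z\<close> is
  still at least the infimum, so \<open>c\<close> times the convexity defect is less than
  \<open>d\<close>.\<close>

lemma midpoint_convex_minimizing_sequence:
  fixes T :: "'i \<Rightarrow> 'a \<Rightarrow> 'b::euclidean_space" and j :: "'i \<Rightarrow> real"
  assumes p: "1 < p" and S: "S \<noteq> {}" and bb: "bdd_below (j ` S)"
    and Lp: "\<And>z. z \<in> S \<Longrightarrow> Lp_fun M p (T z)"
    and bdd: "\<And>z. z \<in> S \<Longrightarrow> j z \<le> Inf (j ` S) + 1 \<Longrightarrow> (LINT x|M. norm (T z x) powr p) \<le> B"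
    and c: "0 < c"
    and mid: "\<And>x y. x \<in> S \<Longrightarrow> y \<in> S \<Longrightarrow> \<exists>z\<in>S.
       c * (((LINT t|M. norm (T x t) powr p) + (LINT t|M. norm (T y t) powr p)) / 2
        - (LINT t|M. norm ((1/2) *\<^sub>R (T x t + T y t)) powr p)) + j z \<le> (j x + j y) / 2"
  obtains v g and h :: "'a \<Rightarrow> real"
    where "\<And>n. v n \<in> S" "\<And>n. j (v n) < Inf (j ` S) + 1 / real (Suc n)"
      "Lp_fun M p g" "Lp_fun M p h"
      "AE x in M. \<forall>n. norm (T (v n) x) \<le> h x" "AE x in M. (\<lambda>n. T (v n) x) \<longlonglongrightarrow> g x"
proof -
  define m where "m = Inf (j ` S)"
  have m_le: "m \<le> j z" if "z \<in> S" for z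
    unfolding m_def by (intro cInf_lower bb) (use that in auto)
  have "\<exists>z\<in>S. j z < m + 1 / real (Suc n)" for n
    using cInf_lessD[of "j ` S" "m + 1 / real (Suc n)"] S unfolding m_def by force
  then obtain v where v: "\<And>n. v n \<in> S" "\<And>n. j (v n) < m + 1 / real (Suc n)" by metis
  have Cauchy: "\<exists>n0. \<forall>a\<ge>n0. \<forall>b\<ge>n0. (LINT x|M. norm (T (v a) x - T (v b) x) powr p) < e" if "0 < e" for e
  proof (rule Lp_midpoint_defect_Cauchy[OF p Lp[OF v(1)] _ _ that])
    show "(LINT x|M. norm (T (v n) x) powr p) \<le> B" for n
    proof (rule bdd[OF v(1)])
      have "1 / real (Suc n) \<le> 1" by simp
      then show "j (v n) \<le> Inf (j ` S) + 1" using v(2)[of n] unfolding m_def by linarith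
    qed
    fix e :: real assume "0 < e"
    define d where "d = e * c"
    have "0 < d" using \<open>0 < e\<close> c by (simp add: d_def)
    then obtain n0 where n0: "inverse (real (Suc n0)) < d" using reals_Archimedean by blast
    have less: "j (v n) < m + d" if "n0 \<le> n" for n
    proof -
      have "1 / real (Suc n) \<le> 1 / real (Suc n0)" using that by (intro divide_left_mono) auto
      then show ?thesis using n0 v(2)[of n] by (simp add: inverse_eq_divide del: of_nat_Suc)
    qed
    show "\<exists>n0. \<forall>m\<ge>n0. \<forall>n\<ge>n0. ((LINT x|M. norm (T (v m) x) powr p) + (LINT x|M. norm (T (v n) x) powr p)) / 2
        - (LINT x|M. norm ((1/2) *\<^sub>R (T (v m) x + T (v n) x)) powr p) < e"
    proof (intro exI[of _ n0] allI impI)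
      fix a b assume ab: "n0 \<le> a" "n0 \<le> b"
      define D where "D = ((LINT x|M. norm (T (v a) x) powr p) + (LINT x|M. norm (T (v b) x) powr p)) / 2
        - (LINT x|M. norm ((1/2) *\<^sub>R (T (v a) x + T (v b) x)) powr p)"
      obtain z where z: "z \<in> S" "c * D + j z \<le> (j (v a) + j (v b)) / 2"
        using mid[OF v(1)[of a] v(1)[of b]] unfolding D_def by blast
      have "j (v a) + j (v b) < 2 * m + 2 * d"
        using less[OF ab(1)] less[OF ab(2)] by linarith
      then have "c * D < c * e"
        using z m_le[OF z(1)] unfolding d_def by (simp add: mult.commute)
      then show "((LINT x|M. norm (T (v a) x) powr p) + (LINT x|M. norm (T (v b) x) powr p)) / 2
        - (LINT x|M. norm ((1/2) *\<^sub>R (T (v a) x + T (v b) x)) powr p) < e"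
        using c by (simp add: D_def)
    qed
  qed
  obtain r g and h :: "'a \<Rightarrow> real" where r: "strict_mono r" and gh: "Lp_fun M p g" "Lp_fun M p h"
    "AE x in M. \<forall>n. norm (T (v (r n)) x) \<le> h x" "AE x in M. (\<lambda>n. T (v (r n)) x) \<longlonglongrightarrow> g x"
    by (rule Lp_Cauchy_dominated_subsequence[OF less_trans[OF zero_less_one p] Lp[OF v(1)] Cauchy])
  show ?thesis
  proof (rule that[of "\<lambda>n. v (r n)", OF _ _ gh])
    show "v (r n) \<in> S" for n by (rule v)
    \<comment> \<open>Since \<open>r n >= n\<close>, the subsequence keeps the rate
      \<open>1 / Suc n\<close>, which the first variation argument below relies on.\<close>
    have "1 / real (Suc (r n)) \<le> 1 / real (Suc n)" for n
      using seq_suble[OF r, of n] by (intro divide_left_mono) auto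
    then show "j (v (r n)) < Inf (j ` S) + 1 / real (Suc n)" for n
      using v(2)[of "r n"] unfolding m_def by (rule order_less_le_trans[OF _ add_left_mono, rotated])
  qed
qed

text \<open>Minimising \<open>norm G ^ p / p - l\<close> over \<open>V\<close> replaces Hahn--Banach and the Riesz representation
  theorem: if a minimising sequence converges to \<open>G\<close>, then \<open>duality_map p G\<close> represents \<open>l\<close>.\<close>

lemma bounded_functional_representation:
  fixes V :: "(('a \<Rightarrow> 'b::euclidean_space) \<times> real) set"
  assumes p: "1 < p"
    and Lp: "\<And>G l. (G, l) \<in> V \<Longrightarrow> Lp_fun M p G"
    and lin: "\<And>G l H k s t. (G, l) \<in> V \<Longrightarrow> (H, k) \<in> V
        \<Longrightarrow> (\<lambda>x. s *\<^sub>R G x + t *\<^sub>R H x, s * l + t * k) \<in> V"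
    and C: "\<And>G l. (G, l) \<in> V \<Longrightarrow> \<bar>l\<bar> \<le> C * (LINT x|M. norm (G x) powr p) powr (1/p)"
  shows "\<exists>q. Lp_fun M (conj_exp p) q \<and> (\<forall>(G, l)\<in>V. (LINT x|M. q x \<bullet> G x) = l)"
proof (cases "V = {}")
  case True
  then show ?thesis using p by (intro exI[of _ "\<lambda>x. 0"]) (auto simp: Lp_fun_def)
next
  case False
  define N where "N G = (LINT x|M. norm (G x) powr p)" for G :: "'a \<Rightarrow> 'b"
  define j where "j z = N (fst z) / p - snd z" for z
  have N0: "0 \<le> N G" for G by (simp add: N_def)
  note q = conj_exp_props[OF p]
  \<comment> \<open>What remains when Young's inequality absorbs the linear term into half of
    \<open>N G / p\<close>; the factor \<open>2 powr (1/p)\<close> pays for that half. Hence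
    \<open>j\<close> is at least \<open>N / (2 * p) - K\<close>, which is coercive.\<close>
  define K where "K = (\<bar>C\<bar> * 2 powr (1/p)) powr conj_exp p / conj_exp p"
  have l_le: "l \<le> N G / (2 * p) + K" if "(G, l) \<in> V" for G l
  proof -
    have "l \<le> C * N G powr (1/p)" using C[OF that] by (simp add: N_def)
    also have "\<dots> \<le> \<bar>C\<bar> * N G powr (1/p)" by (intro mult_right_mono) auto
    also have "\<dots> = (N G / 2) powr (1/p) * (\<bar>C\<bar> * 2 powr (1/p))"
      using N0[of G] by (simp add: powr_divide)
    also have "\<dots> \<le> ((N G / 2) powr (1/p)) powr p / p + K"
      unfolding K_def by (rule Youngs_conj_exp[OF p]) auto
    also have "\<dots> = N G / (2 * p) + K"
      using p N0[of G] by (simp add: powr_powr)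
    finally show ?thesis .
  qed
  have j_ge: "N (fst z) / (2 * p) - K \<le> j z" if "z \<in> V" for z
  proof -
    have "N (fst z) / p = 2 * (N (fst z) / (2 * p))" by simp
    then show ?thesis using l_le[of "fst z" "snd z"] that unfolding j_def prod.collapse by linarith
  qed
  have bb: "bdd_below (j ` V)"
  proof (rule bdd_belowI2)
    fix z assume "z \<in> V"
    then show "- K \<le> j z" using j_ge[of z] N0[of "fst z"] p by (smt (verit) divide_nonneg_pos)
  qed
  define m where "m = Inf (j ` V)"
  have m_le: "m \<le> j z" if "z \<in> V" for z
    unfolding m_def by (intro cInf_lower bb) (use that in auto)
  have S_Lp: "Lp_fun M p (fst z)" if "z \<in> V" for z using Lp[of "fst z" "snd z"] that by simp
  have bdd: "(LINT x|M. norm (fst z x) powr p) \<le> 2 * p * (m + 1 + K)" if "z \<in> V" "j z \<le> Inf (j ` V) + 1" for z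
  proof -
    have "N (fst z) / (2 * p) \<le> m + 1 + K" using j_ge[OF that(1)] that(2) unfolding m_def by linarith
    then show ?thesis using p by (simp add: N_def field_simps)
  qed
  have mid: "\<exists>z\<in>V. 1 / p * (((LINT t|M. norm (fst x t) powr p) + (LINT t|M. norm (fst y t) powr p)) / 2
        - (LINT t|M. norm ((1/2) *\<^sub>R (fst x t + fst y t)) powr p)) + j z \<le> (j x + j y) / 2" if "x \<in> V" "y \<in> V" for x y
  proof
    show "(\<lambda>t. (1/2) *\<^sub>R fst x t + (1/2) *\<^sub>R fst y t, (1/2) * snd x + (1/2) * snd y) \<in> V"
      using lin[of "fst x" "snd x" "fst y" "snd y" "1/2" "1/2"] that by simp
    show "1 / p * (((LINT t|M. norm (fst x t) powr p) + (LINT t|M. norm (fst y t) powr p)) / 2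
        - (LINT t|M. norm ((1/2) *\<^sub>R (fst x t + fst y t)) powr p))
        + j (\<lambda>t. (1/2) *\<^sub>R fst x t + (1/2) *\<^sub>R fst y t, (1/2) * snd x + (1/2) * snd y) \<le> (j x + j y) / 2"
      by (simp add: j_def N_def scaleR_add_right right_diff_distrib add_divide_distrib diff_divide_distrib)
  qed
  obtain v g and h :: "'a \<Rightarrow> real" where v: "\<And>n. v n \<in> V" "\<And>n. j (v n) < Inf (j ` V) + 1 / real (Suc n)"
    and g: "Lp_fun M p g" and h: "Lp_fun M p h"
    and dom: "AE x in M. \<forall>n. norm (fst (v n) x) \<le> h x" and conv: "AE x in M. (\<lambda>n. fst (v n) x) \<longlonglongrightarrow> g x"
    by (rule midpoint_convex_minimizing_sequence[where T = fst, OF p False bb S_Lp bdd _ mid]) (use p in auto)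
  define G where "G n = fst (v n)" for n
  define l where "l n = snd (v n)" for n
  have Gl: "(G n, l n) \<in> V" for n using v by (simp add: G_def l_def)
  have G_Lp: "Lp_fun M p (G n)" for n by (rule Lp[OF Gl])
  have jv: "j (v n) = N (G n) / p - l n" for n by (simp add: j_def G_def l_def)
  have dom: "AE x in M. \<forall>n. norm (G n x) \<le> h x" and conv: "AE x in M. (\<lambda>n. G n x) \<longlonglongrightarrow> g x"
    using dom conv by (simp_all add: G_def)
  \<comment> \<open>Almost minimisers are moved by \<open>t n\<close> in a direction
    \<open>H\<close>. Their error in minimality is \<open>t n * t n\<close>, so division by the step
    leaves the error \<open>t n\<close>, which still vanishes. The limit \<open>g\<close> is not
    moved, as it is not known to occur in \<open>V\<close>.\<close>
  define t where "t n = 1 / sqrt (real (Suc n))" for n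
  have t: "0 < t n" "t n \<le> 1" "t n * t n = 1 / real (Suc n)" for n by (auto simp: t_def)
  have t_lim: "t \<longlonglongrightarrow> 0" unfolding t_def by real_asymp
  have rep: "k \<le> (LINT x|M. duality_map p (g x) \<bullet> H x)" if HV: "(H, k) \<in> V" for H k
  proof -
    note H = Lp[OF HV]
    define W where "W n x = G n x + t n *\<^sub>R H x" for n x
    have W: "Lp_fun M p (W n)" for n
      unfolding W_def using Lp_fun_lincomb[OF G_Lp[of n] H, of 1 "t n"] p by simp
    have int: "integrable M (\<lambda>x. duality_map p (W n x) \<bullet> H x)" for n
      using integrable_inner_Lp(2)[OF p H Lp_fun_duality_map[OF p W]] by (simp add: inner_commute)
    have step: "k \<le> (LINT x|M. duality_map p (W n x) \<bullet> H x) + t n" for n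
    proof -
      have "(W n, l n + t n * k) \<in> V"
        using lin[OF Gl[of n] HV, of 1 "t n"] by (simp add: W_def[abs_def])
      from m_le[OF this] have m1: "m \<le> N (W n) / p - (l n + t n * k)" by (simp add: j_def)
      have m2: "N (G n) / p - l n \<le> m + t n * t n"
        using v(2)[of n] by (simp add: jv t(3) m_def)
      \<comment> \<open>The subgradient inequality at the moved function \<open>W n\<close>, tested
        with \<open>G n\<close>, bounds the increase of the energy from above; its right side
        converges with \<open>W n\<close>.\<close>
      have "(LINT x|M. norm (W n x) powr p - (p * t n) * (duality_map p (W n x) \<bullet> H x)) \<le> N (G n)"
        unfolding N_def
      proof (rule integral_mono)
        show "integrable M (\<lambda>x. norm (W n x) powr p - (p * t n) * (duality_map p (W n x) \<bullet> H x))"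
          using int Lp_fun_integrable[OF W] by auto
        show "integrable M (\<lambda>x. norm (G n x) powr p)" by (rule Lp_fun_integrable[OF G_Lp])
        fix x
        show "norm (W n x) powr p - (p * t n) * (duality_map p (W n x) \<bullet> H x) \<le> norm (G n x) powr p"
          using duality_map_subgradient[OF p, of "W n x" "G n x"] by (simp add: W_def)
      qed
      also have "(LINT x|M. norm (W n x) powr p - (p * t n) * (duality_map p (W n x) \<bullet> H x))
          = N (W n) - (p * t n) * (LINT x|M. duality_map p (W n x) \<bullet> H x)"
        using int Lp_fun_integrable[OF W] by (simp add: N_def)
      finally have "N (W n) \<le> N (G n) + p * (t n * (LINT x|M. duality_map p (W n x) \<bullet> H x))" by simp
      then have "N (W n) / p \<le> N (G n) / p + t n * (LINT x|M. duality_map p (W n x) \<bullet> H x)"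
        using p by (simp add: field_simps)
      then have "t n * k \<le> t n * ((LINT x|M. duality_map p (W n x) \<bullet> H x) + t n)"
        using m1 m2 by (simp add: algebra_simps)
      then show ?thesis using t(1)[of n] by simp
    qed
    define B where "B x = h x + norm (H x)" for x
    have B: "Lp_fun M p B" unfolding B_def using Lp_fun_add[OF h Lp_fun_norm[OF H]] p by simp
    have BH: "integrable M (\<lambda>x. norm (H x) * (norm (B x) powr (p - 1)))"
      using integrable_inner_Lp(1)[OF p Lp_fun_norm[OF H] Lp_fun_duality_map[OF p B]]
      by (simp only: norm_duality_map[OF p] real_norm_def[of "norm _"] abs_norm_cancel)
    have "(\<lambda>n. LINT x|M. duality_map p (W n x) \<bullet> H x) \<longlonglongrightarrow> (LINT x|M. duality_map p (g x) \<bullet> H x)"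
    proof (rule integral_dominated_convergence[OF _ _ BH])
      show "(\<lambda>x. duality_map p (g x) \<bullet> H x) \<in> borel_measurable M"
        using Lp_fun_duality_map[OF p g] H by (auto simp: Lp_fun_def)
      show "(\<lambda>x. duality_map p (W n x) \<bullet> H x) \<in> borel_measurable M" for n
        using int by auto
      show "AE x in M. (\<lambda>n. duality_map p (W n x) \<bullet> H x) \<longlonglongrightarrow> duality_map p (g x) \<bullet> H x"
        using conv
      proof eventually_elim
        fix x assume "(\<lambda>n. G n x) \<longlonglongrightarrow> g x"
        then have "(\<lambda>n. W n x) \<longlonglongrightarrow> g x + 0 *\<^sub>R H x"
          unfolding W_def by (intro tendsto_intros t_lim)
        then have "(\<lambda>n. W n x) \<longlonglongrightarrow> g x" by simp
        then show "(\<lambda>n. duality_map p (W n x) \<bullet> H x) \<longlonglongrightarrow> duality_map p (g x) \<bullet> H x"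
          by (intro tendsto_inner tendsto_const isCont_tendsto_compose[OF isCont_duality_map[OF p]])
      qed
      show "AE x in M. norm (duality_map p (W n x) \<bullet> H x) \<le> norm (H x) * norm (B x) powr (p - 1)" for n
        using dom
      proof eventually_elim
        fix x assume "\<forall>n. norm (G n x) \<le> h x"
        moreover have "t n * norm (H x) \<le> norm (H x)" using t[of n] by (simp add: mult_left_le_one_le)
        ultimately have "norm (W n x) \<le> B x"
          unfolding W_def B_def using t(1)[of n] by (intro norm_triangle_le add_mono) (auto simp: abs_of_pos)
        then have "norm (W n x) \<le> norm (B x)" by simp
        have "norm (duality_map p (W n x) \<bullet> H x) \<le> norm (W n x) powr (p - 1) * norm (H x)"
          using Cauchy_Schwarz_ineq2[of "duality_map p (W n x)" "H x"] by (simp add: norm_duality_map[OF p])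
        also have "\<dots> \<le> norm (B x) powr (p - 1) * norm (H x)"
          using \<open>norm (W n x) \<le> norm (B x)\<close> p by (intro mult_right_mono powr_mono2) auto
        finally show "norm (duality_map p (W n x) \<bullet> H x) \<le> norm (H x) * norm (B x) powr (p - 1)"
          by (simp add: mult.commute)
      qed
    qed
    then have "(\<lambda>n. (LINT x|M. duality_map p (W n x) \<bullet> H x) + t n) \<longlonglongrightarrow> (LINT x|M. duality_map p (g x) \<bullet> H x) + 0"
      by (intro tendsto_add t_lim)
    from LIMSEQ_le_const[OF this] step show ?thesis by auto
  qed
  show ?thesis
  proof (intro exI[of _ "\<lambda>x. duality_map p (g x)"] conjI ballI, safe)
    show "Lp_fun M (conj_exp p) (\<lambda>x. duality_map p (g x))" by (rule Lp_fun_duality_map[OF p g])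
    fix H k assume HV: "(H, k) \<in> V"
    \<comment> \<open>\<open>rep\<close> gives one inequality; the opposite direction
      \<open>- H\<close> supplies the other.\<close>
    have "((\<lambda>x. - H x), - k) \<in> V" using lin[OF HV HV, of "-1" 0] by simp
    from rep[OF this] rep[OF HV] show "(LINT x|M. duality_map p (g x) \<bullet> H x) = k" by simp
  qed
qed

section \<open>Test functions\<close>

lemma frechet_derivative_eq: "(f has_derivative f') (at x) \<Longrightarrow> frechet_derivative f (at x) = f'"
  using frechet_derivative_at by metis

lemma differentiable_has_frechet_derivative:
  "f differentiable_on UNIV \<Longrightarrow> (f has_derivative frechet_derivative f (at x)) (at x)"
  by (simp add: differentiable_on_def frechet_derivative_works[symmetric])

lemma differentiable_on_UNIV_I: "(\<And>x. (f has_derivative f' x) (at x)) \<Longrightarrow> f differentiable_on UNIV"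
  by (auto simp: differentiable_on_def differentiable_def)

lemma k_times_cont_diff_Suc_I:
  assumes "\<And>x. (f has_derivative f' x) (at x)" "\<And>b. b \<in> Basis \<Longrightarrow> k_times_cont_diff k (\<lambda>x. f' x b)"
  shows "k_times_cont_diff (Suc k) f"
proof -
  have "frechet_derivative f (at x) = f' x" for x by (rule frechet_derivative_eq[OF assms(1)])
  then show ?thesis using assms differentiable_on_UNIV_I[OF assms(1)] by auto
qed

lemma k_times_cont_diff_lower: "k_times_cont_diff (Suc k) f \<Longrightarrow> k_times_cont_diff k f"
proof (induction k arbitrary: f)
  case 0
  then show ?case by (simp add: differentiable_imp_continuous_on)
next
  case (Suc k)
  then show ?case by (metis k_times_cont_diff.simps(2))
qed

lemma k_times_cont_diff_const: "k_times_cont_diff k (\<lambda>x. c)"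
proof (induction k arbitrary: c)
  case (Suc k)
  then show ?case by (intro k_times_cont_diff_Suc_I[of _ "\<lambda>x b. 0"]) auto
qed auto

lemma k_times_cont_diff_add:
  "k_times_cont_diff k f \<Longrightarrow> k_times_cont_diff k g \<Longrightarrow> k_times_cont_diff k (\<lambda>x. f x + g x)"
proof (induction k arbitrary: f g)
  case 0
  then show ?case by (auto intro: continuous_intros)
next
  case (Suc k)
  then show ?case
    by (intro k_times_cont_diff_Suc_I[of _ "\<lambda>x b. frechet_derivative f (at x) b + frechet_derivative g (at x) b"])
       (auto intro: has_derivative_add differentiable_has_frechet_derivative)
qed

lemma k_times_cont_diff_mult:
  "k_times_cont_diff k f \<Longrightarrow> k_times_cont_diff k g \<Longrightarrow> k_times_cont_diff k (\<lambda>x. f x * g x)"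
proof (induction k arbitrary: f g)
  case 0
  then show ?case by (auto intro: continuous_intros)
next
  case (Suc k)
  have low: "k_times_cont_diff k f" "k_times_cont_diff k g"
    using Suc.prems by (blast intro: k_times_cont_diff_lower)+
  show ?case
    using Suc.prems
    by (intro k_times_cont_diff_Suc_I[of _ "\<lambda>x b. f x * frechet_derivative g (at x) b + frechet_derivative f (at x) b * g x"])
       (auto intro!: has_derivative_mult differentiable_has_frechet_derivative k_times_cont_diff_add Suc.IH low)
qed

lemma k_times_cont_diff_prod:
  "finite I \<Longrightarrow> (\<And>i. i \<in> I \<Longrightarrow> k_times_cont_diff k (f i)) \<Longrightarrow> k_times_cont_diff k (\<lambda>x. \<Prod>i\<in>I. f i x)"
  by (induction I rule: finite_induct) (auto intro: k_times_cont_diff_mult k_times_cont_diff_const)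

lemma k_times_cont_diff_affine: "k_times_cont_diff k (\<lambda>x. x \<bullet> v + c)"
proof (cases k)
  case 0
  then show ?thesis by (auto intro!: continuous_intros)
next
  case (Suc l)
  show ?thesis
    unfolding Suc
    by (intro k_times_cont_diff_Suc_I[of _ "\<lambda>x b. b \<bullet> v"] k_times_cont_diff_const)
       (auto intro!: derivative_eq_intros)
qed

lemma k_times_cont_diff_dist_square: "k_times_cont_diff k (\<lambda>x. (x - a) \<bullet> (x - a))"
proof (cases k)
  case 0
  then show ?thesis by (auto intro!: continuous_intros)
next
  case (Suc l)
  show ?thesis
    unfolding Suc
  proof (rule k_times_cont_diff_Suc_I[of _ "\<lambda>x b. 2 * ((x - a) \<bullet> b)"])
    show "((\<lambda>x. (x - a) \<bullet> (x - a)) has_derivative (\<lambda>b. 2 * ((x - a) \<bullet> b))) (at x)" for x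
      by (auto intro!: derivative_eq_intros simp: inner_commute)
    show "k_times_cont_diff l (\<lambda>x. 2 * ((x - a) \<bullet> b))" for b
      using k_times_cont_diff_affine[of l "2 *\<^sub>R b" "- 2 * (a \<bullet> b)"] by (simp add: inner_diff_left)
  qed
qed

lemma k_times_cont_diff_compose_affine:
  "k_times_cont_diff k f \<Longrightarrow> k_times_cont_diff k (\<lambda>x. f (c + t *\<^sub>R x))"
proof (induction k arbitrary: f)
  case 0
  then show ?case
    by (auto intro!: continuous_intros continuous_on_compose2[of UNIV f])
next
  case (Suc k)
  show ?case
  proof (rule k_times_cont_diff_Suc_I)
    fix x
    have "(f has_derivative frechet_derivative f (at (c + t *\<^sub>R x))) (at (c + t *\<^sub>R x))"
      using Suc.prems by (auto intro: differentiable_has_frechet_derivative)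
    then show "((\<lambda>x. f (c + t *\<^sub>R x)) has_derivative (\<lambda>b. frechet_derivative f (at (c + t *\<^sub>R x)) (t *\<^sub>R b))) (at x)"
      by (rule has_derivative_compose[rotated]) (auto intro!: derivative_eq_intros)
  next
    fix b :: 'a assume b: "b \<in> Basis"
    have lin: "linear (frechet_derivative f (at x))" for x
      using Suc.prems by (intro linear_frechet_derivative) (auto simp: differentiable_on_def)
    have "k_times_cont_diff k (\<lambda>x. t * frechet_derivative f (at (c + t *\<^sub>R x)) b)"
      by (rule k_times_cont_diff_mult[OF k_times_cont_diff_const Suc.IH]) (use Suc.prems b in auto)
    then show "k_times_cont_diff k (\<lambda>x. frechet_derivative f (at (c + t *\<^sub>R x)) (t *\<^sub>R b))"
      by (simp add: linear_scale[OF lin])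
  qed
qed

text \<open>Derivatives of the flat function \<open>exp (- 1 / t)\<close> stay in the family of
  \<open>flat P\<close>, where \<open>P\<close> is a polynomial in \<open>1 / t\<close>.\<close>

definition flat :: "real poly \<Rightarrow> real \<Rightarrow> real" where
  "flat P t = (if 0 < t then poly P (1 / t) * exp (- (1 / t)) else 0)"

lemma poly_times_exp_tendsto_0: "((\<lambda>x. poly P x * exp (- x)) \<longlongrightarrow> 0) (at_top :: real filter)"
proof -
  have "((\<lambda>x. \<Sum>i\<le>degree P. coeff P i * (x ^ i / exp x)) \<longlongrightarrow> (\<Sum>i\<le>degree P. coeff P i * 0)) (at_top :: real filter)"
    by (intro tendsto_intros tendsto_power_div_exp_0)
  then show ?thesis
    by (simp add: poly_altdef sum_distrib_right exp_minus divide_inverse mult.assoc)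
qed

lemma flat_tendsto_0: "((\<lambda>t. poly P (1 / t) * exp (- (1 / t))) \<longlongrightarrow> 0) (at_right (0::real))"
  using filterlim_compose[OF poly_times_exp_tendsto_0[of P] filterlim_inverse_at_top_right]
  by (simp add: inverse_eq_divide)

text \<open>With \<open>s = 1 / t\<close> the chain rule turns \<open>P s * exp (- s)\<close> into
  \<open>s^2 * (P s - P' s) * exp (- s)\<close>, again a member of the family. At 0 the difference
  quotient from the right is the member belonging to \<open>s * P s\<close>, and the exponential
  beats every polynomial.\<close>

lemma has_derivative_flat:
  "(flat P has_real_derivative flat ([:0, 0, 1:] * (P - pderiv P)) t) (at t)"
proof -
  consider "t < 0" | "t = 0" | "0 < t" by linarith
  then show ?thesis
  proof cases
    case 1
    have "((\<lambda>t. 0) has_real_derivative 0) (at t)" by simp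
    then have "(flat P has_real_derivative 0) (at t)"
      by (rule has_field_derivative_transform_within_open[of _ _ _ "{..<0}"]) (use 1 in \<open>auto simp: flat_def\<close>)
    then show ?thesis using 1 by (simp add: flat_def)
  next
    case 2
    have "((\<lambda>y. (flat P y - flat P 0) / (y - 0)) \<longlongrightarrow> 0) (at 0)"
    proof (rule filterlim_split_at)
      show "((\<lambda>y. (flat P y - flat P 0) / (y - 0)) \<longlongrightarrow> 0) (at_left 0)"
        by (rule tendsto_eventually) (auto simp: flat_def eventually_at_filter)
      show "((\<lambda>y. (flat P y - flat P 0) / (y - 0)) \<longlongrightarrow> 0) (at_right 0)"
        by (rule Lim_transform_eventually[OF flat_tendsto_0[of "[:0, 1:] * P"]])
           (auto simp: flat_def eventually_at_filter)
    qed
    then show ?thesis using 2 by (simp add: has_field_derivative_iff flat_def)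
  next
    case 3
    have "((\<lambda>t. poly P (1 / t) * exp (- (1 / t))) has_real_derivative
        poly ([:0, 0, 1:] * (P - pderiv P)) (1 / t) * exp (- (1 / t))) (at t)"
      using 3 by (auto intro!: derivative_eq_intros DERIV_chain'[OF _ poly_DERIV] simp: field_simps power2_eq_square)
    then have "(flat P has_real_derivative poly ([:0, 0, 1:] * (P - pderiv P)) (1 / t) * exp (- (1 / t))) (at t)"
      by (rule has_field_derivative_transform_within_open[of _ _ _ "{0<..}"]) (use 3 in \<open>auto simp: flat_def\<close>)
    then show ?thesis using 3 by (simp add: flat_def)
  qed
qed

text \<open>A derivative of the composition is a derivative of \<open>f\<close> times another
  \<open>flat\<close>, so the induction has to range over all polynomials \<open>P\<close>.\<close>

lemma k_times_cont_diff_flat: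
  "k_times_cont_diff k f \<Longrightarrow> k_times_cont_diff k (\<lambda>x. flat P (f x))"
proof (induction k arbitrary: P)
  case 0
  have "continuous_on UNIV (flat P)"
    using has_derivative_flat[of P] by (intro continuous_at_imp_continuous_on) (blast intro: DERIV_isCont)
  then show ?case using 0 by (auto intro: continuous_on_compose2[of UNIV "flat P"])
next
  case (Suc k)
  let ?Q = "[:0, 0, 1:] * (P - pderiv P)"
  show ?case
  proof (rule k_times_cont_diff_Suc_I)
    fix x
    have f: "(f has_derivative frechet_derivative f (at x)) (at x)"
      using Suc.prems by (auto intro: differentiable_has_frechet_derivative)
    show "((\<lambda>x. flat P (f x)) has_derivative (\<lambda>b. frechet_derivative f (at x) b * flat ?Q (f x))) (at x)"
      using has_derivative_compose[OF f has_derivative_flat[of P "f x", unfolded has_field_derivative_def]]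
      by (simp add: mult.commute)
  next
    fix b :: 'a assume "b \<in> Basis"
    then show "k_times_cont_diff k (\<lambda>x. frechet_derivative f (at x) b * flat ?Q (f x))"
      using Suc.prems by (intro k_times_cont_diff_mult Suc.IH k_times_cont_diff_lower[OF Suc.prems]) auto
  qed
qed

lemma test_functionI:
  assumes "\<And>k. k_times_cont_diff k \<psi>" "\<And>x. \<psi> x \<noteq> 0 \<Longrightarrow> x \<in> K" "compact K" "K \<subseteq> U"
  shows "test_function U \<psi>"
proof -
  have "closure {x. \<psi> x \<noteq> 0} \<subseteq> K"
    by (rule closure_minimal) (use assms compact_imp_closed in auto)
  then show ?thesis
    using assms compact_closure bounded_subset[OF compact_imp_bounded[OF assms(3)]] unfolding test_function_def
    by (metis closure_subset order_trans)
qed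

lemma test_function_continuous: "test_function U \<psi> \<Longrightarrow> continuous_on UNIV \<psi>"
  unfolding test_function_def by (metis k_times_cont_diff.simps(1))

lemma test_function_zero: "test_function U \<psi> \<Longrightarrow> x \<notin> closure {x. \<psi> x \<noteq> 0} \<Longrightarrow> \<psi> x = 0"
  using closure_subset[of "{x. \<psi> x \<noteq> 0}"] by auto

lemma test_function_derivative:
  assumes "test_function U \<psi>" "b \<in> Basis"
  shows "test_function U (\<lambda>x. frechet_derivative \<psi> (at x) b)"
proof (rule test_functionI[where K = "closure {x. \<psi> x \<noteq> 0}"])
  show "k_times_cont_diff k (\<lambda>x. frechet_derivative \<psi> (at x) b)" for k
    using assms unfolding test_function_def by (metis k_times_cont_diff.simps(2))
  show "compact (closure {x. \<psi> x \<noteq> 0})" "closure {x. \<psi> x \<noteq> 0} \<subseteq> U"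
    using assms by (auto simp: test_function_def)
  fix x assume nz: "frechet_derivative \<psi> (at x) b \<noteq> 0"
  show "x \<in> closure {x. \<psi> x \<noteq> 0}"
  proof (rule ccontr)
    assume x: "x \<notin> closure {x. \<psi> x \<noteq> 0}"
    define C where "C = - closure {x. \<psi> x \<noteq> 0}"
    have C: "open C" and Cx: "x \<in> C" unfolding C_def by (rule open_Compl[OF closed_closure], rule Compl_iff[THEN iffD2, OF x])
    have "0 = \<psi> y" if "y \<in> C" for y
      using that unfolding C_def by (metis ComplD test_function_zero[OF assms(1)])
    note C = C Cx this
    have "(\<psi> has_derivative (\<lambda>b. 0)) (at x)"
      by (rule has_derivative_transform_within_open[OF has_derivative_const C])
    then show False using nz by (simp add: frechet_derivative_eq)
  qed
qed

text \<open>The unnormalised standard mollifier \<open>exp (- 1 / (r^2 - |x - a|^2))\<close>; its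
  mass enters later just as a positive constant. The squared distance keeps it smooth at the
  centre.\<close>

definition bump :: "'a::euclidean_space \<Rightarrow> real \<Rightarrow> 'a \<Rightarrow> real" where
  "bump a r x = flat 1 (r\<^sup>2 - (x - a) \<bullet> (x - a))"

lemma k_times_cont_diff_bump: "k_times_cont_diff k (bump a r)"
proof -
  have "k_times_cont_diff k (\<lambda>x. r\<^sup>2 + (-1) * ((x - a) \<bullet> (x - a)))"
    by (intro k_times_cont_diff_add k_times_cont_diff_mult k_times_cont_diff_const k_times_cont_diff_dist_square)
  then show ?thesis
    unfolding bump_def[abs_def] by (intro k_times_cont_diff_flat) simp
qed

lemma bump_nonneg: "0 \<le> bump a r x"
  by (simp add: bump_def flat_def)

lemma bump_le_1: "bump a r x \<le> 1"
  by (simp add: bump_def flat_def)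

lemma bump_pos_iff: "0 < r \<Longrightarrow> 0 < bump a r x \<longleftrightarrow> x \<in> ball a r"
  using power_less_imp_less_base[of "norm (a - x)" 2 r] power_strict_mono[of "norm (a - x)" r 2]
  by (auto simp: bump_def flat_def dist_norm norm_minus_commute power2_norm_eq_inner[symmetric])

lemma bump_eq_0: "0 < r \<Longrightarrow> x \<notin> ball a r \<Longrightarrow> bump a r x = 0"
  using bump_pos_iff[of r a x] bump_nonneg[of a r x] by linarith

text \<open>For \<open>c > 0\<close> the values \<open>flat 1 (n * c) = exp (- 1 / (n * c))\<close>
  tend to 1, so these smooth functions converge to the indicator of the open box from inside it,
  with values in \<open>[0, 1]\<close>. Test functions thereby reach indicators of boxes by
  dominated convergence.\<close>

definition box_approx :: "'a::euclidean_space \<Rightarrow> 'a \<Rightarrow> nat \<Rightarrow> 'a \<Rightarrow> real" where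
  "box_approx l u n x = (\<Prod>b\<in>Basis. flat 1 (real n * (x \<bullet> b - l \<bullet> b)) * flat 1 (real n * (u \<bullet> b - x \<bullet> b)))"

lemma k_times_cont_diff_box_approx: "k_times_cont_diff k (box_approx l u n)"
proof -
  have "k_times_cont_diff k (\<lambda>x. real n * (x \<bullet> b - l \<bullet> b))" "k_times_cont_diff k (\<lambda>x. real n * (u \<bullet> b - x \<bullet> b))" for b
    using k_times_cont_diff_affine[of k "real n *\<^sub>R b" "- real n * (l \<bullet> b)"]
      k_times_cont_diff_affine[of k "- real n *\<^sub>R b" "real n * (u \<bullet> b)"]
    by (simp_all add: right_diff_distrib add.commute)
  then show ?thesis
    unfolding box_approx_def[abs_def]
    by (intro k_times_cont_diff_prod k_times_cont_diff_mult[where f = "\<lambda>x. flat _ (_ x)"] k_times_cont_diff_flat) auto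
qed

lemma flat_1_bounds: "0 \<le> flat 1 t" "flat 1 t \<le> 1"
  by (auto simp: flat_def)

lemma box_approx_bounds: "0 \<le> box_approx l u n x" "box_approx l u n x \<le> 1"
  unfolding box_approx_def
  by (auto intro!: prod_nonneg prod_le_1 mult_nonneg_nonneg mult_le_one flat_1_bounds)

lemma box_approx_eq_0:
  assumes "x \<notin> box l u"
  shows "box_approx l u n x = 0"
proof -
  obtain b where b: "b \<in> Basis" "x \<bullet> b \<le> l \<bullet> b \<or> u \<bullet> b \<le> x \<bullet> b"
    using assms by (auto simp: mem_box not_less)
  then have "flat 1 (real n * (x \<bullet> b - l \<bullet> b)) * flat 1 (real n * (u \<bullet> b - x \<bullet> b)) = 0"
    by (auto simp: flat_def zero_less_mult_iff)
  then show ?thesis unfolding box_approx_def using b(1) by (auto intro!: prod_zero)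
qed

lemma box_approx_tendsto: "(\<lambda>n. box_approx l u n x) \<longlonglongrightarrow> indicator (box l u) x"
proof (cases "x \<in> box l u")
  case False
  then show ?thesis by (simp add: box_approx_eq_0)
next
  case True
  have lim: "(\<lambda>n. flat 1 (real n * c)) \<longlonglongrightarrow> 1" if "0 < c" for c
  proof (rule Lim_transform_eventually)
    have "(\<lambda>n. exp (- (1 / (real n * c)))) \<longlonglongrightarrow> exp (- 0)"
      using that by (intro tendsto_intros tendsto_divide_0[OF tendsto_const] filterlim_at_top_imp_at_infinity
        filterlim_tendsto_pos_mult_at_top[OF tendsto_const that, of real sequentially, unfolded mult.commute[of c]] filterlim_real_sequentially)
    then show "(\<lambda>n. exp (- (1 / (real n * c)))) \<longlonglongrightarrow> 1" by simp
    show "\<forall>\<^sub>F n in sequentially. exp (- (1 / (real n * c))) = flat 1 (real n * c)"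
      using eventually_gt_at_top[of 0] by eventually_elim (use that in \<open>auto simp: flat_def\<close>)
  qed
  have "(\<lambda>n. box_approx l u n x) \<longlonglongrightarrow> (\<Prod>b\<in>(Basis::'a set). 1 * 1)"
    unfolding box_approx_def
    by (intro tendsto_prod tendsto_mult lim) (use True in \<open>auto simp: mem_box\<close>)
  then show ?thesis using True by simp
qed

section \<open>Weak gradients\<close>

lemma lebesgue_on_measurable_iff:
  fixes f :: "'a::euclidean_space \<Rightarrow> 'b::real_normed_vector"
  assumes "S \<in> sets lebesgue"
  shows "f \<in> borel_measurable (lebesgue_on S) \<longleftrightarrow> (\<lambda>x. indicator S x *\<^sub>R f x) \<in> borel_measurable lebesgue"
  using assms by (subst borel_measurable_restrict_space_iff) (auto simp: mult.commute)

lemma lebesgue_on_integrable_iff: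
  fixes f :: "'a::euclidean_space \<Rightarrow> 'b::{banach, second_countable_topology}"
  assumes "S \<in> sets lebesgue"
  shows "integrable (lebesgue_on S) f \<longleftrightarrow> integrable lebesgue (\<lambda>x. indicator S x *\<^sub>R f x)"
  using assms by (subst integrable_restrict_space) auto

lemma lebesgue_on_integral_eq:
  fixes f :: "'a::euclidean_space \<Rightarrow> 'b::{banach, second_countable_topology}"
  assumes "S \<in> sets lebesgue"
  shows "(LINT x|lebesgue_on S. f x) = (LINT x|lebesgue. indicator S x *\<^sub>R f x)"
  using assms by (subst integral_restrict_space) auto

lemma lebesgue_on_AE_iff:
  assumes "S \<in> sets lebesgue"
  shows "(AE x in lebesgue_on S. P x) \<longleftrightarrow> (AE x in lebesgue. x \<in> S \<longrightarrow> P x)"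
  using assms by (subst AE_restrict_space_iff) auto

text \<open>The positive and negative parts are densities of two measures that agree on boxes, which
  generate the Borel sets and are stable under intersection.\<close>

lemma zero_integral_on_boxes_imp_AE_zero:
  fixes F :: "'a::euclidean_space \<Rightarrow> real"
  assumes F: "integrable lebesgue F"
    and box: "\<And>l u. (LINT x|lebesgue. F x * indicator (box l u) x) = 0"
  shows "AE x in lebesgue. F x = 0"
proof -
  \<comment> \<open>Boxes generate the Borel sets only, so \<open>F\<close> is first replaced by a
    Borel function that equals it almost everywhere.\<close>
  obtain G where [measurable]: "G \<in> borel_measurable lborel" and G: "AE x in lborel. F x = G x"
    using completion_ex_borel_measurable_real[OF borel_measurable_integrable[OF F]] by blast
  have G_leb: "AE x in lebesgue. F x = G x" using G by (rule AE_completion)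
  have G_int: "integrable lborel G"
  proof -
    have "integrable lebesgue G"
    proof (rule integrable_cong_AE_imp[OF F])
      show "G \<in> borel_measurable lebesgue" by (rule measurable_completion) measurable
    qed (use G_leb in \<open>auto elim: eventually_mono\<close>)
    then show ?thesis by (simp add: integrable_completion)
  qed
  define P where "P x = max 0 (G x)" for x
  define N where "N x = max 0 (- G x)" for x
  have [measurable]: "P \<in> borel_measurable borel" "N \<in> borel_measurable borel"
    unfolding P_def N_def using \<open>G \<in> borel_measurable lborel\<close> by simp_all
  have PN0: "0 \<le> P x" "0 \<le> N x" for x by (simp_all add: P_def N_def)
  have PN_int: "integrable lborel P" "integrable lborel N"
    unfolding P_def N_def using G_int by auto
  have nn: "emeasure (density lborel (\<lambda>x. ennreal (H x))) B = ennreal (LINT x|lborel. H x * indicator B x)"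
    if "integrable lborel H" "\<And>x. 0 \<le> H x" "B \<in> sets borel" for H :: "'a \<Rightarrow> real" and B
  proof -
    have "emeasure (density lborel (\<lambda>x. ennreal (H x))) B = (\<integral>\<^sup>+x. ennreal (H x) * indicator B x \<partial>lborel)"
      using that by (intro emeasure_density) auto
    also have "\<dots> = (\<integral>\<^sup>+x. ennreal (H x * indicator B x) \<partial>lborel)"
      using that(2) by (intro nn_integral_cong) (auto simp: indicator_def)
    also have "\<dots> = ennreal (LINT x|lborel. H x * indicator B x)"
      using that by (intro nn_integral_eq_integral integrable_real_mult_indicator) (auto simp: mult.commute)
    finally show ?thesis .
  qed
  have "density lborel (\<lambda>x. ennreal (P x)) = density lborel (\<lambda>x. ennreal (N x))"
  proof (rule measure_eqI_generator_eq[where E = "range (\<lambda>(a, b). box a b)" and \<Omega> = UNIV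
        and A = "\<lambda>n. box (- (real n *\<^sub>R One)) (real n *\<^sub>R One)"])
    show "Int_stable (range (\<lambda>(a, b). box a b :: 'a set))"
      by (auto simp: Int_stable_def box_Int_box)
    show "sets (density lborel (\<lambda>x. ennreal (P x))) = sigma_sets UNIV (range (\<lambda>(a, b). box a b))"
      "sets (density lborel (\<lambda>x. ennreal (N x))) = sigma_sets UNIV (range (\<lambda>(a, b). box a b))"
      by (simp_all add: borel_eq_box)
    fix X :: "'a set" assume "X \<in> range (\<lambda>(a, b). box a b)"
    then obtain l u where X: "X = box l u" by auto
    have "(LINT x|lborel. G x * indicator X x) = (LINT x|lebesgue. G x * indicator X x)"
      unfolding X by (subst integral_completion) auto
    also have "\<dots> = (LINT x|lebesgue. F x * indicator X x)"
      unfolding X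
    proof (rule integral_cong_AE)
      show "(\<lambda>x. G x * indicator (box l u) x) \<in> borel_measurable lebesgue"
        by (rule measurable_completion) measurable
      show "(\<lambda>x. F x * indicator (box l u) x) \<in> borel_measurable lebesgue"
        using F by (intro borel_measurable_times borel_measurable_indicator) auto
    qed (use G_leb in auto)
    also have "\<dots> = 0" unfolding X by (rule box)
    finally have "(LINT x|lborel. G x * indicator X x) = 0" .
    moreover have "G x = P x - N x" for x by (auto simp: P_def N_def)
    moreover have "integrable lborel (\<lambda>x. P x * indicator X x)" "integrable lborel (\<lambda>x. N x * indicator X x)"
      using PN_int X by (auto intro!: integrable_real_mult_indicator)
    ultimately have "(LINT x|lborel. P x * indicator X x) = (LINT x|lborel. N x * indicator X x)"
      by (simp add: left_diff_distrib)
    then show "emeasure (density lborel (\<lambda>x. ennreal (P x))) X = emeasure (density lborel (\<lambda>x. ennreal (N x))) X"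
      using X by (simp add: nn[OF PN_int(1) PN0(1)] nn[OF PN_int(2) PN0(2)])
  next
    show "(\<Union>n. box (- (real n *\<^sub>R One)) (real n *\<^sub>R One)) = (UNIV :: 'a set)"
      by (rule UN_box_eq_UNIV)
    show "emeasure (density lborel (\<lambda>x. ennreal (P x))) (box (- (real n *\<^sub>R One)) (real n *\<^sub>R One)) \<noteq> \<infinity>" for n
      by (simp add: nn[OF PN_int(1) PN0(1)])
  qed auto
  then have "AE x in lborel. ennreal (P x) = ennreal (N x)"
    by (intro sigma_finite_measure.density_unique[OF sigma_finite_lborel]) auto
  then have "AE x in lborel. G x = 0"
  proof eventually_elim
    fix x assume "ennreal (P x) = ennreal (N x)"
    then have "P x = N x" by (simp add: P_def N_def)
    then show "G x = 0" by (auto simp: P_def N_def max_def split: if_splits)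
  qed
  then have "AE x in lebesgue. G x = 0" by (rule AE_completion)
  with G_leb show ?thesis by eventually_elim auto
qed

lemma test_function_bound:
  assumes "test_function U \<psi>"
  obtains B where "\<And>x. \<bar>\<psi> x\<bar> \<le> B * indicator (closure {x. \<psi> x \<noteq> 0}) x" "0 \<le> B"
proof -
  define K where "K = closure {x. \<psi> x \<noteq> 0}"
  have "compact (\<psi> ` K)"
    using assms test_function_continuous[OF assms] unfolding K_def test_function_def
    by (intro compact_continuous_image) (auto intro: continuous_on_subset)
  then have "bounded (\<psi> ` K)" by (rule compact_imp_bounded)
  then obtain B where B: "0 < B" "\<forall>y\<in>\<psi> ` K. norm y \<le> B" unfolding bounded_pos by blast
  show ?thesis
  proof (rule that[of B])
    show "\<bar>\<psi> x\<bar> \<le> B * indicator (closure {x. \<psi> x \<noteq> 0}) x" for x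
    proof (cases "x \<in> K")
      case True
      then have "norm (\<psi> x) \<le> B" using B(2) by blast
      then show ?thesis using True unfolding K_def by simp
    next
      case False
      then have "\<psi> x = 0" unfolding K_def by (rule test_function_zero[OF assms])
      then show ?thesis using False unfolding K_def by simp
    qed
  qed (use B in simp)
qed

text \<open>Local integrability controls \<open>f\<close> on compact subsets, so \<open>f\<close> is
  cut off to the support of \<open>\<psi>\<close> before the bound on \<open>\<psi>\<close> is
  applied.\<close>

lemma integrable_test_function_times:
  fixes f :: "'a::euclidean_space \<Rightarrow> 'b::euclidean_space"
  assumes U: "open U" and f: "locally_integrable U f" and \<psi>: "test_function U \<psi>"
  shows "integrable (lebesgue_on U) (\<lambda>x. \<psi> x *\<^sub>R f x)"
proof -
  define K where "K = closure {x. \<psi> x \<noteq> 0}"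
  have K: "compact K" "K \<subseteq> U" using \<psi> by (auto simp: test_function_def K_def)
  have [simp]: "K \<in> sets lebesgue" "U \<in> sets lebesgue" using fmeasurableD[OF lmeasurable_compact[OF K(1)]] U by auto
  have zero: "\<psi> x = 0" if "x \<notin> K" for x
    using that unfolding K_def by (rule test_function_zero[OF \<psi>])
  have [measurable]: "\<psi> \<in> borel_measurable lebesgue"
    using test_function_continuous[OF \<psi>] by (simp add: continuous_imp_measurable_on_sets_lebesgue measurable_completion borel_measurable_continuous_onI)
  have fK: "integrable lebesgue (\<lambda>x. indicator K x *\<^sub>R f x)"
    using f K by (auto simp: locally_integrable_def lebesgue_on_integrable_iff)
  obtain B where B: "\<And>x. \<bar>\<psi> x\<bar> \<le> B * indicator (closure {x. \<psi> x \<noteq> 0}) x" "0 \<le> B"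
    using test_function_bound[OF \<psi>] by blast
  have "integrable lebesgue (\<lambda>x. \<psi> x *\<^sub>R (indicator K x *\<^sub>R f x))"
  proof (rule Bochner_Integration.integrable_bound[OF integrable_scaleR_right[OF fK, of B]])
    show "(\<lambda>x. \<psi> x *\<^sub>R (indicator K x *\<^sub>R f x)) \<in> borel_measurable lebesgue"
      by (intro borel_measurable_scaleR borel_measurable_integrable[OF fK]) measurable
    show "AE x in lebesgue. norm (\<psi> x *\<^sub>R (indicator K x *\<^sub>R f x)) \<le> norm (B *\<^sub>R (indicator K x *\<^sub>R f x))"
    proof (intro always_eventually allI)
      fix x
      have "B * indicator (closure {x. \<psi> x \<noteq> 0}) x \<le> B * 1"
        using B(2) by (intro mult_left_mono indicator_le_1)
      with B(1)[of x] have "\<bar>\<psi> x\<bar> \<le> B" by simp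
      then have "\<bar>\<psi> x\<bar> * norm (indicator K x *\<^sub>R f x) \<le> B * norm (indicator K x *\<^sub>R f x)"
        by (rule mult_right_mono) simp
      then show "norm (\<psi> x *\<^sub>R (indicator K x *\<^sub>R f x)) \<le> norm (B *\<^sub>R (indicator K x *\<^sub>R f x))"
        using B(2) by (simp only: norm_scaleR abs_of_nonneg)
    qed
  qed
  also have "(\<lambda>x. \<psi> x *\<^sub>R (indicator K x *\<^sub>R f x)) = (\<lambda>x. indicator U x *\<^sub>R (\<psi> x *\<^sub>R f x))"
    using K zero by (auto simp: fun_eq_iff indicator_def)
  finally show ?thesis by (simp add: lebesgue_on_integrable_iff)
qed

text \<open>\<open>U\<close> is covered by countably many closed boxes, on each of which
  \<open>f\<close> is integrable. There the functions \<open>box_approx\<close> convert the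
  hypothesis into vanishing integrals over all boxes.\<close>

lemma fundamental_lemma_calculus_of_variations:
  fixes f :: "'a::euclidean_space \<Rightarrow> real"
  assumes U: "open U" and f: "locally_integrable U f"
    and test: "\<And>\<psi>. test_function U \<psi> \<Longrightarrow> (LINT x|lebesgue_on U. f x * \<psi> x) = 0"
  shows "AE x in lebesgue_on U. f x = 0"
proof -
  have [simp]: "U \<in> sets lebesgue" using U by auto
  obtain D where D: "countable D" "D \<subseteq> Pow U" "\<And>X. X \<in> D \<Longrightarrow> \<exists>a b. X = cbox a b" "\<Union>D = U"
    using open_countable_Union_open_cbox[OF U] by blast
  have "AE x in lebesgue. x \<in> X \<longrightarrow> f x = 0" if XD: "X \<in> D" for X
  proof -
    obtain c d where X: "X = cbox c d" using D(3)[OF XD] by blast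
    have sub: "cbox c d \<subseteq> U" using D(2) XD X by auto
    have fcd: "integrable lebesgue (\<lambda>x. indicator (cbox c d) x *\<^sub>R f x)"
    proof (rule lebesgue_on_integrable_iff[THEN iffD1])
      show "integrable (lebesgue_on (cbox c d)) f" using f sub by (simp add: locally_integrable_def)
    qed simp
    define F where "F x = indicator (box c d) x *\<^sub>R f x" for x
    have F: "integrable lebesgue F"
    proof -
      have "integrable lebesgue (\<lambda>x. indicator (box c d) x *\<^sub>R (indicator (cbox c d) x *\<^sub>R f x))"
        by (rule integrable_mult_indicator[OF _ fcd]) auto
      also have "(\<lambda>x. indicator (box c d) x *\<^sub>R (indicator (cbox c d) x *\<^sub>R f x)) = F"
        using box_subset_cbox[of c d] by (auto simp: F_def indicator_def fun_eq_iff)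
      finally show ?thesis .
    qed
    have "AE x in lebesgue. F x = 0"
    proof (rule zero_integral_on_boxes_imp_AE_zero[OF F])
      fix l u :: 'a
      \<comment> \<open>The intersection of two boxes is a box; if nonempty, its closure stays in
        \<open>cbox c d\<close>, so the approximations of its indicator are test functions on
        \<open>U\<close>.\<close>
      obtain l' u' where lu: "box l u \<inter> box c d = box l' u'" by (rule that[OF box_Int_box])
      have eq: "F x * indicator (box l u) x = indicator (box l' u') x * f x" for x
        using lu by (auto simp: F_def indicator_def)
      show "(LINT x|lebesgue. F x * indicator (box l u) x) = 0"
      proof (cases "box l' u' = {}")
        case True
        then show ?thesis by (simp add: eq)
      next
        case False
        have "cbox l' u' = closure (box l' u')" using False by (simp add: closure_box)
        also have "\<dots> \<subseteq> closure (box c d)" using lu by (intro closure_mono) auto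
        also have "\<dots> \<subseteq> cbox c d" by (rule closure_minimal[OF box_subset_cbox closed_cbox])
        finally have sub': "cbox l' u' \<subseteq> cbox c d" .
        have tf: "test_function U (box_approx l' u' n)" for n
        proof (rule test_functionI[where K = "cbox l' u'"])
          show "x \<in> cbox l' u'" if "box_approx l' u' n x \<noteq> 0" for x
            using that box_approx_eq_0[of x l' u' n] box_subset_cbox[of l' u'] by blast
        qed (use sub sub' k_times_cont_diff_box_approx in auto)
        have "(\<lambda>n. LINT x|lebesgue. box_approx l' u' n x * (indicator (cbox c d) x *\<^sub>R f x))
            \<longlonglongrightarrow> (LINT x|lebesgue. indicator (box l' u') x * f x)"
        proof (rule integral_dominated_convergence[where w = "\<lambda>x. norm (indicator (cbox c d) x *\<^sub>R f x)"])
          have box_eq: "indicator (box l' u') x * f x = indicator (box l' u') x *\<^sub>R (indicator (cbox c d) x *\<^sub>R f x)" for x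
            using sub' box_subset_cbox[of l' u'] by (auto simp: indicator_def)
          show "(\<lambda>x. indicator (box l' u') x * f x) \<in> borel_measurable lebesgue"
            unfolding box_eq by (intro borel_measurable_scaleR borel_measurable_indicator borel_measurable_integrable[OF fcd]) auto
          have "box_approx l' u' n \<in> borel_measurable lebesgue" for n
            using test_function_continuous[OF tf] by (simp add: measurable_completion borel_measurable_continuous_onI)
          then show "(\<lambda>x. box_approx l' u' n x * (indicator (cbox c d) x *\<^sub>R f x)) \<in> borel_measurable lebesgue" for n
            by (intro borel_measurable_times borel_measurable_integrable[OF fcd])
          show "AE x in lebesgue. (\<lambda>n. box_approx l' u' n x * (indicator (cbox c d) x *\<^sub>R f x)) \<longlonglongrightarrow> indicator (box l' u') x * f x"
          proof (intro always_eventually allI)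
            fix x
            show "(\<lambda>n. box_approx l' u' n x * (indicator (cbox c d) x *\<^sub>R f x)) \<longlonglongrightarrow> indicator (box l' u') x * f x"
              unfolding box_eq real_scaleR_def[of "indicator (box l' u') x"]
              by (intro tendsto_mult box_approx_tendsto tendsto_const)
          qed
          show "AE x in lebesgue. norm (box_approx l' u' n x * (indicator (cbox c d) x *\<^sub>R f x)) \<le> norm (indicator (cbox c d) x *\<^sub>R f x)" for n
            using box_approx_bounds[of l' u' n]
            by (intro always_eventually allI) (auto simp: abs_mult intro!: mult_left_le_one_le)
        qed (use fcd in auto)
        moreover have "(LINT x|lebesgue. box_approx l' u' n x * (indicator (cbox c d) x *\<^sub>R f x)) = 0" for n
        proof -
          have "box_approx l' u' n x * (indicator (cbox c d) x *\<^sub>R f x) = indicator U x *\<^sub>R (f x * box_approx l' u' n x)" for x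
            using box_approx_eq_0[of x l' u' n] sub sub' box_subset_cbox[of l' u'] by (auto simp: indicator_def)
          then have "(LINT x|lebesgue. box_approx l' u' n x * (indicator (cbox c d) x *\<^sub>R f x)) = (LINT x|lebesgue. indicator U x *\<^sub>R (f x * box_approx l' u' n x))"
            by (simp only:)
          also have "\<dots> = (LINT x|lebesgue_on U. f x * box_approx l' u' n x)"
            by (simp add: lebesgue_on_integral_eq)
          also have "\<dots> = 0" by (rule test[OF tf])
          finally show ?thesis .
        qed
        ultimately show ?thesis
          by (simp add: eq LIMSEQ_const_iff)
      qed
    qed
    \<comment> \<open>\<open>F\<close> is supported in the open box; what it misses of the closed
      one is negligible.\<close>
    moreover have "AE x in lebesgue. x \<notin> cbox c d - box c d"
      by (rule AE_not_in) (simp add: negligible_iff_null_sets[symmetric] negligible_frontier_interval)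
    ultimately show ?thesis
      unfolding X by eventually_elim (auto simp: F_def)
  qed
  then have "AE x in lebesgue. \<forall>X\<in>D. x \<in> X \<longrightarrow> f x = 0"
    using D(1) by (subst AE_ball_countable) auto
  then have "AE x in lebesgue. x \<in> U \<longrightarrow> f x = 0"
    by eventually_elim (use D(4) in auto)
  then show ?thesis by (simp add: lebesgue_on_AE_iff)
qed

section \<open>Uniqueness and linearity of weak gradients\<close>

lemma locally_integrable_lincomb:
  fixes f g :: "'a::euclidean_space \<Rightarrow> 'b::euclidean_space"
  assumes "locally_integrable U f" "locally_integrable U g"
  shows "locally_integrable U (\<lambda>x. s *\<^sub>R f x + t *\<^sub>R g x)"
  using assms by (auto simp: locally_integrable_def)

lemma has_weak_gradient_unique:
  assumes U: "open U" and G: "has_weak_gradient U v G" and H: "has_weak_gradient U v H"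
  shows "AE x in lebesgue_on U. G x = H x"
proof -
  have loc: "locally_integrable U G" "locally_integrable U H" using G H by (auto simp: has_weak_gradient_def)
  have "AE x in lebesgue_on U. (G x - H x) \<bullet> b = 0" if b: "b \<in> Basis" for b
  proof (rule fundamental_lemma_calculus_of_variations[OF U])
    show "locally_integrable U (\<lambda>x. (G x - H x) \<bullet> b)"
      using loc by (auto simp: locally_integrable_def)
    fix \<psi> :: "'a \<Rightarrow> real" assume \<psi>: "test_function U \<psi>"
    have int: "integrable (lebesgue_on U) (\<lambda>x. (G x \<bullet> b) * \<psi> x)" "integrable (lebesgue_on U) (\<lambda>x. (H x \<bullet> b) * \<psi> x)"
      using loc[THEN integrable_test_function_times[OF U _ \<psi>], THEN integrable_inner_left[of b, rotated]]
      by (simp_all add: mult.commute)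
    have wg: "(LINT x|lebesgue_on U. v x * frechet_derivative \<psi> (at x) b) = - (LINT x|lebesgue_on U. (K x \<bullet> b) * \<psi> x)"
      if "has_weak_gradient U v K" for K
      using that b \<psi> by (simp add: has_weak_gradient_def)
    have "(LINT x|lebesgue_on U. (G x \<bullet> b) * \<psi> x) = (LINT x|lebesgue_on U. (H x \<bullet> b) * \<psi> x)"
      using wg[OF G] wg[OF H] by linarith
    then show "(LINT x|lebesgue_on U. ((G x - H x) \<bullet> b) * \<psi> x) = 0"
      using int by (simp add: inner_diff_left left_diff_distrib)
  qed
  then have "AE x in lebesgue_on U. \<forall>b\<in>Basis. (G x - H x) \<bullet> b = 0"
    by (subst AE_ball_countable) (auto intro: countable_finite)
  then show ?thesis
    by eventually_elim (simp add: euclidean_all_zero_iff)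
qed

lemma has_weak_gradient_lincomb:
  assumes U: "open U" and G: "has_weak_gradient U u G" and H: "has_weak_gradient U v H"
  shows "has_weak_gradient U (\<lambda>x. s * u x + t * v x) (\<lambda>x. s *\<^sub>R G x + t *\<^sub>R H x)"
  unfolding has_weak_gradient_def
proof (intro conjI allI impI ballI)
  have loc: "locally_integrable U u" "locally_integrable U v" "locally_integrable U G" "locally_integrable U H"
    using G H by (auto simp: has_weak_gradient_def)
  show "locally_integrable U (\<lambda>x. s * u x + t * v x)" "locally_integrable U (\<lambda>x. s *\<^sub>R G x + t *\<^sub>R H x)"
    using locally_integrable_lincomb[OF loc(1,2), of s t] locally_integrable_lincomb[OF loc(3,4), of s t] by simp_all
  fix \<psi> :: "'a \<Rightarrow> real" and b :: 'a assume \<psi>: "test_function U \<psi>" and b: "b \<in> Basis"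
  let ?d = "\<lambda>x. frechet_derivative \<psi> (at x) b"
  have i1: "integrable (lebesgue_on U) (\<lambda>x. (G x \<bullet> b) * \<psi> x)" "integrable (lebesgue_on U) (\<lambda>x. (H x \<bullet> b) * \<psi> x)"
    using loc(3,4)[THEN integrable_test_function_times[OF U _ \<psi>], THEN integrable_inner_left[of b, rotated]]
    by (simp_all add: mult.commute)
  have i2: "integrable (lebesgue_on U) (\<lambda>x. u x * ?d x)" "integrable (lebesgue_on U) (\<lambda>x. v x * ?d x)"
    using loc(1,2)[THEN integrable_test_function_times[OF U _ test_function_derivative[OF \<psi> b]]]
    by (simp_all add: mult.commute)
  have e: "(LINT x|lebesgue_on U. u x * ?d x) = - (LINT x|lebesgue_on U. (G x \<bullet> b) * \<psi> x)"
    "(LINT x|lebesgue_on U. v x * ?d x) = - (LINT x|lebesgue_on U. (H x \<bullet> b) * \<psi> x)"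
    using G H \<psi> b by (auto simp: has_weak_gradient_def)
  have "(LINT x|lebesgue_on U. (s * u x + t * v x) * ?d x)
      = s * (LINT x|lebesgue_on U. u x * ?d x) + t * (LINT x|lebesgue_on U. v x * ?d x)"
    using i2 by (simp add: distrib_right mult.assoc)
  also have "\<dots> = - (LINT x|lebesgue_on U. ((s *\<^sub>R G x + t *\<^sub>R H x) \<bullet> b) * \<psi> x)"
    using i1 unfolding e by (simp add: inner_add_left distrib_right mult.assoc)
  finally show "(LINT x|lebesgue_on U. (s * u x + t * v x) * ?d x)
      = - (LINT x|lebesgue_on U. ((s *\<^sub>R G x + t *\<^sub>R H x) \<bullet> b) * \<psi> x)" .
qed

text \<open>\<open>weak_grad\<close> may pick any weak gradient. Uniqueness identifies the pick
  almost everywhere with one in \<open>L^p\<close>, and completeness of Lebesgue measure turns this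
  into measurability.\<close>

lemma weak_grad_W1:
  assumes U: "open U" and v: "v \<in> W1 U p"
  shows "has_weak_gradient U v (weak_grad U v)" "Lp_fun (lebesgue_on U) p (weak_grad U v)"
proof -
  obtain G where G: "Lp_fun (lebesgue_on U) p G" "has_weak_gradient U v G"
    using v by (auto simp: W1_def Lp_space_iff)
  show wg: "has_weak_gradient U v (weak_grad U v)"
    unfolding weak_grad_def by (rule someI[where P = "has_weak_gradient U v", OF G(2)])
  have AE: "AE x in lebesgue_on U. G x = weak_grad U v x"
    by (rule has_weak_gradient_unique[OF U G(2) wg])
  have m: "weak_grad U v \<in> borel_measurable (lebesgue_on U)"
  proof -
    have [simp]: "U \<in> sets lebesgue" using U by auto
    have "AE x in lebesgue. indicator U x *\<^sub>R G x = indicator U x *\<^sub>R weak_grad U v x"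
      using AE unfolding lebesgue_on_AE_iff[OF \<open>U \<in> sets lebesgue\<close>] by eventually_elim (auto simp: indicator_def)
    then show ?thesis
      using Lp_fun_measurable[OF G(1)] by (auto simp: lebesgue_on_measurable_iff intro: borel_measurable_AE)
  qed
  show "Lp_fun (lebesgue_on U) p (weak_grad U v)"
    unfolding Lp_fun_def
  proof
    show "integrable (lebesgue_on U) (\<lambda>x. norm (weak_grad U v x) powr p)"
      using Lp_fun_integrable[OF G(1)] Lp_fun_measurable[OF G(1)] m AE
      by (subst integrable_cong_AE[of _ _ "\<lambda>x. norm (G x) powr p"]) auto
  qed (rule m)
qed

section \<open>Morrey's estimate\<close>

text \<open>The derivative of \<open>flat 1\<close>, evaluated at \<open>r^2 - |x - a|^2\<close>.
  The polynomial keeps the shape that \<open>has_derivative_flat\<close> produces for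
  \<open>P = 1\<close>, so that both match syntactically.\<close>

definition bump' :: "'a::euclidean_space \<Rightarrow> real \<Rightarrow> 'a \<Rightarrow> real" where
  "bump' a r x = flat ([:0, 0, 1:] * (1 - pderiv 1)) (r\<^sup>2 - (x - a) \<bullet> (x - a))"

lemma has_derivative_bump:
  "(bump a r has_derivative (\<lambda>v. - 2 * ((x - a) \<bullet> v) * bump' a r x)) (at x)"
proof -
  have "((\<lambda>x. r\<^sup>2 - (x - a) \<bullet> (x - a)) has_derivative (\<lambda>v. - 2 * ((x - a) \<bullet> v))) (at x)"
    by (auto intro!: derivative_eq_intros simp: inner_commute)
  from has_derivative_compose[OF this has_derivative_flat[of 1, unfolded has_field_derivative_def]]
  show ?thesis
    unfolding bump_def[abs_def] bump'_def by (simp add: mult.commute mult.left_commute)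
qed

lemma continuous_on_flat: "continuous_on A (flat P)"
  using has_derivative_flat[of P] by (intro continuous_at_imp_continuous_on) (blast intro: DERIV_isCont)

lemma continuous_on_bump [continuous_intros]:
  assumes "continuous_on A f"
  shows "continuous_on A (\<lambda>x. bump a r (f x))" "continuous_on A (\<lambda>x. bump' a r (f x))"
proof -
  have c: "continuous_on A (\<lambda>x. flat P (h x))" if "continuous_on A h" for P h
    by (rule continuous_on_compose2[OF continuous_on_flat[of UNIV] that]) auto
  show "continuous_on A (\<lambda>x. bump a r (f x))" "continuous_on A (\<lambda>x. bump' a r (f x))"
    unfolding bump_def bump'_def by (intro c continuous_intros assms)+
qed

lemma bump'_eq_0:
  assumes "0 < r" "x \<notin> ball a r"
  shows "bump' a r x = 0"
proof -
  have "r\<^sup>2 \<le> (norm (x - a))\<^sup>2"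
    using assms by (intro power_mono) (auto simp: dist_norm norm_minus_commute)
  then show ?thesis by (simp add: bump'_def flat_def power2_norm_eq_inner)
qed

text \<open>For the dilation \<open>z \<mapsto> y + t *\<^sub>R (z - y)\<close> and a bump \<open>\<eta>\<close>, the kernel
  \<open>\<eta> (y + (x - y) / t) / t ^ d\<close> has \<open>t\<close>-derivative minus the divergence of
  \<open>(\<eta> (y + (x - y) / t) / t ^ (d + 1)) *\<^sub>R (x - y)\<close>.\<close>

definition dilation_inv :: "'a::euclidean_space \<Rightarrow> real \<Rightarrow> 'a \<Rightarrow> 'a" where
  "dilation_inv y t x = y + (1/t) *\<^sub>R (x - y)"

definition bump_kernel :: "'a::euclidean_space \<Rightarrow> 'a \<Rightarrow> real \<Rightarrow> real \<Rightarrow> 'a \<Rightarrow> real" where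
  "bump_kernel y a r t x = bump a r (dilation_inv y t x) / t ^ DIM('a)"

definition bump_kernel_deriv :: "'a::euclidean_space \<Rightarrow> 'a \<Rightarrow> real \<Rightarrow> real \<Rightarrow> 'a \<Rightarrow> real" where
  "bump_kernel_deriv y a r t x = 2 * ((dilation_inv y t x - a) \<bullet> (x - y)) * bump' a r (dilation_inv y t x) / t ^ (DIM('a) + 2)
     - real DIM('a) * bump a r (dilation_inv y t x) / t ^ (DIM('a) + 1)"

definition bump_flux :: "'a::euclidean_space \<Rightarrow> 'a \<Rightarrow> real \<Rightarrow> real \<Rightarrow> 'a \<Rightarrow> 'a" where
  "bump_flux y a r t x = (bump a r (dilation_inv y t x) / t ^ (DIM('a) + 1)) *\<^sub>R (x - y)"

lemma dilation_inv_dilation: "0 < t \<Longrightarrow> dilation_inv y t (y + t *\<^sub>R (z - y)) = z"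
  by (simp add: dilation_inv_def)

lemma dist_dilation_inv: "0 < t \<Longrightarrow> dist a (dilation_inv y t x) = dist (y + t *\<^sub>R (a - y)) x / t"
proof -
  assume t: "0 < t"
  have "dist (y + t *\<^sub>R (a - y)) x = norm (t *\<^sub>R (a - dilation_inv y t x))"
    using t by (simp add: dist_norm dilation_inv_def algebra_simps)
  also have "\<dots> = t * dist a (dilation_inv y t x)"
    using t by (simp only: norm_scaleR dist_norm abs_of_pos)
  finally show ?thesis using t by simp
qed

lemma dilation_inv_in_ball: "0 < t \<Longrightarrow> dilation_inv y t x \<in> ball a r \<longleftrightarrow> x \<in> ball (y + t *\<^sub>R (a - y)) (t * r)"
  by (simp add: dist_dilation_inv field_simps)

lemma has_derivative_bump_dilation:
  "((\<lambda>x. bump a r (dilation_inv y t x)) has_derivative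
     (\<lambda>v. - 2 * ((dilation_inv y t x - a) \<bullet> ((1/t) *\<^sub>R v)) * bump' a r (dilation_inv y t x))) (at x)"
  by (rule has_derivative_compose[OF _ has_derivative_bump])
     (auto simp: dilation_inv_def[abs_def] intro!: derivative_eq_intros simp: scaleR_diff_right)

lemma bump_kernel_has_derivative:
  fixes y :: "'a::euclidean_space"
  assumes "0 < t"
  shows "((\<lambda>t. bump_kernel y a r t x) has_real_derivative bump_kernel_deriv y a r t x) (at t)"
proof -
  have w: "((\<lambda>t. dilation_inv y t x) has_derivative (\<lambda>s. (- s / t\<^sup>2) *\<^sub>R (x - y))) (at t)"
    unfolding dilation_inv_def using assms
    by (auto intro!: derivative_eq_intros simp: power2_eq_square divide_simps scaleR_left_diff_distrib)
  have b: "((\<lambda>t. bump a r (dilation_inv y t x)) has_real_derivative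
      2 * ((dilation_inv y t x - a) \<bullet> (x - y)) * bump' a r (dilation_inv y t x) / t\<^sup>2) (at t)"
    unfolding has_field_derivative_def
    by (rule has_derivative_eq_rhs[OF has_derivative_compose[OF w has_derivative_bump[of a r]]])
       (simp add: fun_eq_iff mult_ac)
  \<comment> \<open>The derivative of \<open>t ^ DIM('a)\<close> carries the truncated exponent
    \<open>DIM('a) - 1\<close>; the case split on \<open>DIM('a)\<close> removes that
    subtraction.\<close>
  show ?thesis
    unfolding bump_kernel_def bump_kernel_deriv_def using assms
    by (auto intro!: derivative_eq_intros b simp: divide_simps power2_eq_square)
       (cases "DIM('a)"; simp add: algebra_simps)
qed

lemma bump_kernel_zero:
  assumes "0 < r" "0 < t" "x \<notin> ball (y + t *\<^sub>R (a - y)) (t * r)"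
  shows "bump_kernel y a r t x = 0" "bump_kernel_deriv y a r t x = 0" "bump_flux y a r t x = 0"
  using assms dilation_inv_in_ball[OF assms(2), of y x a r]
  by (auto simp: bump_kernel_def bump_kernel_deriv_def bump_flux_def bump_eq_0 bump'_eq_0)

text \<open>Each component of the flux is a test function \<open>\<psi> b\<close>. Summing the
  defining identity of the weak gradient over the coordinates moves the divergence of the flux,
  which is minus \<open>bump_kernel_deriv\<close>, onto \<open>v\<close>; the two minus signs
  cancel.\<close>

lemma weak_gradient_bump_flux:
  fixes y :: "'a::euclidean_space"
  assumes U: "open U" and G: "has_weak_gradient U v G" and "0 < t" "0 < r"
    and sub: "cball (y + t *\<^sub>R (a - y)) (t * r) \<subseteq> U"
  shows "(LINT x|lebesgue_on U. v x * bump_kernel_deriv y a r t x) = (LINT x|lebesgue_on U. G x \<bullet> bump_flux y a r t x)"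
proof -
  define f where "f x = bump a r (dilation_inv y t x) / t ^ (DIM('a) + 1)" for x
  define \<psi> where "\<psi> b x = ((x - y) \<bullet> b) * f x" for b x
  have f_smooth: "k_times_cont_diff k f" for k
  proof -
    have "k_times_cont_diff k (\<lambda>x. bump a r ((y - (1/t) *\<^sub>R y) + (1/t) *\<^sub>R x) * (1 / t ^ (DIM('a) + 1)))"
      by (intro k_times_cont_diff_mult k_times_cont_diff_const k_times_cont_diff_compose_affine k_times_cont_diff_bump)
    then show ?thesis by (simp add: f_def[abs_def] dilation_inv_def algebra_simps)
  qed
  have f_zero: "x \<in> cball (y + t *\<^sub>R (a - y)) (t * r)" if "f x \<noteq> 0" for x
    using that dilation_inv_in_ball[OF \<open>0 < t\<close>, of y x a r] bump_eq_0[OF \<open>0 < r\<close>, of "dilation_inv y t x" a]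
      ball_subset_cball by (auto simp: f_def)
  have \<psi>: "test_function U (\<psi> b)" for b
  proof (rule test_functionI[where K = "cball (y + t *\<^sub>R (a - y)) (t * r)"])
    show "k_times_cont_diff k (\<psi> b)" for k
      using k_times_cont_diff_mult[OF k_times_cont_diff_affine[of k b "- (y \<bullet> b)"] f_smooth[of k]]
      by (simp add: \<psi>_def[abs_def] inner_diff_left)
  qed (use sub f_zero in \<open>auto simp: \<psi>_def\<close>)
  have der: "frechet_derivative (\<psi> b) (at x) b = f x - 2 * (((x - y) \<bullet> b) * ((dilation_inv y t x - a) \<bullet> b)) * bump' a r (dilation_inv y t x) / t ^ (DIM('a) + 2)"
    if b: "b \<in> Basis" for b x
  proof -
    have "(\<psi> b has_derivative (\<lambda>v. ((x - y) \<bullet> b) * ((- 2 * ((dilation_inv y t x - a) \<bullet> ((1/t) *\<^sub>R v)) * bump' a r (dilation_inv y t x)) * (1 / t ^ (DIM('a) + 1))) + (v \<bullet> b) * f x)) (at x)"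
    proof -
      have f_eq: "f = (\<lambda>x. bump a r (dilation_inv y t x) * (1 / t ^ (DIM('a) + 1)))"
        by (simp add: f_def fun_eq_iff)
      have "((\<lambda>x. (x - y) \<bullet> b) has_derivative (\<lambda>v. v \<bullet> b)) (at x)"
        by (auto intro!: derivative_eq_intros)
      then show ?thesis
        unfolding \<psi>_def[abs_def]
        by (rule has_derivative_mult) (unfold f_eq, rule has_derivative_mult_left[OF has_derivative_bump_dilation])
    qed
    from frechet_derivative_eq[OF this] show ?thesis
      using b \<open>0 < t\<close> by (simp add: field_simps)
  qed
  have sum_der: "(\<Sum>b\<in>Basis. frechet_derivative (\<psi> b) (at x) b) = - bump_kernel_deriv y a r t x" for x
  proof -
    have "(\<Sum>b\<in>Basis. frechet_derivative (\<psi> b) (at x) b) =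
       (\<Sum>b\<in>Basis. f x - 2 * (((x - y) \<bullet> b) * ((dilation_inv y t x - a) \<bullet> b)) * bump' a r (dilation_inv y t x) / t ^ (DIM('a) + 2))"
      by (intro sum.cong der) auto
    also have "\<dots> = real DIM('a) * f x - 2 * ((x - y) \<bullet> (dilation_inv y t x - a)) * bump' a r (dilation_inv y t x) / t ^ (DIM('a) + 2)"
      by (simp add: sum_subtractf sum_divide_distrib[symmetric] sum_distrib_right[symmetric] sum_distrib_left[symmetric] euclidean_inner[symmetric])
    also have "\<dots> = - bump_kernel_deriv y a r t x"
      by (simp add: bump_kernel_deriv_def f_def inner_commute)
    finally show ?thesis .
  qed
  have loc: "locally_integrable U v" "locally_integrable U G" using G by (auto simp: has_weak_gradient_def)
  have i1: "integrable (lebesgue_on U) (\<lambda>x. v x * frechet_derivative (\<psi> b) (at x) b)" if "b \<in> Basis" for b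
    using integrable_test_function_times[OF U loc(1) test_function_derivative[OF \<psi> that]] by (simp add: mult.commute)
  have i2: "integrable (lebesgue_on U) (\<lambda>x. (G x \<bullet> b) * \<psi> b x)" if "b \<in> Basis" for b
    using integrable_inner_left[OF integrable_test_function_times[OF U loc(2) \<psi>[of b]], of b] by (simp add: mult.commute)
  have "(LINT x|lebesgue_on U. v x * bump_kernel_deriv y a r t x) = - (LINT x|lebesgue_on U. (\<Sum>b\<in>Basis. v x * frechet_derivative (\<psi> b) (at x) b))"
    by (simp add: sum_distrib_left[symmetric] sum_der)
  also have "\<dots> = - (\<Sum>b\<in>Basis. LINT x|lebesgue_on U. v x * frechet_derivative (\<psi> b) (at x) b)"
    using i1 by (simp add: Bochner_Integration.integral_sum)
  also have "\<dots> = (\<Sum>b\<in>Basis. LINT x|lebesgue_on U. (G x \<bullet> b) * \<psi> b x)"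
    using G \<psi> by (simp add: has_weak_gradient_def sum_negf)
  also have "\<dots> = (LINT x|lebesgue_on U. (\<Sum>b\<in>Basis. (G x \<bullet> b) * \<psi> b x))"
    using i2 by (simp add: Bochner_Integration.integral_sum)
  also have "(\<lambda>x. \<Sum>b\<in>Basis. (G x \<bullet> b) * \<psi> b x) = (\<lambda>x. G x \<bullet> bump_flux y a r t x)"
  proof
    fix x
    have "G x \<bullet> bump_flux y a r t x = f x * (\<Sum>b\<in>Basis. (G x \<bullet> b) * ((x - y) \<bullet> b))"
      by (simp add: bump_flux_def f_def flip: euclidean_inner)
    then show "(\<Sum>b\<in>Basis. (G x \<bullet> b) * \<psi> b x) = G x \<bullet> bump_flux y a r t x"
      by (simp add: \<psi>_def sum_distrib_left mult_ac)
  qed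
  finally show ?thesis .
qed

text \<open>A point \<open>x\<close> of the support is the dilation of a point within
  \<open>R\<close> of \<open>y\<close>, so \<open>norm (x - y) <= t * R\<close>. This gains one
  power of \<open>t\<close> over the denominator \<open>t ^ (d + 1)\<close>.\<close>

lemma bump_flux_le:
  fixes y :: "'a::euclidean_space"
  assumes "0 < t" "0 < r" "ball a r \<subseteq> cball y R" "0 \<le> R"
  shows "norm (bump_flux y a r t x) \<le> R / t ^ DIM('a) * indicator (ball (y + t *\<^sub>R (a - y)) (t * r)) x"
proof (cases "x \<in> ball (y + t *\<^sub>R (a - y)) (t * r)")
  case True
  then have "dilation_inv y t x \<in> cball y R"
    using assms(3) dilation_inv_in_ball[OF assms(1)] by blast
  moreover have "dist y (dilation_inv y t x) = norm (x - y) / t"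
    using assms(1) by (simp add: dilation_inv_def dist_norm)
  ultimately have "norm (x - y) \<le> t * R"
    using assms(1) by (simp add: pos_divide_le_eq mult.commute)
  then have "norm (bump_flux y a r t x) \<le> 1 / t ^ (DIM('a) + 1) * (t * R)"
    unfolding bump_flux_def norm_scaleR using assms bump_le_1[of a r] bump_nonneg[of a r]
    by (intro mult_mono) (auto simp: divide_right_mono)
  then show ?thesis using True assms(1) by simp
qed (use assms bump_kernel_zero(3) in auto)

text \<open>The flux has size of order \<open>t powr (- d)\<close> on a ball of volume of order
  \<open>t ^ d\<close>, so with \<open>q = conj_exp p\<close> its norm scales as
  \<open>t powr (- d + d / q) = t powr (- d / p)\<close>. The exponent exceeds \<open>- 1\<close>
  exactly when \<open>p > d\<close>.\<close>

lemma bump_flux_Lp: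
  fixes y :: "'a::euclidean_space"
  assumes "0 < t" "0 < r" "ball a r \<subseteq> cball y R" "0 \<le> R" "1 < p" "U \<in> sets lebesgue"
  shows "Lp_fun (lebesgue_on U) (conj_exp p) (bump_flux y a r t)"
    "(LINT x|lebesgue_on U. norm (bump_flux y a r t x) powr conj_exp p) powr (1 / conj_exp p)
      \<le> R * (unit_ball_vol (real DIM('a)) * r ^ DIM('a)) powr (1 / conj_exp p) * t powr (- real DIM('a) / p)"
proof -
  define q where "q = conj_exp p"
  define d where "d = real DIM('a)"
  note q = conj_exp_props[OF assms(5), folded q_def]
  define B where "B = ball (y + t *\<^sub>R (a - y)) (t * r)"
  define c where "c = (R / t ^ DIM('a)) powr q"
  have le: "norm (bump_flux y a r t x) powr q \<le> c * indicator B x" for x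
  proof -
    have "norm (bump_flux y a r t x) powr q \<le> (R / t ^ DIM('a) * indicator B x) powr q"
      unfolding B_def using q by (intro powr_mono2 bump_flux_le assms) auto
    also have "\<dots> = c * indicator B x" by (auto simp: indicator_def c_def)
    finally show ?thesis .
  qed
  have "continuous_on UNIV (bump_flux y a r t)"
    unfolding bump_flux_def[abs_def] dilation_inv_def using assms by (intro continuous_intros) auto
  then have [measurable]: "bump_flux y a r t \<in> borel_measurable (lebesgue_on U)"
    by (intro measurable_restrict_space1 measurable_completion) (simp add: borel_measurable_continuous_onI)
  have Bint: "integrable lebesgue (indicator B :: 'a \<Rightarrow> real)"
    using lmeasurable_ball[of "y + t *\<^sub>R (a - y)" "t * r"] unfolding B_def fmeasurable_def
    by (intro integrable_real_indicator) auto
  have intB: "integrable (lebesgue_on U) (\<lambda>x. c * indicator B x)"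
    using integrable_mult_indicator[OF assms(6) integrable_mult_right[OF Bint, of c]]
    unfolding lebesgue_on_integrable_iff[OF assms(6)] .
  have int: "integrable (lebesgue_on U) (\<lambda>x. norm (bump_flux y a r t x) powr q)"
    by (rule Bochner_Integration.integrable_bound[OF intB]) (auto intro: order_trans[OF le abs_ge_self])
  then show "Lp_fun (lebesgue_on U) (conj_exp p) (bump_flux y a r t)"
    by (simp add: Lp_fun_def q_def)
  have "(LINT x|lebesgue_on U. norm (bump_flux y a r t x) powr q) \<le> (LINT x|lebesgue_on U. c * indicator B x)"
    by (rule integral_mono[OF int intB le])
  also have "\<dots> \<le> (LINT x|lebesgue. c * indicator B x)"
    unfolding lebesgue_on_integral_eq[OF assms(6)]
  proof (rule integral_mono)
    show "integrable lebesgue (\<lambda>x. indicator U x *\<^sub>R (c * indicator B x))"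
      using intB unfolding lebesgue_on_integrable_iff[OF assms(6)] .
    show "integrable lebesgue (\<lambda>x. c * indicator B x)" using Bint by simp
    show "indicator U x *\<^sub>R (c * indicator B x) \<le> c * indicator B x" for x
      by (auto simp: indicator_def c_def)
  qed
  also have "\<dots> = c * measure lebesgue B"
    using Bint by simp
  also have "\<dots> = c * (unit_ball_vol d * (t * r) ^ DIM('a))"
    unfolding B_def d_def using assms by (simp add: content_ball)
  finally have "(LINT x|lebesgue_on U. norm (bump_flux y a r t x) powr q) powr (1/q)
      \<le> (c * (unit_ball_vol d * (t * r) ^ DIM('a))) powr (1/q)"
    using q by (intro powr_mono2) auto
  also have "\<dots> = R * (unit_ball_vol d * r ^ DIM('a)) powr (1/q) * (t powr (- d) * t powr (d / q))"
  proof -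
    have "c powr (1/q) = R * t powr (- d)"
      using assms q by (simp add: c_def powr_powr d_def powr_minus powr_realpow divide_inverse)
    moreover have "(t ^ DIM('a)) powr (1/q) = t powr (d / q)"
      using assms by (simp add: powr_realpow[symmetric] powr_powr d_def)
    ultimately show ?thesis
      using assms by (simp add: powr_mult power_mult_distrib unit_ball_vol_nonneg d_def mult_ac)
  qed
  also have "t powr (- d) * t powr (d / q) = t powr (- d / p)"
  proof -
    have "- d + d / q = - d * (1 - 1/q)" by (simp add: right_diff_distrib)
    also have "1 - 1/q = 1/p" using q(2) by linarith
    finally show ?thesis by (simp add: powr_add[symmetric])
  qed
  finally show "(LINT x|lebesgue_on U. norm (bump_flux y a r t x) powr conj_exp p) powr (1 / conj_exp p)
      \<le> R * (unit_ball_vol (real DIM('a)) * r ^ DIM('a)) powr (1 / conj_exp p) * t powr (- real DIM('a) / p)"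
    by (simp add: q_def d_def)
qed

text \<open>A bridge between two integrals: differentiation under the integral sign takes place for
  the gauge integral over a box, everything about weak gradients for the Lebesgue integral.\<close>

lemma integral_cbox_eq_lborel:
  fixes f :: "'a::euclidean_space \<Rightarrow> real"
  assumes "continuous_on UNIV f" "\<And>x. x \<notin> cbox c d \<Longrightarrow> f x = 0"
  shows "integral (cbox c d) f = (LINT x|lborel. f x)"
proof -
  have "set_integrable lborel (cbox c d) f"
    unfolding set_integrable_def using assms(1)
    by (intro borel_integrable_compact) (auto intro: continuous_on_subset)
  then have "integral (cbox c d) f = (LINT x:cbox c d|lborel. f x)"
    by (rule set_borel_integral_eq_integral(2)[symmetric])
  also have "\<dots> = (LINT x|lborel. f x)"
    unfolding set_lebesgue_integral_def
    by (intro Bochner_Integration.integral_cong) (use assms(2) in \<open>auto simp: indicator_def\<close>)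
  finally show ?thesis .
qed

lemma lborel_integral_dilation:
  fixes f :: "'a::euclidean_space \<Rightarrow> real"
  assumes "f \<in> borel_measurable borel" "0 < t"
  shows "(LINT x|lborel. f x) = t ^ DIM('a) * (LINT z|lborel. f (y + t *\<^sub>R (z - y)))"
proof -
  define c where "c = y - t *\<^sub>R y"
  have "(LINT x|lborel. f x) = (LINT x|density (distr lborel borel (\<lambda>x. c + t *\<^sub>R x)) (\<lambda>_. ennreal (\<bar>t\<bar> ^ DIM('a))). f x)"
    using lborel_affine[of t c] assms(2) by simp
  also have "\<dots> = (LINT x|distr lborel borel (\<lambda>x. c + t *\<^sub>R x). t ^ DIM('a) * f x)"
    using assms by (subst integral_real_density) auto
  also have "\<dots> = (LINT z|lborel. t ^ DIM('a) * f (c + t *\<^sub>R z))"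
    using assms by (subst integral_distr) auto
  also have "\<dots> = t ^ DIM('a) * (LINT z|lborel. f (c + t *\<^sub>R z))"
    by (rule integral_mult_right_zero)
  finally show ?thesis by (simp add: c_def algebra_simps)
qed

lemma dilated_ball_subset:
  fixes y :: "'a::euclidean_space"
  assumes "0 < t" "t \<le> 1" "ball a r \<subseteq> cball y R"
  shows "ball (y + t *\<^sub>R (a - y)) (t * r) \<subseteq> cball y R"
proof
  fix x assume "x \<in> ball (y + t *\<^sub>R (a - y)) (t * r)"
  then have "dilation_inv y t x \<in> cball y R"
    using assms dilation_inv_in_ball by blast
  moreover have "dist y (dilation_inv y t x) = norm (x - y) / t"
    using assms(1) by (simp add: dilation_inv_def dist_norm)
  ultimately have "norm (x - y) \<le> t * R"
    using assms(1) by (simp add: pos_divide_le_eq mult.commute)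
  also have "\<dots> \<le> R"
    using \<open>norm (x - y) \<le> t * R\<close> assms norm_ge_zero[of "x - y"]
    by (smt (verit) mult_left_le_one_le zero_le_mult_iff)
  finally show "x \<in> cball y R" by (simp add: dist_norm norm_minus_commute)
qed

lemma continuous_on_bump_kernel:
  fixes y a :: "'a::euclidean_space"
  assumes "continuous_on A f" "continuous_on A h" "\<And>z. z \<in> A \<Longrightarrow> 0 < f z"
  shows "continuous_on A (\<lambda>z. bump_kernel y a r (f z) (h z))"
    and "continuous_on A (\<lambda>z. bump_kernel_deriv y a r (f z) (h z))"
  unfolding bump_kernel_def bump_kernel_deriv_def dilation_inv_def
  by (intro continuous_intros assms; use assms(3) in fastforce)+

section \<open>Contracting bump averages to a point\<close>

definition grad_norm :: "'a::euclidean_space set \<Rightarrow> real \<Rightarrow> ('a \<Rightarrow> real) \<Rightarrow> real" where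
  "grad_norm U p v = (LINT x|lebesgue_on U. norm (weak_grad U v x) powr p) powr (1 / p)"

lemma borel_measurable_bump [measurable]: "bump a r \<in> borel_measurable borel"
  by (intro borel_measurable_continuous_onI continuous_intros)

lemma integrable_bump:
  assumes "0 < r"
  shows "integrable lborel (bump a r)"
proof (rule Bochner_Integration.integrable_bound)
  show "integrable lborel (indicator (ball a r) :: 'a \<Rightarrow> real)"
    by (intro integrable_real_indicator emeasure_bounded_finite) auto
  show "AE x in lborel. norm (bump a r x) \<le> norm (indicator (ball a r) x :: real)"
    by (intro always_eventually allI) (auto simp: indicator_def bump_eq_0[OF assms] bump_le_1 bump_nonneg)
qed measurable

text \<open>The dilation cancels the singular factor \<open>t ^ d\<close> and leaves
  \<open>g (y + t *\<^sub>R (z - y))\<close> against a fixed bump. Continuity of \<open>g\<close> at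
  \<open>y\<close> gives the limit, boundedness of \<open>g\<close> on \<open>cball y R\<close> the
  majorant.\<close>

lemma integral_bump_kernel_tendsto:
  fixes y :: "'a::euclidean_space"
  assumes g: "continuous_on UNIV g" and r: "0 < r" and R: "ball a r \<subseteq> cball y R"
  shows "(\<lambda>n. LINT x|lborel. g x * bump_kernel y a r (1 / real (Suc n)) x) \<longlonglongrightarrow> g y * (LINT x|lborel. bump a r x)"
proof -
  define t where "t n = 1 / real (Suc n)" for n
  have t: "0 < t n" "t n \<le> 1" for n by (auto simp: t_def)
  have [measurable]: "g \<in> borel_measurable borel" using g by (rule borel_measurable_continuous_onI)
  have eq: "(LINT x|lborel. g x * bump_kernel y a r (t n) x) = (LINT z|lborel. g (y + t n *\<^sub>R (z - y)) * bump a r z)" for n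
  proof -
    have m: "(\<lambda>x. g x * bump_kernel y a r (t n) x) \<in> borel_measurable borel"
      using t(1)[of n] by (intro borel_measurable_continuous_onI continuous_intros continuous_on_bump_kernel g) auto
    have "(LINT x|lborel. g x * bump_kernel y a r (t n) x)
        = t n ^ DIM('a) * (LINT z|lborel. g (y + t n *\<^sub>R (z - y)) * (bump a r z / t n ^ DIM('a)))"
      using lborel_integral_dilation[OF m t(1)[of n], of y] t(1)[of n]
      by (simp add: bump_kernel_def dilation_inv_dilation)
    then show ?thesis using t(1)[of n] by simp
  qed
  have "compact (g ` cball y R)" using g by (intro compact_continuous_image) (auto intro: continuous_on_subset)
  then have "bounded (g ` cball y R)" by (rule compact_imp_bounded)
  then obtain B where B: "0 < B" "\<forall>z\<in>g ` cball y R. norm z \<le> B" unfolding bounded_pos by blast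
  have "(\<lambda>n. LINT z|lborel. g (y + t n *\<^sub>R (z - y)) * bump a r z) \<longlonglongrightarrow> (LINT z|lborel. g y * bump a r z)"
  proof (rule integral_dominated_convergence[where w = "\<lambda>z. B * bump a r z"])
    show "integrable lborel (\<lambda>z. B * bump a r z)" using integrable_bump[OF r, of a] by simp
    show "AE z in lborel. (\<lambda>n. g (y + t n *\<^sub>R (z - y)) * bump a r z) \<longlonglongrightarrow> g y * bump a r z"
    proof (intro always_eventually allI)
      fix z
      have "t \<longlonglongrightarrow> 0" unfolding t_def by real_asymp
      then have "(\<lambda>n. y + t n *\<^sub>R (z - y)) \<longlonglongrightarrow> y + 0 *\<^sub>R (z - y)" by (intro tendsto_intros)
      moreover have "isCont g y" using g by (simp add: continuous_on_eq_continuous_at)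
      ultimately show "(\<lambda>n. g (y + t n *\<^sub>R (z - y)) * bump a r z) \<longlonglongrightarrow> g y * bump a r z"
        by (intro tendsto_mult tendsto_const isCont_tendsto_compose[of y g]) simp_all
    qed
    show "AE z in lborel. norm (g (y + t n *\<^sub>R (z - y)) * bump a r z) \<le> B * bump a r z" for n
    proof (intro always_eventually allI)
      fix z
      show "norm (g (y + t n *\<^sub>R (z - y)) * bump a r z) \<le> B * bump a r z"
      proof (cases "z \<in> ball a r")
        case True
        then have "norm (z - y) \<le> R" using R by (auto simp: dist_norm norm_minus_commute)
        moreover have "t n * norm (z - y) \<le> norm (z - y)" using t[of n] by (simp add: mult_left_le_one_le)
        ultimately have "y + t n *\<^sub>R (z - y) \<in> cball y R" using t(1)[of n] by (simp add: dist_norm)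
        then have "norm (g (y + t n *\<^sub>R (z - y))) \<le> B" using B by blast
        then show ?thesis using bump_nonneg[of a r z] by (simp add: abs_mult mult_right_mono)
      qed (simp add: bump_eq_0[OF r])
    qed
  qed measurable
  then show ?thesis unfolding t_def[symmetric] eq by simp
qed

lemma integral_bump_pos:
  assumes "0 < r"
  shows "0 < (LINT x|lborel. bump a r x)"
proof -
  have "(LINT x|lborel. bump a r x) \<noteq> 0"
  proof
    assume "(LINT x|lborel. bump a r x) = 0"
    then have "AE x in lborel. bump a r x = 0"
      using integrable_bump[OF assms, of a] by (subst (asm) integral_nonneg_eq_0_iff_AE) (auto simp: bump_nonneg)
    then have "AE x in lborel. x \<notin> ball a r"
      by eventually_elim (use bump_pos_iff[OF assms] in force)
    then have "emeasure lborel (ball a r) = 0"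
      by (subst (asm) AE_iff_null_sets[symmetric]) (auto simp: null_sets_def)
    moreover have "emeasure lborel (ball a r) > 0"
      using emeasure_lborel_cbox_eq by (simp add: emeasure_ball assms less_imp_le zero_less_power unit_ball_vol_pos)
    ultimately show False by simp
  qed
  moreover have "0 \<le> (LINT x|lborel. bump a r x)" by (simp add: bump_nonneg)
  ultimately show ?thesis by linarith
qed

text \<open>\<open>\<Phi> t\<close>, the integral of \<open>g\<close> against the kernel, joins the
  bump average at \<open>t = 1\<close> to \<open>g y\<close> times the mass of the bump as
  \<open>t\<close> tends to 0. Its derivative pairs the weak gradient with the flux and is at most
  \<open>N * K * t powr (- d / p)\<close> by Hoelder, whose integral over \<open>(0, 1]\<close> is
  \<open>N * K / (1 - d / p)\<close>. It is the contracted balls that lie in \<open>U\<close>, so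
  \<open>y\<close> may be a boundary point.\<close>

lemma morrey_star_shaped:
  fixes y :: "'a::euclidean_space"
  assumes U: "open U" and p: "real DIM('a) < p" and v: "v \<in> W1 U p"
    and g: "continuous_on UNIV g" and gv: "AE x in lebesgue_on U. g x = v x"
    and r: "0 < r" and R: "ball a r \<subseteq> cball y R" "0 \<le> R"
    and star: "\<And>t. 0 < t \<Longrightarrow> t \<le> 1 \<Longrightarrow> cball (y + t *\<^sub>R (a - y)) (t * r) \<subseteq> U"
  shows "\<bar>(LINT x|lborel. g x * bump a r x) - g y * (LINT x|lborel. bump a r x)\<bar>
    \<le> R * (unit_ball_vol (real DIM('a)) * r ^ DIM('a)) powr (1 / conj_exp p) / (1 - real DIM('a) / p) * grad_norm U p v"
proof -
  define K where "K = R * (unit_ball_vol (real DIM('a)) * r ^ DIM('a)) powr (1 / conj_exp p)"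
  define N where "N = grad_norm U p v"
  define \<theta> where "\<theta> = 1 - real DIM('a) / p"
  have "1 \<le> real DIM('a)" using DIM_positive[where 'a = 'a] by linarith
  then have p1: "1 < p" using p by linarith
  have \<theta>: "0 < \<theta>" using p p1 by (simp add: \<theta>_def)
  have KN: "0 \<le> K" "0 \<le> N" using R by (auto simp: K_def N_def grad_norm_def)
  have Uleb: "U \<in> sets lebesgue" using U by auto
  note G = weak_grad_W1[OF U v]
  have "bounded (cball y R)" by simp
  \<comment> \<open>One box contains the supports for all \<open>t <= 1\<close>, so
    \<open>\<Phi>\<close> is an integral over a domain independent of \<open>t\<close>.\<close>
  then obtain b where b: "cball y R \<subseteq> cbox (- b) b" by (rule bounded_subset_cbox_symmetric)
  have out: "x \<notin> ball (y + t *\<^sub>R (a - y)) (t * r)" if "x \<notin> cbox (- b) b" "0 < t" "t \<le> 1" for x t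
    using that b dilated_ball_subset[OF that(2,3) R(1)] by blast
  define \<Phi> where "\<Phi> t = integral (cbox (- b) b) (\<lambda>x. g x * bump_kernel y a r t x)" for t
  have \<Phi>_eq: "\<Phi> t = (LINT x|lborel. g x * bump_kernel y a r t x)" if "0 < t" "t \<le> 1" for t
    unfolding \<Phi>_def using that bump_kernel_zero(1)[OF r that(1) out[OF _ that]]
    by (intro integral_cbox_eq_lborel continuous_intros g continuous_on_bump_kernel) auto
  have der: "(\<Phi> has_real_derivative integral (cbox (- b) b) (\<lambda>x. g x * bump_kernel_deriv y a r t x)) (at t)"
    if t: "0 < t" for t
  proof -
    have gc: "continuous_on A (\<lambda>z. g (h z))" if "continuous_on A h" for A :: "'c::topological_space set" and h
      by (rule continuous_on_compose2[OF g that]) auto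
    have "(\<Phi> has_real_derivative integral (cbox (- b) b) (\<lambda>x. g x * bump_kernel_deriv y a r t x)) (at t within {0<..})"
      unfolding \<Phi>_def[abs_def]
    proof (rule leibniz_rule_field_derivative)
      fix s :: real and x assume "s \<in> {0<..}"
      then show "((\<lambda>s. g x * bump_kernel y a r s x) has_real_derivative g x * bump_kernel_deriv y a r s x) (at s within {0<..})"
        by (intro DERIV_cmult has_field_derivative_at_within[OF bump_kernel_has_derivative]) auto
      show "(\<lambda>x. g x * bump_kernel y a r s x) integrable_on cbox (- b) b"
        using \<open>s \<in> {0<..}\<close> by (intro integrable_continuous continuous_intros gc continuous_on_bump_kernel) auto
    next
      show "continuous_on ({0<..} \<times> cbox (- b) b) (\<lambda>(s, x). g x * bump_kernel_deriv y a r s x)"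
        unfolding split_beta
        by (intro continuous_intros gc continuous_on_bump_kernel) auto
    qed (use t in auto)
    then show ?thesis using t by (simp add: at_within_open[of t "{0<..}"])
  qed
  have der_eq: "integral (cbox (- b) b) (\<lambda>x. g x * bump_kernel_deriv y a r t x)
      = (LINT x|lebesgue_on U. weak_grad U v x \<bullet> bump_flux y a r t x)" if t: "0 < t" "t \<le> 1" for t
  proof -
    have cont: "continuous_on UNIV (\<lambda>x. g x * bump_kernel_deriv y a r t x)" "continuous_on UNIV (bump_kernel_deriv y a r t)"
      using t by (auto intro!: continuous_intros g continuous_on_bump_kernel)
    have m: "(\<lambda>x. g x * bump_kernel_deriv y a r t x) \<in> borel_measurable borel" "bump_kernel_deriv y a r t \<in> borel_measurable borel"
      by (intro borel_measurable_continuous_onI cont)+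
    have zero: "bump_kernel_deriv y a r t x = 0" if "x \<notin> U" for x
      using star[OF t] that ball_subset_cball by (intro bump_kernel_zero r t) blast
    have "integral (cbox (- b) b) (\<lambda>x. g x * bump_kernel_deriv y a r t x) = (LINT x|lborel. g x * bump_kernel_deriv y a r t x)"
      using bump_kernel_zero(2)[OF r t(1) out[OF _ t]] by (intro integral_cbox_eq_lborel cont) auto
    also have "\<dots> = (LINT x|lebesgue. g x * bump_kernel_deriv y a r t x)"
      using m by (subst integral_completion) auto
    also have "\<dots> = (LINT x|lebesgue_on U. g x * bump_kernel_deriv y a r t x)"
      unfolding lebesgue_on_integral_eq[OF Uleb]
      by (intro Bochner_Integration.integral_cong) (use zero in \<open>auto simp: indicator_def\<close>)
    also have "\<dots> = (LINT x|lebesgue_on U. v x * bump_kernel_deriv y a r t x)"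
    proof (rule integral_cong_AE)
      have "bump_kernel_deriv y a r t \<in> borel_measurable (lebesgue_on U)"
        using m by (intro measurable_restrict_space1 measurable_completion) simp
      moreover have "v \<in> borel_measurable (lebesgue_on U)" using v by (simp add: W1_def Lp_space_def)
      ultimately show "(\<lambda>x. v x * bump_kernel_deriv y a r t x) \<in> borel_measurable (lebesgue_on U)" by measurable
      show "(\<lambda>x. g x * bump_kernel_deriv y a r t x) \<in> borel_measurable (lebesgue_on U)"
        using m by (intro measurable_restrict_space1 measurable_completion) simp
      show "AE x in lebesgue_on U. g x * bump_kernel_deriv y a r t x = v x * bump_kernel_deriv y a r t x"
        using gv by eventually_elim simp
    qed
    also have "\<dots> = (LINT x|lebesgue_on U. weak_grad U v x \<bullet> bump_flux y a r t x)"
      by (rule weak_gradient_bump_flux[OF U G(1) t(1) r star[OF t]])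
    finally show ?thesis .
  qed
  have bound: "\<bar>integral (cbox (- b) b) (\<lambda>x. g x * bump_kernel_deriv y a r t x)\<bar> \<le> N * K * t powr (\<theta> - 1)"
    if t: "0 < t" "t \<le> 1" for t
  proof -
    note flux = bump_flux_Lp[OF t(1) r R p1 Uleb]
    have "\<bar>LINT x|lebesgue_on U. weak_grad U v x \<bullet> bump_flux y a r t x\<bar>
      \<le> N * (LINT x|lebesgue_on U. norm (bump_flux y a r t x) powr conj_exp p) powr (1 / conj_exp p)"
      unfolding N_def grad_norm_def by (rule Holder_inequality_inner[OF p1 G(2) flux(1)])
    also have "\<dots> \<le> N * (K * t powr (- real DIM('a) / p))"
      unfolding K_def by (rule mult_left_mono[OF flux(2) KN(2)])
    finally show ?thesis by (simp add: der_eq[OF t] \<theta>_def mult.assoc)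
  qed
  \<comment> \<open>A primitive of the derivative bound. That \<open>h - \<Phi>\<close> and
    \<open>h + \<Phi>\<close> are nondecreasing on \<open>[s, 1]\<close> does the work of
    integrating the bound.\<close>
  define h where "h t = N * K * (t powr \<theta> / \<theta>)" for t
  have h_der: "(h has_real_derivative N * K * t powr (\<theta> - 1)) (at t)" if "0 < t" for t
    unfolding h_def using that \<theta> by (auto intro!: derivative_eq_intros simp: powr_diff)
  have est: "\<bar>\<Phi> 1 - \<Phi> s\<bar> \<le> N * K / \<theta>" if s: "0 < s" "s \<le> 1" for s
  proof -
    have "h s - \<Phi> s \<le> h 1 - \<Phi> 1"
    proof (rule DERIV_nonneg_imp_nondecreasing[OF s(2), of "\<lambda>t. h t - \<Phi> t"])
      fix t assume t: "s \<le> t" "t \<le> 1"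
      show "\<exists>y. ((\<lambda>t. h t - \<Phi> t) has_real_derivative y) (at t) \<and> 0 \<le> y"
        using t s bound[of t] 
        by (intro exI[of _ "N * K * t powr (\<theta> - 1) - integral (cbox (- b) b) (\<lambda>x. g x * bump_kernel_deriv y a r t x)"]
              conjI DERIV_diff h_der der) auto
    qed
    moreover have "h s + \<Phi> s \<le> h 1 + \<Phi> 1"
    proof (rule DERIV_nonneg_imp_nondecreasing[OF s(2), of "\<lambda>t. h t + \<Phi> t"])
      fix t assume t: "s \<le> t" "t \<le> 1"
      show "\<exists>y. ((\<lambda>t. h t + \<Phi> t) has_real_derivative y) (at t) \<and> 0 \<le> y"
        using t s bound[of t] 
        by (intro exI[of _ "N * K * t powr (\<theta> - 1) + integral (cbox (- b) b) (\<lambda>x. g x * bump_kernel_deriv y a r t x)"]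
              conjI DERIV_add h_der der) auto
    qed
    moreover have "0 \<le> h s" using KN \<theta> by (simp add: h_def)
    moreover have "h 1 = N * K / \<theta>" by (simp add: h_def)
    ultimately show ?thesis by linarith
  qed
  have "(\<lambda>n. \<bar>\<Phi> 1 - \<Phi> (1 / real (Suc n))\<bar>) \<longlonglongrightarrow> \<bar>\<Phi> 1 - g y * (LINT x|lborel. bump a r x)\<bar>"
  proof (intro tendsto_intros)
    have "\<Phi> (1 / real (Suc n)) = (LINT x|lborel. g x * bump_kernel y a r (1 / real (Suc n)) x)" for n
      by (rule \<Phi>_eq) auto
    then show "(\<lambda>n. \<Phi> (1 / real (Suc n))) \<longlonglongrightarrow> g y * (LINT x|lborel. bump a r x)"
      using integral_bump_kernel_tendsto[OF g r R(1)] by simp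
  qed
  then have "\<bar>\<Phi> 1 - g y * (LINT x|lborel. bump a r x)\<bar> \<le> N * K / \<theta>"
    by (rule LIMSEQ_le_const2) (use est in auto)
  moreover have "\<Phi> 1 = (LINT x|lborel. g x * bump a r x)"
    by (simp add: \<Phi>_eq bump_kernel_def dilation_inv_def)
  ultimately show ?thesis by (simp add: N_def K_def \<theta>_def mult_ac)
qed

section \<open>Oscillation on a bounded Lipschitz domain\<close>

text \<open>The constant is uniform in \<open>v\<close>. Continuity of \<open>g\<close> on the whole
  space gives it values on the boundary of \<open>U\<close> and is the form that Morrey's estimate
  takes as input.\<close>

definition osc_le :: "'a::euclidean_space set \<Rightarrow> real \<Rightarrow> 'a set \<Rightarrow> real \<Rightarrow> bool" where
  "osc_le U p A C \<longleftrightarrow> (\<forall>v\<in>W1 U p. \<forall>g. continuous_on UNIV g \<and> (AE x in lebesgue_on U. g x = v x) \<longrightarrow>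
     (\<forall>x\<in>A. \<forall>y\<in>A. \<bar>g x - g y\<bar> \<le> C * grad_norm U p v))"

lemma grad_norm_nonneg: "0 \<le> grad_norm U p v"
  by (simp add: grad_norm_def)

lemma osc_leD:
  "osc_le U p A C \<Longrightarrow> v \<in> W1 U p \<Longrightarrow> continuous_on UNIV g \<Longrightarrow> AE x in lebesgue_on U. g x = v x
    \<Longrightarrow> x \<in> A \<Longrightarrow> y \<in> A \<Longrightarrow> \<bar>g x - g y\<bar> \<le> C * grad_norm U p v"
  unfolding osc_le_def by blast

lemma osc_le_mono: "osc_le U p A C \<Longrightarrow> B \<subseteq> A \<Longrightarrow> C \<le> D \<Longrightarrow> osc_le U p B D"
  unfolding osc_le_def by (meson grad_norm_nonneg mult_right_mono order_trans subsetD)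

text \<open>The absolute values are there because a constant in \<open>osc_le\<close> carries no
  sign, while the bound for two different points adds up and the bound for equal points must be
  nonnegative.\<close>

lemma osc_le_trans:
  assumes "osc_le U p {x, y} C" "osc_le U p {y, z} D"
  shows "osc_le U p {x, z} (\<bar>C\<bar> + \<bar>D\<bar>)"
  unfolding osc_le_def
proof (intro ballI allI impI)
  fix v g a b
  assume v: "v \<in> W1 U p" and g: "continuous_on UNIV g \<and> (AE x in lebesgue_on U. g x = v x)"
    and ab: "a \<in> {x, z}" "b \<in> {x, z}"
  have "osc_le U p {x, y} \<bar>C\<bar>" "osc_le U p {y, z} \<bar>D\<bar>"
    by (rule osc_le_mono[OF assms(1) subset_refl abs_ge_self] osc_le_mono[OF assms(2) subset_refl abs_ge_self])+
  then have "\<bar>g x - g y\<bar> \<le> \<bar>C\<bar> * grad_norm U p v" "\<bar>g y - g z\<bar> \<le> \<bar>D\<bar> * grad_norm U p v"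
    using v g osc_leD[of U p _ _ v g] by blast+
  moreover have "0 \<le> (\<bar>C\<bar> + \<bar>D\<bar>) * grad_norm U p v" by (simp add: grad_norm_nonneg)
  ultimately show "\<bar>g a - g b\<bar> \<le> (\<bar>C\<bar> + \<bar>D\<bar>) * grad_norm U p v"
    using ab by (auto simp: distrib_right)
qed

text \<open>All points of \<open>A\<close> see the same ball around \<open>a\<close>, so one bump
  average \<open>m\<close> is compared with every \<open>g z * I\<close>. Passing from one point to
  another through \<open>m\<close> costs the factor 2.\<close>

lemma osc_le_star_shaped:
  fixes a :: "'a::euclidean_space"
  assumes U: "open U" and p: "real DIM('a) < p" and r: "0 < r" and A: "bounded A"
    and star: "\<And>y t. y \<in> A \<Longrightarrow> 0 < t \<Longrightarrow> t \<le> 1 \<Longrightarrow> cball (y + t *\<^sub>R (a - y)) (t * r) \<subseteq> U"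
  shows "\<exists>C. osc_le U p A C"
proof -
  have "bounded ((\<lambda>y. y - a) ` A)" using A by (rule bounded_translation_minus)
  then obtain R0 where R0: "0 < R0" "\<And>y. y \<in> A \<Longrightarrow> norm (y - a) \<le> R0"
    unfolding bounded_pos by blast
  define R where "R = R0 + r"
  define I where "I = (LINT x|lborel. bump a r x)"
  have I: "0 < I" unfolding I_def by (rule integral_bump_pos[OF r])
  define K where "K = R * (unit_ball_vol (real DIM('a)) * r ^ DIM('a)) powr (1 / conj_exp p) / (1 - real DIM('a) / p)"
  have "osc_le U p A (2 * K / I)"
    unfolding osc_le_def
  proof (intro ballI allI impI)
    fix v g x y
    assume v: "v \<in> W1 U p" and g: "continuous_on UNIV g \<and> (AE x in lebesgue_on U. g x = v x)"
      and xy: "x \<in> A" "y \<in> A"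
    define m where "m = (LINT x|lborel. g x * bump a r x)"
    have "\<bar>m - g z * I\<bar> \<le> K * grad_norm U p v" if z: "z \<in> A" for z
    proof -
      have "ball a r \<subseteq> cball z R"
      proof
        fix w assume "w \<in> ball a r"
        then have "dist z w \<le> norm (z - a) + r"
          using dist_triangle[of z w a] by (simp add: dist_norm)
        then show "w \<in> cball z R" using R0(2)[OF z] by (simp add: R_def)
      qed
      then show ?thesis
        unfolding m_def I_def K_def using g R0 r by (intro morrey_star_shaped U p v star z) (auto simp: R_def)
    qed
    from this[OF xy(1)] this[OF xy(2)] have "\<bar>g x * I - g y * I\<bar> \<le> 2 * (K * grad_norm U p v)" by linarith
    moreover have "\<bar>g x * I - g y * I\<bar> = \<bar>g x - g y\<bar> * I"
      using I by (simp add: abs_mult flip: left_diff_distrib)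
    ultimately show "\<bar>g x - g y\<bar> \<le> 2 * K / I * grad_norm U p v"
      using I by (simp add: field_simps)
  qed
  then show ?thesis by blast
qed

lemma cball_dilation_subset:
  fixes y :: "'a::euclidean_space"
  assumes "0 < t" "\<And>z. z \<in> cball a r \<Longrightarrow> y + t *\<^sub>R (z - y) \<in> U"
  shows "cball (y + t *\<^sub>R (a - y)) (t * r) \<subseteq> U"
proof
  fix w assume "w \<in> cball (y + t *\<^sub>R (a - y)) (t * r)"
  then have "dilation_inv y t w \<in> cball a r"
    using assms(1) by (simp add: dist_dilation_inv field_simps)
  then have "y + t *\<^sub>R (dilation_inv y t w - y) \<in> U" by (rule assms(2))
  then show "w \<in> U" using assms(1) by (simp add: dilation_inv_def)
qed

text \<open>A ball inside \<open>U\<close> is convex, so contracting a smaller concentric ball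
  towards any of its points stays in it.\<close>

lemma interior_star_shaped:
  fixes x :: "'a::euclidean_space"
  assumes "open U" "x \<in> U"
  shows "\<exists>N a r. open N \<and> x \<in> N \<and> 0 < r \<and>
    (\<forall>y\<in>N. \<forall>t. 0 < t \<and> t \<le> 1 \<longrightarrow> cball (y + t *\<^sub>R (a - y)) (t * r) \<subseteq> U)"
proof -
  obtain e where e: "0 < e" "ball x e \<subseteq> U" using assms openE by blast
  show ?thesis
  proof (intro exI[of _ "ball x e"] exI[of _ x] exI[of _ "e / 2"] conjI ballI allI impI)
    fix y and t :: real assume y: "y \<in> ball x e" and t: "0 < t \<and> t \<le> 1"
    show "cball (y + t *\<^sub>R (x - y)) (t * (e / 2)) \<subseteq> U"
    proof (rule cball_dilation_subset)
      fix z assume "z \<in> cball x (e / 2)"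
      then have z: "z \<in> ball x e" using e by simp
      have "y + t *\<^sub>R (z - y) = (1 - t) *\<^sub>R y + t *\<^sub>R z" by (simp add: algebra_simps)
      also have "\<dots> \<in> ball x e"
        using convex_ball[of x e] y z t by (intro convexD) auto
      finally show "y + t *\<^sub>R (z - y) \<in> U" using e by blast
    qed (use t in simp)
  qed (use e in auto)
qed

text \<open>Cone condition: near a boundary point, all segments pointing into a small ball around
  \<open>x + s *\<^sub>R e\<close>, with \<open>e\<close> the graph direction, stay strictly above the Lipschitz graph.\<close>

lemma boundary_star_shaped:
  fixes x :: "'a::euclidean_space"
  assumes r0: "0 < r0" and e: "norm e = 1" and lip: "L-lipschitz_on {z. z \<bullet> e = 0} \<gamma>"
    and graph: "U \<inter> ball x r0 = {y \<in> ball x r0. (\<gamma> (y - (y \<bullet> e) *\<^sub>R e) :: real) < y \<bullet> e}"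
  shows "\<exists>N a r. open N \<and> x \<in> N \<and> 0 < r \<and>
    (\<forall>y\<in>N \<inter> closure U. \<forall>t. 0 < t \<and> t \<le> 1 \<longrightarrow> cball (y + t *\<^sub>R (a - y)) (t * r) \<subseteq> U)"
proof -
  define P where "P y = y - (y \<bullet> e) *\<^sub>R e" for y :: 'a
  have ee: "e \<bullet> e = 1" using e by (simp add: norm_eq_1)
  have P0: "P y \<bullet> e = 0" for y by (simp add: P_def inner_diff_left ee)
  have P_norm: "norm (P u) \<le> norm u" for u
  proof -
    have "P u \<bullet> P u = u \<bullet> u - (u \<bullet> e)\<^sup>2"
      by (simp add: P_def inner_diff_left inner_diff_right ee power2_eq_square inner_commute)
    then have "(norm (P u))\<^sup>2 \<le> (norm u)\<^sup>2" by (simp add: power2_norm_eq_inner)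
    then show ?thesis by (simp add: power2_le_iff_abs_le)
  qed
  have P_lin: "P (y + t *\<^sub>R (s *\<^sub>R e + u)) = P y + t *\<^sub>R P u" for y t s u
    by (simp add: P_def inner_add_left ee algebra_simps)
  have L0: "0 \<le> L" using lip by (rule lipschitz_on_nonneg)
  have lipP: "\<gamma> (P y') \<le> \<gamma> (P y) + L * norm (P y' - P y)" for y y'
    using lipschitz_onD[OF lip, of "P y'" "P y"] P0 by (simp add: dist_norm)
  have cont: "continuous_on UNIV (\<lambda>y. \<gamma> (P y))"
  proof (rule continuous_on_compose2[OF lipschitz_on_continuous_on[OF lip]])
    show "continuous_on UNIV P" unfolding P_def[abs_def] by (intro continuous_intros)
  qed (auto simp: P0)
  \<comment> \<open>Chosen to give \<open>L * \<delta> < 1 - \<delta>\<close>: a step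
    \<open>s *\<^sub>R e + u\<close> with \<open>norm u <= s * \<delta>\<close> rises by at least
    \<open>s * (1 - \<delta>)\<close>, the graph below it by at most
    \<open>s * L * \<delta>\<close>. The scale \<open>s = r0 / 4\<close> keeps the segments in
    \<open>ball x r0\<close>. The radius \<open>r\<close> is half of \<open>s * \<delta>\<close>
    because the start \<open>y\<close> and the target \<open>z\<close> may each be off by
    \<open>r\<close>.\<close>
  define \<delta> where "\<delta> = 1 / (2 + L)"
  define s where "s = r0 / 4"
  define r where "r = s * \<delta> / 2"
  have \<delta>: "0 < \<delta>" "\<delta> \<le> 1 / 2" "L * \<delta> < 1 - \<delta>" using L0 by (auto simp: \<delta>_def field_simps)
  have s: "0 < s" using r0 by (simp add: s_def)
  have r: "0 < r" using s \<delta> by (simp add: r_def)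
  have sd: "s * \<delta> \<le> s / 2" using s \<delta>(2) by (simp add: mult_left_mono[of \<delta> "1/2" s, simplified])
  show ?thesis
  proof (intro exI[of _ "ball x r"] exI[of _ "x + s *\<^sub>R e"] exI[of _ r] conjI ballI allI impI)
    fix y and t :: real assume y: "y \<in> ball x r \<inter> closure U" and t: "0 < t \<and> t \<le> 1"
    have yx: "norm (y - x) < r" using y by (simp add: dist_norm norm_minus_commute)
    \<comment> \<open>On the closure of \<open>U\<close> only the weak inequality survives.
      Strictness at \<open>w\<close> is regained from the slope gap along the cone, as
      \<open>t > 0\<close>.\<close>
    have above: "\<gamma> (P y) \<le> y \<bullet> e"
    proof -
      have "r < r0" using sd s by (simp add: r_def s_def)
      then have "y \<in> ball x r0 \<inter> closure U" using y by auto
      then have "y \<in> closure (ball x r0 \<inter> U)" using open_Int_closure_subset[OF open_ball] by blast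
      also have "closure (ball x r0 \<inter> U) \<subseteq> {y. \<gamma> (P y) \<le> y \<bullet> e}"
      proof (rule closure_minimal)
        show "ball x r0 \<inter> U \<subseteq> {y. \<gamma> (P y) \<le> y \<bullet> e}"
          unfolding Int_commute[of "ball x r0"] graph by (auto simp: P_def)
        show "closed {y. \<gamma> (P y) \<le> y \<bullet> e}"
          by (intro closed_Collect_le cont continuous_intros)
      qed
      finally show ?thesis by simp
    qed
    show "cball (y + t *\<^sub>R (x + s *\<^sub>R e - y)) (t * r) \<subseteq> U"
    proof (rule cball_dilation_subset)
      fix z assume z: "z \<in> cball (x + s *\<^sub>R e) r"
      define u where "u = z - y - s *\<^sub>R e"
      have zy: "z - y = s *\<^sub>R e + u" by (simp add: u_def)
      have "norm u \<le> norm (z - (x + s *\<^sub>R e)) + norm (x - y)"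
        unfolding u_def by (rule order_trans[OF _ norm_triangle_ineq]) (simp add: algebra_simps)
      also have "\<dots> \<le> 2 * r" using z yx by (simp add: dist_norm norm_minus_commute)
      finally have u: "norm u \<le> s * \<delta>" by (simp add: r_def)
      define w where "w = y + t *\<^sub>R (z - y)"
      have "norm (z - y) \<le> s + s * \<delta>"
        unfolding zy using u e s by (intro norm_triangle_le) simp
      moreover have "t * norm (z - y) \<le> norm (z - y)" using t by (simp add: mult_left_le_one_le)
      ultimately have "norm (w - y) \<le> s + s * \<delta>" using t by (simp add: w_def)
      moreover have "norm (w - x) \<le> norm (w - y) + norm (y - x)"
        using norm_triangle_ineq[of "w - y" "y - x"] by simp
      moreover have "2 * r = s * \<delta>" "r0 = 4 * s" by (simp_all add: r_def s_def)
      ultimately have "norm (w - x) < r0"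
        using yx sd s by linarith
      then have w_ball: "w \<in> ball x r0" by (simp add: dist_norm norm_minus_commute)
      have "\<gamma> (P w) \<le> \<gamma> (P y) + L * norm (P w - P y)" by (rule lipP)
      also have "P w - P y = t *\<^sub>R P u" unfolding w_def zy P_lin by simp
      also have "L * norm (t *\<^sub>R P u) \<le> L * (t * (s * \<delta>))"
        using t L0 order_trans[OF P_norm u] by (intro mult_left_mono) auto
      also have "L * (t * (s * \<delta>)) = t * s * (L * \<delta>)" by simp
      also have "t * s * (L * \<delta>) < t * s * (1 - \<delta>)"
        using t s \<delta>(3) by (intro mult_strict_left_mono) auto
      also have "t * s * (1 - \<delta>) \<le> t * (s + u \<bullet> e)"
      proof -
        have "\<bar>u \<bullet> e\<bar> \<le> norm u" using Cauchy_Schwarz_ineq2[of u e] e by simp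
        then have "s * (1 - \<delta>) \<le> s + u \<bullet> e" using u by (simp add: right_diff_distrib)
        then show ?thesis using t by (simp add: mult.assoc mult_left_mono)
      qed
      finally have "\<gamma> (P w) < \<gamma> (P y) + t * (s + u \<bullet> e)" by simp
      also have "\<dots> \<le> w \<bullet> e"
        using above by (simp add: w_def zy inner_add_left ee)
      finally have "w \<in> U \<inter> ball x r0" using w_ball unfolding graph by (simp add: P_def)
      then show "y + t *\<^sub>R (z - y) \<in> U" by (simp add: w_def)
    qed (use t in simp)
  qed (use r in auto)
qed

text \<open>Every point of the closure has a neighbourhood that is seen from one ball, which bounds
  the oscillation locally. Connectedness links every point to a base point, and compactness makes
  the constants uniform.\<close>

lemma osc_le_bounded_lipschitz_domain:
  fixes U :: "'a::euclidean_space set"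
  assumes U: "bounded_lipschitz_domain U" and p: "real DIM('a) < p"
  shows "\<exists>C. osc_le U p (closure U) C"
proof -
  have op: "open U" and con: "connected U" and ne: "U \<noteq> {}" and bd: "bounded U"
    using U by (auto simp: bounded_lipschitz_domain_def)
  have "\<exists>N C. open N \<and> x \<in> N \<and> osc_le U p (N \<inter> closure U) C" if x: "x \<in> closure U" for x
  proof -
    have "\<exists>N a r. open N \<and> x \<in> N \<and> 0 < r \<and>
      (\<forall>y\<in>N \<inter> closure U. \<forall>t. 0 < t \<and> t \<le> 1 \<longrightarrow> cball (y + t *\<^sub>R (a - y)) (t * r) \<subseteq> U)"
    proof (cases "x \<in> U")
      case True
      then show ?thesis using interior_star_shaped[OF op True] by blast
    next
      case False
      then have "x \<in> frontier U" using x op by (simp add: frontier_def interior_open)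
      then obtain r0 e L \<gamma> where "0 < r0" "norm e = 1" "L-lipschitz_on {z. z \<bullet> e = 0} \<gamma>"
        "U \<inter> ball x r0 = {y \<in> ball x r0. (\<gamma> (y - (y \<bullet> e) *\<^sub>R e) :: real) < y \<bullet> e}"
        using U unfolding bounded_lipschitz_domain_def by blast
      then show ?thesis by (rule boundary_star_shaped)
    qed
    then obtain N a r where N: "open N" "x \<in> N" "0 < r"
      and star: "\<And>y t. y \<in> N \<inter> closure U \<Longrightarrow> 0 < t \<Longrightarrow> t \<le> 1 \<Longrightarrow> cball (y + t *\<^sub>R (a - y)) (t * r) \<subseteq> U"
      by blast
    have "bounded (N \<inter> closure U)" using bounded_closure[OF bd] by (rule bounded_subset) auto
    from osc_le_star_shaped[OF op p N(3) this star] show ?thesis using N by blast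
  qed
  then obtain N C where N: "\<And>x. x \<in> closure U \<Longrightarrow> open (N x)" "\<And>x. x \<in> closure U \<Longrightarrow> x \<in> N x"
    and C: "\<And>x. x \<in> closure U \<Longrightarrow> osc_le U p (N x \<inter> closure U) (C x)" by metis
  obtain x0 where x0: "x0 \<in> closure U" using ne closure_subset by blast
  \<comment> \<open>Being comparable with some constant is a locally trivial equivalence relation on
    the connected closure. The constant obtained still depends on the point.\<close>
  have "\<exists>D. osc_le U p {x, x0} D" if x: "x \<in> closure U" for x
  proof (rule connected_equivalence_relation[OF connected_imp_connected_closure[OF con] x x0])
    show "\<exists>D. osc_le U p {b, a} D" if "\<exists>D. osc_le U p {a, b} D" for a b
      using that by (simp add: insert_commute)
    show "\<exists>D. osc_le U p {a, c} D" if "\<exists>D. osc_le U p {a, b} D" "\<exists>D. osc_le U p {b, c} D" for a b c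
      using that osc_le_trans by blast
    fix a assume a: "a \<in> closure U"
    show "\<exists>T. openin (top_of_set (closure U)) T \<and> a \<in> T \<and> (\<forall>x\<in>T. \<exists>D. osc_le U p {a, x} D)"
    proof (intro exI[of _ "closure U \<inter> N a"] conjI ballI)
      show "openin (top_of_set (closure U)) (closure U \<inter> N a)" using N(1)[OF a] by (rule openin_open_Int)
      show "a \<in> closure U \<inter> N a" using a N(2) by blast
      fix x assume "x \<in> closure U \<inter> N a"
      then have "osc_le U p {a, x} (C a)" using a N(2) by (intro osc_le_mono[OF C[OF a]]) auto
      then show "\<exists>D. osc_le U p {a, x} D" by blast
    qed
  qed
  then obtain D where D: "\<And>x. x \<in> closure U \<Longrightarrow> osc_le U p {x, x0} (D x)" by metis
  have "compact (closure U)" using bd by (simp add: compact_closure)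
  then obtain F where F: "F \<subseteq> closure U" "finite F" "closure U \<subseteq> (\<Union>x\<in>F. N x)"
    using N by (elim compactE_image[of _ "closure U" N]) auto
  \<comment> \<open>For each of finitely many centres \<open>c\<close>, this covers the step from a
    nearby point to \<open>c\<close> by \<open>C c\<close> and the step from \<open>c\<close> to
    \<open>x0\<close> by \<open>D c\<close>.\<close>
  define M where "M = (\<Sum>x\<in>F. \<bar>C x\<bar> + \<bar>D x\<bar>)"
  have M: "\<bar>C x\<bar> + \<bar>D x\<bar> \<le> M" if "x \<in> F" for x
    unfolding M_def using that F(2) by (intro member_le_sum) auto
  have "osc_le U p (closure U) (2 * M)"
    unfolding osc_le_def
  proof (intro ballI allI impI)
    fix v g x y
    assume v: "v \<in> W1 U p" and g: "continuous_on UNIV g \<and> (AE x in lebesgue_on U. g x = v x)"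
      and xy: "x \<in> closure U" "y \<in> closure U"
    have le: "\<bar>g z - g x0\<bar> \<le> M * grad_norm U p v" if z: "z \<in> closure U" for z
    proof -
      obtain c where c: "c \<in> F" "z \<in> N c" using F z by blast
      then have cU: "c \<in> closure U" using F by blast
      have "\<bar>g z - g c\<bar> \<le> C c * grad_norm U p v"
        using osc_leD[OF C[OF cU] v] g c z N(2)[OF cU] cU by blast
      moreover have "\<bar>g c - g x0\<bar> \<le> D c * grad_norm U p v"
        using osc_leD[OF D[OF cU] v] g by blast
      moreover have "C c * grad_norm U p v + D c * grad_norm U p v \<le> M * grad_norm U p v"
        unfolding distrib_right[symmetric] using M[OF c(1)]
        by (intro mult_right_mono grad_norm_nonneg) linarith
      ultimately show ?thesis by linarith
    qed
    show "\<bar>g x - g y\<bar> \<le> 2 * M * grad_norm U p v"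
      using le[OF xy(1)] le[OF xy(2)] by linarith
  qed
  then show ?thesis by blast
qed

section \<open>The Beckmann problem\<close>

lemma W1_lincomb:
  assumes U: "open U" and p: "1 < p" and u: "u \<in> W1 U p" and v: "v \<in> W1 U p"
  shows "(\<lambda>x. s * u x + t * v x) \<in> W1 U p"
proof -
  obtain G H where "Lp_fun (lebesgue_on U) p G" "has_weak_gradient U u G"
    "Lp_fun (lebesgue_on U) p H" "has_weak_gradient U v H"
    using u v by (auto simp: W1_def Lp_space_iff)
  then have "Lp_fun (lebesgue_on U) p (\<lambda>x. s *\<^sub>R G x + t *\<^sub>R H x)"
    "has_weak_gradient U (\<lambda>x. s * u x + t * v x) (\<lambda>x. s *\<^sub>R G x + t *\<^sub>R H x)"
    using p by (auto intro!: Lp_fun_lincomb has_weak_gradient_lincomb[OF U])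
  moreover have "Lp_fun (lebesgue_on U) p (\<lambda>x. s * u x + t * v x)"
    using Lp_fun_lincomb[of "lebesgue_on U" p u v s t] u v p by (simp add: W1_def Lp_space_iff)
  ultimately show ?thesis by (auto simp: W1_def Lp_space_iff)
qed

lemma grad_norm_eq:
  assumes U: "open U" and v: "v \<in> W1 U p" and G: "has_weak_gradient U v G" "Lp_fun (lebesgue_on U) p G"
  shows "grad_norm U p v = (LINT x|lebesgue_on U. norm (G x) powr p) powr (1 / p)"
proof -
  have "(LINT x|lebesgue_on U. norm (weak_grad U v x) powr p) = (LINT x|lebesgue_on U. norm (G x) powr p)"
  proof (rule integral_cong_AE)
    show "AE x in lebesgue_on U. norm (weak_grad U v x) powr p = norm (G x) powr p"
      using has_weak_gradient_unique[OF U weak_grad_W1(1)[OF U v] G(1)] by eventually_elim simp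
    show "(\<lambda>x. norm (weak_grad U v x) powr p) \<in> borel_measurable (lebesgue_on U)"
      by (rule borel_measurable_integrable[OF Lp_fun_integrable[OF weak_grad_W1(2)[OF U v]]])
    show "(\<lambda>x. norm (G x) powr p) \<in> borel_measurable (lebesgue_on U)"
      by (rule borel_measurable_integrable[OF Lp_fun_integrable[OF G(2)]])
  qed
  then show ?thesis by (simp add: grad_norm_def)
qed

section \<open>Pairing with the measures and existence of an admissible field\<close>

lemma integrable_continuous_prob_on_compact:
  fixes g :: "'a::euclidean_space \<Rightarrow> real"
  assumes "prob_space \<mu>" "sets \<mu> = sets (restrict_space borel \<Omega>)" "compact \<Omega>" "continuous_on \<Omega> g"
  shows "integrable \<mu> g"
proof -
  interpret prob_space \<mu> by fact
  have sp: "space \<mu> = \<Omega>" using sets_eq_imp_space_eq[OF assms(2)] by (simp add: space_restrict_space)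
  have "bounded (g ` \<Omega>)" using assms by (intro compact_imp_bounded compact_continuous_image)
  then obtain B where "\<forall>z\<in>g ` \<Omega>. norm z \<le> B" unfolding bounded_pos by blast
  moreover have "g \<in> borel_measurable \<mu>"
    using borel_measurable_continuous_on_restrict[OF assms(4)] measurable_cong_sets[OF assms(2) refl] by blast
  ultimately show ?thesis by (intro integrable_const_bound[of _ B]) (auto simp: sp intro!: AE_I2)
qed

lemma prob_integral_diff_le:
  fixes g :: "'a::euclidean_space \<Rightarrow> real"
  assumes "prob_space \<mu>" "sets \<mu> = sets (restrict_space borel \<Omega>)" "compact \<Omega>" "continuous_on \<Omega> g"
    and "\<And>x. x \<in> \<Omega> \<Longrightarrow> \<bar>g x - c\<bar> \<le> K"
  shows "\<bar>(LINT x|\<mu>. g x) - c\<bar> \<le> K"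
proof -
  interpret prob_space \<mu> by fact
  have sp: "space \<mu> = \<Omega>" using sets_eq_imp_space_eq[OF assms(2)] by (simp add: space_restrict_space)
  note i = integrable_continuous_prob_on_compact[OF assms(1-4)]
  have "\<bar>LINT x|\<mu>. g x - c\<bar> \<le> (LINT x|\<mu>. \<bar>g x - c\<bar>)" by (rule integral_abs_bound)
  also have "\<dots> \<le> (LINT x|\<mu>. K)"
    using i assms(5) by (intro integral_mono) (auto simp: sp)
  finally show ?thesis using i by (simp add: prob_space)
qed

lemma lebesgue_on_subset_Lp_fun:
  fixes f :: "'a::euclidean_space \<Rightarrow> 'b::euclidean_space"
  assumes S: "S \<in> sets lebesgue" "T \<in> sets lebesgue" "S \<subseteq> T" and f: "Lp_fun (lebesgue_on T) p f"
  shows "Lp_fun (lebesgue_on S) p f"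
proof -
  have eq: "indicator S x *\<^sub>R h x = indicator S x *\<^sub>R (indicator T x *\<^sub>R h x)" for h :: "'a \<Rightarrow> 'c::real_vector" and x
    using S(3) by (auto simp: indicator_def)
  have "(\<lambda>x. indicator T x *\<^sub>R f x) \<in> borel_measurable lebesgue"
    using Lp_fun_measurable[OF f] unfolding lebesgue_on_measurable_iff[OF S(2)] .
  then have 1: "f \<in> borel_measurable (lebesgue_on S)"
    unfolding lebesgue_on_measurable_iff[OF S(1)] eq[of _ f]
    by (rule borel_measurable_scaleR[OF borel_measurable_indicator[OF S(1)]])
  have "integrable lebesgue (\<lambda>x. indicator T x *\<^sub>R (norm (f x) powr p))"
    using Lp_fun_integrable[OF f] unfolding lebesgue_on_integrable_iff[OF S(2)] .
  then have 2: "integrable (lebesgue_on S) (\<lambda>x. norm (f x) powr p)"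
    unfolding lebesgue_on_integrable_iff[OF S(1)] eq[of _ "\<lambda>x. norm (f x) powr p"]
    by (rule integrable_mult_indicator[OF S(1)])
  from 1 2 show ?thesis by (simp add: Lp_fun_def)
qed

lemma Lp_fun_extend_by_zero:
  fixes f :: "'a::euclidean_space \<Rightarrow> 'b::euclidean_space"
  assumes S: "S \<in> sets lebesgue" "T \<in> sets lebesgue" and f: "Lp_fun (lebesgue_on S) p f"
  shows "Lp_fun (lebesgue_on T) p (\<lambda>x. indicator S x *\<^sub>R f x)"
proof -
  have m: "(\<lambda>x. indicator S x *\<^sub>R f x) \<in> borel_measurable lebesgue"
    using Lp_fun_measurable[OF f] unfolding lebesgue_on_measurable_iff[OF S(1)] .
  have "integrable lebesgue (\<lambda>x. indicator S x *\<^sub>R (norm (f x) powr p))"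
    using Lp_fun_integrable[OF f] unfolding lebesgue_on_integrable_iff[OF S(1)] .
  then have "integrable lebesgue (\<lambda>x. norm (indicator S x *\<^sub>R f x) powr p)"
    by (rule Bochner_Integration.integrable_cong[THEN iffD1, rotated 2]) (auto simp: indicator_def)
  then have "integrable (lebesgue_on T) (\<lambda>x. norm (indicator S x *\<^sub>R f x) powr p)"
    unfolding lebesgue_on_integrable_iff[OF S(2)] by (rule integrable_mult_indicator[OF S(2)])
  then show ?thesis
    unfolding Lp_fun_def using m by (blast intro: measurable_restrict_space1)
qed

text \<open>Up to sign, an admissible field represents the functional that sends a gradient to the
  integral of its potential against the signed measure. Comparing both integrals with the value at
  one point \<open>z\<close> bounds their difference by twice the oscillation bound, hence by the
  gradient norm.\<close>

lemma beckmann_admissible_nonempty: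
  fixes \<Omega> :: "'a::euclidean_space set"
  assumes \<Omega>: "compact \<Omega>" "closure (interior \<Omega>) = \<Omega>" "bounded_lipschitz_domain (interior \<Omega>)"
    and \<alpha>: "1 < \<alpha>" "real DIM('a) < conj_exp \<alpha>"
    and \<mu>p: "prob_space \<mu>p" "sets \<mu>p = sets (restrict_space borel \<Omega>)"
    and \<mu>m: "prob_space \<mu>m" "sets \<mu>m = sets (restrict_space borel \<Omega>)"
  shows "beckmann_admissible \<Omega> \<alpha> \<mu>p \<mu>m \<noteq> {}"
proof -
  define U where "U = interior \<Omega>"
  define p where "p = conj_exp \<alpha>"
  have U: "open U" "U \<in> sets lebesgue" "U \<noteq> {}" "U \<subseteq> \<Omega>"
    using \<Omega>(3) interior_subset by (auto simp: U_def bounded_lipschitz_domain_def)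
  have \<Omega>leb: "\<Omega> \<in> sets lebesgue" using fmeasurableD[OF lmeasurable_compact[OF \<Omega>(1)]] .
  note q = conj_exp_props[OF \<alpha>(1), folded p_def]
  \<comment> \<open>A linear relation rather than a map on gradients; that the gradient determines
    the value follows from the bound verified below.\<close>
  define V where "V = {(G, l). \<exists>v g. v \<in> W1 U p \<and> has_weak_gradient U v G \<and> Lp_fun (lebesgue_on U) p G
     \<and> continuous_representative \<Omega> v g \<and> l = (LINT x|\<mu>p. g x) - (LINT x|\<mu>m. g x)}"
  obtain C where C: "osc_le U p \<Omega> C"
    using osc_le_bounded_lipschitz_domain[OF \<Omega>(3) \<alpha>(2)] \<Omega>(2) by (auto simp: U_def p_def)
  have "\<exists>q. Lp_fun (lebesgue_on U) (conj_exp p) q \<and> (\<forall>(G, l)\<in>V. (LINT x|lebesgue_on U. q x \<bullet> G x) = l)"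
  proof (rule bounded_functional_representation[OF q(1)])
    show "Lp_fun (lebesgue_on U) p G" if "(G, l) \<in> V" for G l using that by (auto simp: V_def)
  next
    fix G l H k and s t :: real
    assume "(G, l) \<in> V" "(H, k) \<in> V"
    then obtain u g v h where u: "u \<in> W1 U p" "has_weak_gradient U u G" "Lp_fun (lebesgue_on U) p G"
        "continuous_representative \<Omega> u g" "l = (LINT x|\<mu>p. g x) - (LINT x|\<mu>m. g x)"
      and v: "v \<in> W1 U p" "has_weak_gradient U v H" "Lp_fun (lebesgue_on U) p H"
        "continuous_representative \<Omega> v h" "k = (LINT x|\<mu>p. h x) - (LINT x|\<mu>m. h x)"
      unfolding V_def by auto
    have cont: "continuous_on \<Omega> g" "continuous_on \<Omega> h" using u v by (auto simp: continuous_representative_def)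
    show "(\<lambda>x. s *\<^sub>R G x + t *\<^sub>R H x, s * l + t * k) \<in> V"
      unfolding V_def mem_Collect_eq split
    proof (intro exI conjI)
      show "(\<lambda>x. s * u x + t * v x) \<in> W1 U p" by (rule W1_lincomb[OF U(1) q(1) u(1) v(1)])
      show "has_weak_gradient U (\<lambda>x. s * u x + t * v x) (\<lambda>x. s *\<^sub>R G x + t *\<^sub>R H x)"
        by (rule has_weak_gradient_lincomb[OF U(1) u(2) v(2)])
      show "Lp_fun (lebesgue_on U) p (\<lambda>x. s *\<^sub>R G x + t *\<^sub>R H x)"
        using q(1) by (intro Lp_fun_lincomb u v) auto
      have "AE x in lebesgue_on (interior \<Omega>). g x = u x" "AE x in lebesgue_on (interior \<Omega>). h x = v x"
        using u v by (auto simp: continuous_representative_def)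
      then have "AE x in lebesgue_on (interior \<Omega>). s * g x + t * h x = s * u x + t * v x"
        by eventually_elim simp
      then show "continuous_representative \<Omega> (\<lambda>x. s * u x + t * v x) (\<lambda>x. s * g x + t * h x)"
        using cont by (auto simp: continuous_representative_def intro!: continuous_intros)
      show "s * l + t * k = (LINT x|\<mu>p. s * g x + t * h x) - (LINT x|\<mu>m. s * g x + t * h x)"
        using integrable_continuous_prob_on_compact[OF \<mu>p \<Omega>(1)] integrable_continuous_prob_on_compact[OF \<mu>m \<Omega>(1)] cont
        unfolding u(5) v(5) by (simp add: algebra_simps)
    qed
  next
    fix G l assume "(G, l) \<in> V"
    then obtain v g where v: "v \<in> W1 U p" "has_weak_gradient U v G" "Lp_fun (lebesgue_on U) p G"
        "continuous_representative \<Omega> v g" "l = (LINT x|\<mu>p. g x) - (LINT x|\<mu>m. g x)"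
      unfolding V_def by auto
    have g: "continuous_on \<Omega> g" "AE x in lebesgue_on U. g x = v x"
      using v(4) unfolding continuous_representative_def U_def by blast+
    have "bounded (g ` \<Omega>)" using g \<Omega>(1) by (intro compact_imp_bounded compact_continuous_image)
    then obtain B where B: "0 < B" "\<And>x. x \<in> \<Omega> \<Longrightarrow> norm (g x) \<le> B" unfolding bounded_pos by blast
    have clo: "closedin (top_of_set UNIV) \<Omega>" using \<Omega>(1) by (simp add: compact_imp_closed)
    \<comment> \<open>\<open>osc_le\<close> speaks of functions continuous on the whole space, so
      \<open>g\<close> is extended from \<open>\<Omega>\<close>; the extension still equals
      \<open>v\<close> almost everywhere on \<open>U\<close>.\<close>
    obtain g' where g': "continuous_on UNIV g'" "\<And>x. x \<in> \<Omega> \<Longrightarrow> g' x = g x"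
        "\<And>x. x \<in> UNIV \<Longrightarrow> norm (g' x) \<le> B"
      by (rule Tietze[OF g(1) clo less_imp_le[OF B(1)] B(2)]) (assumption | (rule that; blast))+
    have "AE x in lebesgue_on U. x \<in> U" by (rule AE_I2) simp
    with g(2) have AE': "AE x in lebesgue_on U. g' x = v x"
      by eventually_elim (use g'(2) U(4) in auto)
    have osc: "\<bar>g x - g y\<bar> \<le> C * grad_norm U p v" if "x \<in> \<Omega>" "y \<in> \<Omega>" for x y
      using osc_leD[OF C v(1) g'(1) AE' that] g'(2) that by simp
    obtain z where z: "z \<in> \<Omega>" using U(3,4) by blast
    have "\<bar>(LINT x|\<mu>p. g x) - g z\<bar> \<le> C * grad_norm U p v"
      by (rule prob_integral_diff_le[OF \<mu>p \<Omega>(1) g(1) osc[OF _ z]])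
    moreover have "\<bar>(LINT x|\<mu>m. g x) - g z\<bar> \<le> C * grad_norm U p v"
      by (rule prob_integral_diff_le[OF \<mu>m \<Omega>(1) g(1) osc[OF _ z]])
    ultimately show "\<bar>l\<bar> \<le> 2 * C * (LINT x|lebesgue_on U. norm (G x) powr p) powr (1 / p)"
      unfolding v(5) grad_norm_eq[OF U(1) v(1-3), symmetric] by linarith
  qed
  then obtain q0 where q0': "Lp_fun (lebesgue_on U) \<alpha> q0 \<and> (\<forall>(G, l)\<in>V. (LINT x|lebesgue_on U. q0 x \<bullet> G x) = l)"
    unfolding q(3) by (rule exE)
  then have q0_Lp: "Lp_fun (lebesgue_on U) \<alpha> q0" by (rule conjunct1)
  have q0: "(LINT x|lebesgue_on U. q0 x \<bullet> G x) = l" if "(G, l) \<in> V" for G l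
    using bspec[OF conjunct2[OF q0'] that] by simp
  \<comment> \<open>The sign undoes the one in \<open>weak_div\<close>. Integrability is posed on
    \<open>\<Omega>\<close> but the divergence on its interior, hence the extension by zero.\<close>
  define Q where "Q x = indicator U x *\<^sub>R (- q0 x)" for x
  have "Lp_fun (lebesgue_on U) \<alpha> (\<lambda>x. - q0 x)" using Lp_fun_scaleR[OF q0_Lp, of "-1"] by simp
  then have "Q \<in> Lp_space \<Omega> \<alpha>"
    unfolding Q_def[abs_def] Lp_space_iff by (rule Lp_fun_extend_by_zero[OF U(2) \<Omega>leb])
  moreover have "div_eq_measure \<Omega> \<alpha> \<mu>p \<mu>m Q"
    unfolding div_eq_measure_def U_def[symmetric] p_def[symmetric]
  proof (intro ballI allI impI)
    fix \<phi> g assume "\<phi> \<in> W1_mean0 U p" and g: "continuous_representative \<Omega> \<phi> g"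
    then have \<phi>: "\<phi> \<in> W1 U p" by (simp add: W1_mean0_def)
    have "(weak_grad U \<phi>, (LINT x|\<mu>p. g x) - (LINT x|\<mu>m. g x)) \<in> V"
      unfolding V_def using \<phi> weak_grad_W1[OF U(1) \<phi>] g by blast
    from q0[OF this] have "(LINT x|lebesgue_on U. q0 x \<bullet> weak_grad U \<phi> x) = (LINT x|\<mu>p. g x) - (LINT x|\<mu>m. g x)" .
    moreover have "(LINT x|lebesgue_on U. Q x \<bullet> weak_grad U \<phi> x) = (LINT x|lebesgue_on U. - (q0 x \<bullet> weak_grad U \<phi> x))"
      by (intro Bochner_Integration.integral_cong) (auto simp: Q_def)
    ultimately show "weak_div U Q \<phi> = (LINT x|\<mu>p. g x) - (LINT x|\<mu>m. g x)"
      by (simp add: weak_div_def)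
  qed
  ultimately show ?thesis by (auto simp: beckmann_admissible_def)
qed

section \<open>Convexity and limits for the constraint and the objective\<close>

text \<open>The weight is bounded on a set of finite measure, hence in the conjugate Lebesgue space,
  and Hoelder applies.\<close>

lemma integrable_weight_norm:
  fixes q :: "'a::euclidean_space \<Rightarrow> 'b::euclidean_space"
  assumes "compact \<Omega>" "continuous_on \<Omega> w" "1 < \<alpha>" "Lp_fun (lebesgue_on \<Omega>) \<alpha> q"
  shows "integrable (lebesgue_on \<Omega>) (\<lambda>x. w x * norm (q x))"
proof -
  have \<Omega>leb: "\<Omega> \<in> lmeasurable" using assms(1) by (rule lmeasurable_compact)
  have "bounded (w ` \<Omega>)" using assms by (intro compact_imp_bounded compact_continuous_image)
  then obtain B where B: "0 < B" "\<forall>z\<in>w ` \<Omega>. norm z \<le> B" unfolding bounded_pos by blast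
  have m: "w \<in> borel_measurable (lebesgue_on \<Omega>)"
    using \<Omega>leb assms(2) by (intro continuous_imp_measurable_on_sets_lebesgue) auto
  have "integrable (lebesgue_on \<Omega>) (\<lambda>x. \<bar>w x\<bar> powr conj_exp \<alpha>)"
  proof (rule Bochner_Integration.integrable_bound)
    show "integrable (lebesgue_on \<Omega>) (\<lambda>x. B powr conj_exp \<alpha>)"
      by (rule finite_measure.integrable_const[OF finite_measure_lebesgue_on[OF \<Omega>leb]])
    show "AE x in lebesgue_on \<Omega>. norm (\<bar>w x\<bar> powr conj_exp \<alpha>) \<le> norm (B powr conj_exp \<alpha>)"
      using B conj_exp_props[OF assms(3)] by (intro AE_I2) (auto intro!: powr_mono2)
  qed (use m in measurable)
  then have "Lp_fun (lebesgue_on \<Omega>) (conj_exp \<alpha>) w" using m by (simp add: Lp_fun_def)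
  from integrable_inner_Lp(2)[OF assms(3) Lp_fun_norm[OF assms(4)] this]
  show ?thesis by (simp add: mult.commute)
qed

lemma beckmann_admissible_midpoint:
  fixes \<Omega> :: "'a::euclidean_space set"
  assumes \<Omega>: "\<Omega> \<in> sets lebesgue" and \<alpha>: "1 < \<alpha>"
    and a: "a \<in> beckmann_admissible \<Omega> \<alpha> \<mu>p \<mu>m" and b: "b \<in> beckmann_admissible \<Omega> \<alpha> \<mu>p \<mu>m"
  shows "(\<lambda>x. (1/2) *\<^sub>R (a x + b x)) \<in> beckmann_admissible \<Omega> \<alpha> \<mu>p \<mu>m"
proof -
  define U where "U = interior \<Omega>"
  have U: "open U" "U \<in> sets lebesgue" "U \<subseteq> \<Omega>" using interior_subset by (auto simp: U_def)
  have Lp: "Lp_fun (lebesgue_on \<Omega>) \<alpha> a" "Lp_fun (lebesgue_on \<Omega>) \<alpha> b"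
    using a b by (auto simp: beckmann_admissible_def Lp_space_iff)
  then have "(\<lambda>x. (1/2) *\<^sub>R (a x + b x)) \<in> Lp_space \<Omega> \<alpha>"
    unfolding Lp_space_iff using \<alpha> by (intro Lp_fun_scaleR Lp_fun_add) auto
  moreover have "div_eq_measure \<Omega> \<alpha> \<mu>p \<mu>m (\<lambda>x. (1/2) *\<^sub>R (a x + b x))"
    unfolding div_eq_measure_def U_def[symmetric]
  proof (intro ballI allI impI)
    fix \<phi> g assume \<phi>0: "\<phi> \<in> W1_mean0 U (conj_exp \<alpha>)" and g: "continuous_representative \<Omega> \<phi> g"
    then have \<phi>: "\<phi> \<in> W1 U (conj_exp \<alpha>)" by (simp add: W1_mean0_def)
    have int: "integrable (lebesgue_on U) (\<lambda>x. f x \<bullet> weak_grad U \<phi> x)" if "Lp_fun (lebesgue_on \<Omega>) \<alpha> f" for f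
      using integrable_inner_Lp(2)[OF \<alpha> lebesgue_on_subset_Lp_fun[OF U(2) \<Omega> U(3) that] weak_grad_W1(2)[OF U(1) \<phi>]] .
    have "weak_div U a \<phi> = (LINT x|\<mu>p. g x) - (LINT x|\<mu>m. g x)" "weak_div U b \<phi> = (LINT x|\<mu>p. g x) - (LINT x|\<mu>m. g x)"
      using a b \<phi>0 g by (auto simp: beckmann_admissible_def div_eq_measure_def U_def)
    then show "weak_div U (\<lambda>x. (1/2) *\<^sub>R (a x + b x)) \<phi> = (LINT x|\<mu>p. g x) - (LINT x|\<mu>m. g x)"
      using int[OF Lp(1)] int[OF Lp(2)] by (simp add: weak_div_def inner_add_left add_divide_distrib)
  qed
  ultimately show ?thesis by (simp add: beckmann_admissible_def)
qed

text \<open>For fixed \<open>\<phi>\<close> the majorant \<open>h\<close> times the norm of the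
  gradient of \<open>\<phi>\<close> is integrable by conjugacy, so the left side of the constraint
  converges while the right side stays constant.\<close>

lemma beckmann_admissible_closed:
  fixes \<Omega> :: "'a::euclidean_space set" and h :: "'a \<Rightarrow> real"
  assumes \<Omega>: "\<Omega> \<in> sets lebesgue" and \<alpha>: "1 < \<alpha>"
    and f: "\<And>n. f n \<in> beckmann_admissible \<Omega> \<alpha> \<mu>p \<mu>m"
    and q: "Lp_fun (lebesgue_on \<Omega>) \<alpha> q" and h: "Lp_fun (lebesgue_on \<Omega>) \<alpha> h"
    and dom: "AE x in lebesgue_on \<Omega>. \<forall>n. norm (f n x) \<le> h x"
    and conv: "AE x in lebesgue_on \<Omega>. (\<lambda>n. f n x) \<longlonglongrightarrow> q x"
  shows "q \<in> beckmann_admissible \<Omega> \<alpha> \<mu>p \<mu>m"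
proof -
  define U where "U = interior \<Omega>"
  have U: "open U" "U \<in> sets lebesgue" "U \<subseteq> \<Omega>" using interior_subset by (auto simp: U_def)
  have AE_U: "AE x in lebesgue_on U. P x" if "AE x in lebesgue_on \<Omega>. P x" for P
    using that U(3) unfolding lebesgue_on_AE_iff[OF \<Omega>] lebesgue_on_AE_iff[OF U(2)]
    by (auto elim!: eventually_mono)
  have "div_eq_measure \<Omega> \<alpha> \<mu>p \<mu>m q"
    unfolding div_eq_measure_def U_def[symmetric]
  proof (intro ballI allI impI)
    fix \<phi> g assume \<phi>0: "\<phi> \<in> W1_mean0 U (conj_exp \<alpha>)" and g: "continuous_representative \<Omega> \<phi> g"
    then have \<phi>: "\<phi> \<in> W1 U (conj_exp \<alpha>)" by (simp add: W1_mean0_def)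
    note wg = weak_grad_W1(2)[OF U(1) \<phi>]
    have Lp_U: "Lp_fun (lebesgue_on U) \<alpha> k" if "Lp_fun (lebesgue_on \<Omega>) \<alpha> k" for k :: "'a \<Rightarrow> 'b::euclidean_space"
      by (rule lebesgue_on_subset_Lp_fun[OF U(2) \<Omega> U(3) that])
    have fL: "Lp_fun (lebesgue_on \<Omega>) \<alpha> (f n)" for n using f by (auto simp: beckmann_admissible_def Lp_space_iff)
    have "(\<lambda>n. LINT x|lebesgue_on U. f n x \<bullet> weak_grad U \<phi> x) \<longlonglongrightarrow> (LINT x|lebesgue_on U. q x \<bullet> weak_grad U \<phi> x)"
    proof (rule integral_dominated_convergence[where w = "\<lambda>x. norm (h x) * norm (norm (weak_grad U \<phi> x))"])
      show "integrable (lebesgue_on U) (\<lambda>x. norm (h x) * norm (norm (weak_grad U \<phi> x)))"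
        by (rule integrable_inner_Lp(1)[OF \<alpha> Lp_U[OF h] Lp_fun_norm[OF wg]])
      show "(\<lambda>x. q x \<bullet> weak_grad U \<phi> x) \<in> borel_measurable (lebesgue_on U)"
        by (rule borel_measurable_integrable[OF integrable_inner_Lp(2)[OF \<alpha> Lp_U[OF q] wg]])
      show "(\<lambda>x. f n x \<bullet> weak_grad U \<phi> x) \<in> borel_measurable (lebesgue_on U)" for n
        by (rule borel_measurable_integrable[OF integrable_inner_Lp(2)[OF \<alpha> Lp_U[OF fL] wg]])
      show "AE x in lebesgue_on U. (\<lambda>n. f n x \<bullet> weak_grad U \<phi> x) \<longlonglongrightarrow> q x \<bullet> weak_grad U \<phi> x"
        using AE_U[OF conv] by eventually_elim (intro tendsto_intros)
      show "AE x in lebesgue_on U. norm (f n x \<bullet> weak_grad U \<phi> x) \<le> norm (h x) * norm (norm (weak_grad U \<phi> x))" for n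
        using AE_U[OF dom]
      proof eventually_elim
        fix x assume "\<forall>n. norm (f n x) \<le> h x"
        then have "norm (f n x) \<le> norm (h x)" by (simp add: order_trans[OF _ abs_ge_self])
        then show "norm (f n x \<bullet> weak_grad U \<phi> x) \<le> norm (h x) * norm (norm (weak_grad U \<phi> x))"
          using Cauchy_Schwarz_ineq2[of "f n x" "weak_grad U \<phi> x"]
            mult_right_mono[of "norm (f n x)" "norm (h x)" "norm (weak_grad U \<phi> x)"] by simp
      qed
    qed
    then have "(\<lambda>n. weak_div U (f n) \<phi>) \<longlonglongrightarrow> weak_div U q \<phi>"
      unfolding weak_div_def by (rule tendsto_minus)
    moreover have "weak_div U (f n) \<phi> = (LINT x|\<mu>p. g x) - (LINT x|\<mu>m. g x)" for n
      using f[of n] \<phi>0 g by (auto simp: beckmann_admissible_def div_eq_measure_def U_def)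
    ultimately show "weak_div U q \<phi> = (LINT x|\<mu>p. g x) - (LINT x|\<mu>m. g x)"
      by (simp add: LIMSEQ_const_iff)
  qed
  then show ?thesis using q by (simp add: beckmann_admissible_def Lp_space_iff)
qed

text \<open>The power term satisfies the claim with equality, since the added defect is exactly what
  it loses at the midpoint. The weight term is convex by the triangle inequality and
  \<open>w >= 0\<close>.\<close>

lemma beckmann_objective_midpoint:
  fixes \<Omega> :: "'a::euclidean_space set"
  assumes \<Omega>: "compact \<Omega>" and w: "continuous_on \<Omega> w" "\<And>x. x \<in> \<Omega> \<Longrightarrow> 0 \<le> w x" and \<alpha>: "1 < \<alpha>"
    and a: "Lp_fun (lebesgue_on \<Omega>) \<alpha> a" and b: "Lp_fun (lebesgue_on \<Omega>) \<alpha> b"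
  shows "\<epsilon> / \<alpha> * (((LINT x|lebesgue_on \<Omega>. norm (a x) powr \<alpha>) + (LINT x|lebesgue_on \<Omega>. norm (b x) powr \<alpha>)) / 2
      - (LINT x|lebesgue_on \<Omega>. norm ((1/2) *\<^sub>R (a x + b x)) powr \<alpha>))
    + beckmann_objective \<Omega> w \<alpha> \<epsilon> (\<lambda>x. (1/2) *\<^sub>R (a x + b x))
    \<le> (beckmann_objective \<Omega> w \<alpha> \<epsilon> a + beckmann_objective \<Omega> w \<alpha> \<epsilon> b) / 2"
proof -
  have ab: "Lp_fun (lebesgue_on \<Omega>) \<alpha> (\<lambda>x. (1/2) *\<^sub>R (a x + b x))"
    using \<alpha> by (intro Lp_fun_scaleR Lp_fun_add a b) auto
  note int = integrable_weight_norm[OF \<Omega> w(1) \<alpha>]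
  have "(LINT x|lebesgue_on \<Omega>. w x * norm ((1/2) *\<^sub>R (a x + b x)))
      \<le> (LINT x|lebesgue_on \<Omega>. (w x * norm (a x) + w x * norm (b x)) / 2)"
  proof (rule integral_mono)
    show "integrable (lebesgue_on \<Omega>) (\<lambda>x. (w x * norm (a x) + w x * norm (b x)) / 2)"
      using int[OF a] int[OF b] by simp
    fix x assume "x \<in> space (lebesgue_on \<Omega>)"
    then have "w x * norm ((1/2) *\<^sub>R (a x + b x)) \<le> w x * ((norm (a x) + norm (b x)) / 2)"
      using w(2)[of x] norm_triangle_ineq[of "a x" "b x"] by (intro mult_left_mono) auto
    then show "w x * norm ((1/2) *\<^sub>R (a x + b x)) \<le> (w x * norm (a x) + w x * norm (b x)) / 2"
      by (simp add: distrib_left)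
  qed (rule int[OF ab])
  also have "\<dots> = ((LINT x|lebesgue_on \<Omega>. w x * norm (a x)) + (LINT x|lebesgue_on \<Omega>. w x * norm (b x))) / 2"
    using int[OF a] int[OF b] by simp
  finally show ?thesis
    by (simp add: beckmann_objective_def algebra_simps add_divide_distrib)
qed

lemma beckmann_objective_tendsto:
  fixes \<Omega> :: "'a::euclidean_space set" and h :: "'a \<Rightarrow> real"
  assumes \<Omega>: "compact \<Omega>" and w: "continuous_on \<Omega> w" and \<alpha>: "1 < \<alpha>"
    and f: "\<And>n. Lp_fun (lebesgue_on \<Omega>) \<alpha> (f n)"
    and q: "Lp_fun (lebesgue_on \<Omega>) \<alpha> q" and h: "Lp_fun (lebesgue_on \<Omega>) \<alpha> h"
    and dom: "AE x in lebesgue_on \<Omega>. \<forall>n. norm (f n x) \<le> h x"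
    and conv: "AE x in lebesgue_on \<Omega>. (\<lambda>n. f n x) \<longlonglongrightarrow> q x"
  shows "(\<lambda>n. beckmann_objective \<Omega> w \<alpha> \<epsilon> (f n)) \<longlonglongrightarrow> beckmann_objective \<Omega> w \<alpha> \<epsilon> q"
  unfolding beckmann_objective_def
proof (intro tendsto_intros)
  note int = integrable_weight_norm[OF \<Omega> w \<alpha>]
  have dom': "AE x in lebesgue_on \<Omega>. \<forall>n. norm (f n x) \<le> norm (h x)"
    using dom by eventually_elim (auto intro: order_trans)
  show "(\<lambda>n. LINT x|lebesgue_on \<Omega>. w x * norm (f n x)) \<longlonglongrightarrow> (LINT x|lebesgue_on \<Omega>. w x * norm (q x))"
  proof (rule integral_dominated_convergence[where w = "\<lambda>x. \<bar>w x * norm (h x)\<bar>"])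
    show "integrable (lebesgue_on \<Omega>) (\<lambda>x. \<bar>w x * norm (h x)\<bar>)" using int[OF h] by simp
    show "AE x in lebesgue_on \<Omega>. (\<lambda>n. w x * norm (f n x)) \<longlonglongrightarrow> w x * norm (q x)"
      using conv by eventually_elim (intro tendsto_intros)
    show "AE x in lebesgue_on \<Omega>. norm (w x * norm (f n x)) \<le> \<bar>w x * norm (h x)\<bar>" for n
      using dom' by eventually_elim (auto simp: abs_mult intro!: mult_left_mono)
  qed (use int[OF q] int[OF f] in auto)
  show "(\<lambda>n. LINT x|lebesgue_on \<Omega>. norm (f n x) powr \<alpha>) \<longlonglongrightarrow> (LINT x|lebesgue_on \<Omega>. norm (q x) powr \<alpha>)"
  proof (rule integral_dominated_convergence[where w = "\<lambda>x. norm (h x) powr \<alpha>"])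
    show "AE x in lebesgue_on \<Omega>. (\<lambda>n. norm (f n x) powr \<alpha>) \<longlonglongrightarrow> norm (q x) powr \<alpha>"
      using conv by eventually_elim (use \<alpha> in \<open>auto intro!: tendsto_powr' tendsto_norm\<close>)
    show "AE x in lebesgue_on \<Omega>. norm (norm (f n x) powr \<alpha>) \<le> norm (h x) powr \<alpha>" for n
      using dom' by eventually_elim (use \<alpha> in \<open>auto intro!: powr_mono2\<close>)
  qed (use Lp_fun_integrable[OF q] Lp_fun_integrable[OF f] Lp_fun_integrable[OF h] in auto)
qed

theorem corollary2p12:
  fixes \<Omega> :: "(real ^ 'd) set"
    and w :: "real ^ 'd \<Rightarrow> real"
    and \<mu>p \<mu>m :: "(real ^ 'd) measure"
    and \<alpha> \<epsilon> :: real
  assumes "compact \<Omega>"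
    and "closure (interior \<Omega>) = \<Omega>"
    and "bounded_lipschitz_domain (interior \<Omega>)"
    and "continuous_on \<Omega> w"
    and "\<And>x. x \<in> \<Omega> \<Longrightarrow> 0 \<le> w x"
    and "1 < \<alpha>"
    and "CARD('d) = 1 \<or> \<alpha> < real CARD('d) / (real CARD('d) - 1)"
    and "prob_space \<mu>p" and "sets \<mu>p = sets (restrict_space borel \<Omega>)"
    and "prob_space \<mu>m" and "sets \<mu>m = sets (restrict_space borel \<Omega>)"
    and "neumann_uniquely_solvable (interior \<Omega>) (conj_exp \<alpha>)"
    and "\<epsilon> > 0"
  shows "\<exists>q. is_arg_min (beckmann_objective \<Omega> w \<alpha> \<epsilon>)
               (\<lambda>q. q \<in> beckmann_admissible \<Omega> \<alpha> \<mu>p \<mu>m) q \<and>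
             (\<forall>q'. is_arg_min (beckmann_objective \<Omega> w \<alpha> \<epsilon>)
                     (\<lambda>q. q \<in> beckmann_admissible \<Omega> \<alpha> \<mu>p \<mu>m) q' \<longrightarrow>
                   (AE x in lebesgue_on \<Omega>. q' x = q x))"
proof -
  define S where "S = beckmann_admissible \<Omega> \<alpha> \<mu>p \<mu>m"
  define J where "J = beckmann_objective \<Omega> w \<alpha> \<epsilon>"
  define m where "m = Inf (J ` S)"
  note \<alpha> = \<open>1 < \<alpha>\<close>
  have \<Omega>leb: "\<Omega> \<in> sets lebesgue" using fmeasurableD[OF lmeasurable_compact[OF assms(1)]] .
  \<comment> \<open>\<open>\<alpha> < d / (d - 1)\<close> says that the conjugate exponent exceeds
    \<open>d\<close>. For \<open>d = 1\<close> the quotient is a division by zero; there the claim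
    is \<open>1 < conj_exp \<alpha>\<close>.\<close>
  have dim: "real DIM(real ^ 'd) < conj_exp \<alpha>"
  proof (cases "CARD('d) = 1")
    case True
    then show ?thesis using conj_exp_props(1)[OF \<alpha>] by simp
  next
    case False
    moreover have "0 < CARD('d)" by (rule zero_less_card_finite)
    ultimately have "1 < real CARD('d)" by linarith
    then show ?thesis using assms(7) \<alpha> False by (simp add: conj_exp_def field_simps)
  qed
  have S_Lp: "Lp_fun (lebesgue_on \<Omega>) \<alpha> q" if "q \<in> S" for q
    using that by (simp add: S_def beckmann_admissible_def Lp_space_iff)
  have ne: "S \<noteq> {}"
    unfolding S_def by (rule beckmann_admissible_nonempty[OF assms(1-3) \<alpha> dim assms(8-11)])
  have w_int: "0 \<le> (LINT x|lebesgue_on \<Omega>. w x * norm (q x))" for q :: "real ^ 'd \<Rightarrow> real ^ 'd"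
    using assms(5) by (intro Bochner_Integration.integral_nonneg) auto
  have J_ge: "\<epsilon> / \<alpha> * (LINT x|lebesgue_on \<Omega>. norm (q x) powr \<alpha>) \<le> J q" for q
    using w_int[of q] by (simp add: J_def beckmann_objective_def)
  have J0: "0 \<le> J q" for q
    by (rule order_trans[OF _ J_ge]) (use \<alpha> assms(13) in auto)
  have bb: "bdd_below (J ` S)" using J0 by (intro bdd_belowI2)
  have m_le: "m \<le> J q" if "q \<in> S" for q
    unfolding m_def by (intro cInf_lower bb) (use that in auto)
  have bdd: "(LINT x|lebesgue_on \<Omega>. norm (q x) powr \<alpha>) \<le> \<alpha> / \<epsilon> * (m + 1)" if "q \<in> S" "J q \<le> Inf (J ` S) + 1" for q
    using order_trans[OF J_ge[of q] that(2)] \<alpha> assms(13) by (simp add: m_def field_simps)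
  have mid_S: "(\<lambda>t. (1/2) *\<^sub>R (x t + y t)) \<in> S" if "x \<in> S" "y \<in> S" for x y
    using beckmann_admissible_midpoint[OF \<Omega>leb \<alpha>] that by (simp add: S_def)
  have mid_J: "\<epsilon> / \<alpha> * (((LINT t|lebesgue_on \<Omega>. norm (x t) powr \<alpha>) + (LINT t|lebesgue_on \<Omega>. norm (y t) powr \<alpha>)) / 2
      - (LINT t|lebesgue_on \<Omega>. norm ((1/2) *\<^sub>R (x t + y t)) powr \<alpha>)) + J (\<lambda>t. (1/2) *\<^sub>R (x t + y t)) \<le> (J x + J y) / 2"
    if "x \<in> S" "y \<in> S" for x y
    unfolding J_def by (rule beckmann_objective_midpoint[OF assms(1,4,5) \<alpha> S_Lp S_Lp]) (use that in auto)
  have mid: "\<exists>z\<in>S. \<epsilon> / \<alpha> * (((LINT t|lebesgue_on \<Omega>. norm (x t) powr \<alpha>) + (LINT t|lebesgue_on \<Omega>. norm (y t) powr \<alpha>)) / 2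
      - (LINT t|lebesgue_on \<Omega>. norm ((1/2) *\<^sub>R (x t + y t)) powr \<alpha>)) + J z \<le> (J x + J y) / 2"
    if "x \<in> S" "y \<in> S" for x y
    using mid_J[OF that] mid_S[OF that] by blast
  have arg_min: "is_arg_min J (\<lambda>q. q \<in> S) q \<longleftrightarrow> q \<in> S \<and> J q \<le> m" for q
  proof
    assume q: "is_arg_min J (\<lambda>q. q \<in> S) q"
    then have "J q \<le> m" unfolding m_def by (intro cInf_greatest) (use ne in \<open>auto simp: is_arg_min_linorder\<close>)
    then show "q \<in> S \<and> J q \<le> m" using q by (simp add: is_arg_min_def)
  next
    assume "q \<in> S \<and> J q \<le> m"
    then show "is_arg_min J (\<lambda>q. q \<in> S) q"
      unfolding is_arg_min_linorder using m_le by (blast intro: order_trans)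
  qed
  \<comment> \<open>The points are now the fields themselves, so \<open>T\<close> is the identity
    and \<open>\<epsilon> / \<alpha>\<close> is the convexity constant.\<close>
  obtain v q and h :: "real ^ 'd \<Rightarrow> real" where v: "\<And>n. v n \<in> S" "\<And>n. J (v n) < Inf (J ` S) + 1 / real (Suc n)"
    and q: "Lp_fun (lebesgue_on \<Omega>) \<alpha> q" and h: "Lp_fun (lebesgue_on \<Omega>) \<alpha> h"
    and dom: "AE x in lebesgue_on \<Omega>. \<forall>n. norm (v n x) \<le> h x"
    and conv: "AE x in lebesgue_on \<Omega>. (\<lambda>n. v n x) \<longlonglongrightarrow> q x"
    by (rule midpoint_convex_minimizing_sequence[where T = "\<lambda>q. q", OF \<alpha> ne bb S_Lp bdd _ mid])
      (use \<alpha> assms(13) in auto)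
  have qS: "q \<in> S"
    unfolding S_def by (rule beckmann_admissible_closed[OF \<Omega>leb \<alpha> v(1)[unfolded S_def] q h dom conv])
  have "(\<lambda>n. J (v n)) \<longlonglongrightarrow> J q"
    unfolding J_def by (rule beckmann_objective_tendsto[OF assms(1,4) \<alpha> S_Lp[OF v(1)] q h dom conv])
  moreover have "(\<lambda>n. m + 1 / real (Suc n)) \<longlonglongrightarrow> m" by real_asymp
  ultimately have Jq: "J q \<le> m"
    by (rule LIMSEQ_le) (use v(2) in \<open>auto simp: m_def intro: less_imp_le\<close>)
  show ?thesis
    unfolding S_def[symmetric] J_def[symmetric] arg_min
  proof (intro exI[of _ q] conjI allI impI)
    fix q' assume q': "q' \<in> S \<and> J q' \<le> m"
    \<comment> \<open>The midpoint of two minimisers cannot fall below the infimum, so this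
      nonnegative defect has integral 0 and vanishes almost everywhere; strict convexity then forces
      equality there.\<close>
    define D where "D x = (norm (q' x) powr \<alpha> + norm (q x) powr \<alpha>) / 2 - norm ((1/2) *\<^sub>R (q' x + q x)) powr \<alpha>" for x
    have D0: "0 \<le> D x" for x using norm_powr_midpoint[OF \<alpha>, of "q' x" "q x"] by (simp add: D_def)
    have i: "integrable (lebesgue_on \<Omega>) (\<lambda>x. norm (q' x) powr \<alpha>)" "integrable (lebesgue_on \<Omega>) (\<lambda>x. norm (q x) powr \<alpha>)"
      "integrable (lebesgue_on \<Omega>) (\<lambda>x. norm ((1/2) *\<^sub>R (q' x + q x)) powr \<alpha>)"
      using q' by (intro Lp_fun_integrable S_Lp mid_S qS; simp)+
    have D_int: "integrable (lebesgue_on \<Omega>) D"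
      unfolding D_def[abs_def] using i by (intro Bochner_Integration.integrable_diff integrable_divide Bochner_Integration.integrable_add) auto
    have "m \<le> J (\<lambda>t. (1/2) *\<^sub>R (q' t + q t))" using q' qS by (intro m_le mid_S) auto
    then have "\<epsilon> / \<alpha> * (LINT x|lebesgue_on \<Omega>. D x) + m
        \<le> \<epsilon> / \<alpha> * (LINT x|lebesgue_on \<Omega>. D x) + J (\<lambda>t. (1/2) *\<^sub>R (q' t + q t))"
      by (rule add_left_mono)
    also have "\<dots> \<le> (J q' + J q) / 2"
      using mid_J[of q' q] q' qS i by (simp add: D_def)
    also have "\<dots> \<le> (m + m) / 2" using q' Jq by (intro divide_right_mono add_mono) auto
    finally have "\<epsilon> / \<alpha> * (LINT x|lebesgue_on \<Omega>. D x) \<le> 0" by simp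
    then have "(LINT x|lebesgue_on \<Omega>. D x) \<le> 0" using \<alpha> assms(13) by (simp add: divide_le_0_iff mult_le_0_iff)
    then have "(LINT x|lebesgue_on \<Omega>. D x) = 0" using D0 by (intro antisym) auto
    then have "AE x in lebesgue_on \<Omega>. D x = 0"
      using D_int D0 by (subst (asm) integral_nonneg_eq_0_iff_AE) auto
    then show "AE x in lebesgue_on \<Omega>. q' x = q x"
    proof eventually_elim
      fix x assume "D x = 0"
      then show "q' x = q x"
        using norm_powr_midpoint_strict[OF \<alpha>, of "q' x" "q x"] by (cases "q' x = q x") (auto simp: D_def)
    qed
  qed (use qS Jq in auto)
qed

end
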